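(* Let $v\in L^2(\mathbb R_+)$ be real-valued with $\operatorname{supp}v\subset[0,\gamma]$, where $\gamma=\sup\operatorname{supp}v>0$, and let $V=vI_2$. Then the states of $H=H_0+V$ satisfy: 1) The number of eigenvalues is finite. 2) Let $\lambda^{(1)}\in g^+$ be an eigenvalue of $H$ and let $\lambda^{(2)}\in g^-$ be the same number but on the lower rim (the non-physical sheet). Then $\lambda^{(2)}$ is not an anti-bound state. 3) Let $\lambda_1,\lambda_2\in g^+$, $\lambda_1<\lambda_2$, be eigenvalues of $H$ and assume that there are no other eigenvalues on the interval $\omega^{(1)}=(\lambda_1,\lambda_2)\subset g^+$. Let $\omega^{(2)}\subset g^-$ be the same interval but on the lower rim (the non-physical sheet). Then there exists an odd number $\ge1$ of anti-bound states (counted with multiplicities) on $\omega^{(2)}$.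
   Context: Fix an integer $\varkappa\ge1$ and $m>0$; $\mathbb R_+=(0,\infty)$, $\mathbb C_\pm=\{\pm\operatorname{Im}\lambda>0\}$. On $L^2(\mathbb R_+)\oplus L^2(\mathbb R_+)$, $H_0$ is the self-adjoint operator $$H_0=\begin{pmatrix} m & -\partial_x+\frac{\varkappa}{x}\\ \partial_x+\frac{\varkappa}{x} & -m\end{pmatrix},\qquad f_1(0)=0,$$ with $\sigma_{\rm ac}(H_0)=\mathbb R\setminus(-m,m)$. Let $\Lambda=\mathbb C\setminus[-m,m]$ and let $g^+$, $g^-$ denote the upper and lower rims of the cut $(-m,m)$; put $\Lambda_\pm=\mathbb C_\pm\cup g^\pm$. $\Lambda_+$ corresponds to the physical sheet and $\Lambda_-$ to the non-physical sheet: all functions are considered first in $\mathbb C_+$ and are then continued through $\sigma_{\rm ac}(H_0)$ into $\Lambda$ (including the rims). For $h\in C_0(\mathbb R_+,\mathbb C^2)$, $h\neq0$, $\Phi(\lambda)=((H-\lambda)^{-1}h,h)$, $\lambda\in\mathbb C_+$, has such a meromorphic continuation. If, for some such $h$, $\Phi$ has a pole at $\lambda_0\in g^+$, then $\lambda_0$ is called an eigenvalue; if $\Phi$ has a pole at $\lambda_0\in\Lambda_-$, then $\lambda_0$ is called a resonance; $\lambda_0=\pm m$ is a virtual state if $z\mapsto\Phi(\lambda_0+z^2)$ has a pole at $0$. A state is an eigenvalue, a resonance or a virtual state; its multiplicity is the multiplicity of the corresponding pole (maximal order over $h$). A state lying on $g^-$ is called an anti-bound state. *)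

theory Defs
  imports "HOL-Analysis.Analysis" "HOL-Complex_Analysis.Complex_Analysis"
    "HOL-Library.Extended_Nat"
begin

text \<open>Functions on the half-line are total functions on \<^typ>\<open>real\<close>; only their values on
  \<open>(0, \<infinity>)\<close> matter.  A spinor is a function with values in \<^typ>\<open>complex \<times> complex\<close>.\<close>

abbreviation half_line :: "real measure" where
  "half_line \<equiv> lebesgue_on {0<..}"

definition L2 :: "(real \<Rightarrow> 'a::euclidean_space) set" where
  "L2 = {f. f \<in> borel_measurable half_line \<and> integrable half_line (\<lambda>x. (norm (f x))\<^sup>2)}"

definition L2_inner :: "(real \<Rightarrow> complex \<times> complex) \<Rightarrow> (real \<Rightarrow> complex \<times> complex) \<Rightarrow> complex" where
  "L2_inner f g = (LINT x|half_line. fst (f x) * cnj (fst (g x)) + snd (f x) * cnj (snd (g x)))"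

text \<open>The support of an element of \<open>L\<^sup>2(0, \<infinity>)\<close> (an equivalence class): the complement of the
  largest open set on which it vanishes almost everywhere.\<close>

definition ess_supp :: "(real \<Rightarrow> real) \<Rightarrow> real set" where
  "ess_supp v = {x. \<forall>e>0. \<not> (AE y in half_line. y \<in> ball x e \<longrightarrow> v y = 0)}"

text \<open>\<open>f\<close> is locally absolutely continuous on \<open>(0, \<infinity>)\<close> with almost everywhere derivative \<open>f'\<close>.\<close>

definition has_ac_derivative ::
    "(real \<Rightarrow> complex \<times> complex) \<Rightarrow> (real \<Rightarrow> complex \<times> complex) \<Rightarrow> bool" where
  "has_ac_derivative f f' \<longleftrightarrow>
     (\<forall>a b. 0 < a \<longrightarrow> a \<le> b \<longrightarrow> f' absolutely_integrable_on {a..b} \<and> f b - f a = integral {a..b} f')"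

text \<open>Unbounded operators are given by their graphs: \<open>H0_graph \<kappa> m f g\<close> means that \<open>f\<close> (taken to be
  the continuous representative of its class) is in the domain of \<open>H\<^sub>0\<close> and \<open>H\<^sub>0 f = g\<close>.\<close>

definition H0_graph ::
    "nat \<Rightarrow> real \<Rightarrow> (real \<Rightarrow> complex \<times> complex) \<Rightarrow> (real \<Rightarrow> complex \<times> complex) \<Rightarrow> bool" where
  "H0_graph \<kappa> m f g \<longleftrightarrow> f \<in> L2 \<and> g \<in> L2 \<and> ((\<lambda>x. fst (f x)) \<longlongrightarrow> 0) (at_right 0) \<and>
     (\<exists>f'. has_ac_derivative f f' \<and>
        (AE x in half_line.
           fst (g x) = of_real m * fst (f x) - snd (f' x) + of_real (real \<kappa> / x) * snd (f x) \<and>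
           snd (g x) = fst (f' x) + of_real (real \<kappa> / x) * fst (f x) - of_real m * snd (f x)))"

definition H_graph ::
    "nat \<Rightarrow> real \<Rightarrow> (real \<Rightarrow> real) \<Rightarrow>
     (real \<Rightarrow> complex \<times> complex) \<Rightarrow> (real \<Rightarrow> complex \<times> complex) \<Rightarrow> bool" where
  "H_graph \<kappa> m v f g \<longleftrightarrow> (\<lambda>x. v x *\<^sub>R f x) \<in> L2 \<and>
     (\<exists>g0. H0_graph \<kappa> m f g0 \<and> (AE x in half_line. g x = g0 x + v x *\<^sub>R f x))"

text \<open>\<open>resolvent \<kappa> m v \<zeta> h\<close> is \<open>(H - \<zeta>)\<^sup>-\<^sup>1 h\<close>, meaningful for \<open>\<zeta>\<close> in the resolvent set of \<open>H\<close>; there it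
  is determined by its defining property up to irrelevant values on \<open>(-\<infinity>, 0]\<close>.\<close>

definition resolvent ::
    "nat \<Rightarrow> real \<Rightarrow> (real \<Rightarrow> real) \<Rightarrow> complex \<Rightarrow>
     (real \<Rightarrow> complex \<times> complex) \<Rightarrow> (real \<Rightarrow> complex \<times> complex)" where
  "resolvent \<kappa> m v \<zeta> h = (SOME f. \<exists>g. H_graph \<kappa> m v f g \<and>
     (AE x in half_line. (fst (g x) - \<zeta> * fst (f x), snd (g x) - \<zeta> * snd (f x)) = h x))"

definition Phi ::
    "nat \<Rightarrow> real \<Rightarrow> (real \<Rightarrow> real) \<Rightarrow> (real \<Rightarrow> complex \<times> complex) \<Rightarrow> complex \<Rightarrow> complex" where
  "Phi \<kappa> m v h \<zeta> = L2_inner (resolvent \<kappa> m v \<zeta> h) h"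

text \<open>Nonzero elements of \<open>C\<^sub>0((0, \<infinity>), \<complex>\<^sup>2)\<close>: continuous with compact support inside \<open>(0, \<infinity>)\<close>.\<close>

definition test_functions :: "(real \<Rightarrow> complex \<times> complex) set" where
  "test_functions = {h. continuous_on {0<..} h \<and>
     (\<exists>K. compact K \<and> K \<subseteq> {0<..} \<and> (\<forall>x\<in>{0<..} - K. h x = 0)) \<and> (\<exists>x>0. h x \<noteq> 0)}"

text \<open>Continuation from \<open>\<complex>\<^sub>+\<close> to the cut plane \<open>\<Lambda> = \<complex> - [-m, m]\<close>.  Since \<open>\<Lambda>\<close> is connected and the
  two half-planes touch in it only along \<open>\<sigma>\<^sub>a\<^sub>c(H\<^sub>0)\<close>, this is the continuation through \<open>\<sigma>\<^sub>a\<^sub>c(H\<^sub>0)\<close>: on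
  \<open>\<complex>\<^sub>-\<close> it differs in general from the resolvent expression \<^const>\<open>Phi\<close>.\<close>

definition continuation :: "real \<Rightarrow> (complex \<Rightarrow> complex) \<Rightarrow> (complex \<Rightarrow> complex) \<Rightarrow> bool" where
  "continuation m \<Phi> F \<longleftrightarrow> F nicely_meromorphic_on (- complex_of_real ` {-m..m}) \<and>
     (\<forall>\<zeta>. Im \<zeta> > 0 \<longrightarrow> F \<zeta> = \<Phi> \<zeta>)"

text \<open>Points at which states may lie: points of \<open>\<Lambda>\<close>, points of the upper and lower rims of
  the cut \<open>(-m, m)\<close>, and the branch points \<open>\<plusminus>m\<close>.\<close>

datatype cut_point = Inner complex | Upper real | Lower real | Branch real

definition g_plus :: "real \<Rightarrow> cut_point set" where
  "g_plus m = Upper ` {-m<..<m}"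

definition g_minus :: "real \<Rightarrow> cut_point set" where
  "g_minus m = Lower ` {-m<..<m}"

definition Lambda_minus :: "real \<Rightarrow> cut_point set" where
  "Lambda_minus m = Inner ` {\<zeta>. Im \<zeta> < 0} \<union> g_minus m"

definition pole_of_order_at :: "(complex \<Rightarrow> complex) \<Rightarrow> complex \<Rightarrow> nat \<Rightarrow> bool" where
  "pole_of_order_at G z n \<longleftrightarrow> G meromorphic_on {z} \<and> is_pole G z \<and> int n = - zorder G z"

text \<open>\<open>F\<close>, on the part of a punctured neighbourhood of \<open>z\<close> lying in \<open>D\<close>, extends meromorphically to a
  full neighbourhood of \<open>z\<close>, and the extension has a pole of order \<open>n\<close> at \<open>z\<close>.\<close>

definition extension_pole ::
    "(complex \<Rightarrow> complex) \<Rightarrow> complex set \<Rightarrow> complex \<Rightarrow> nat \<Rightarrow> bool" where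
  "extension_pole F D z n \<longleftrightarrow>
     (\<exists>G. pole_of_order_at G z n \<and> (\<forall>\<^sub>F w in at z within D. G w = F w))"

text \<open>A rim point is approached from its own side of the cut.  At a branch point
  \<open>\<mu> = \<plusminus>m\<close> the local variable is \<open>z\<close> with \<open>\<zeta> = \<mu> + z\<^sup>2\<close>, and \<open>\<complex>\<^sub>+\<close> corresponds to the first quadrant.\<close>

fun pole_at :: "(complex \<Rightarrow> complex) \<Rightarrow> cut_point \<Rightarrow> nat \<Rightarrow> bool" where
  "pole_at F (Inner \<zeta>) n = pole_of_order_at F \<zeta> n"
| "pole_at F (Upper x) n = extension_pole F {\<zeta>. Im \<zeta> > 0} (of_real x) n"
| "pole_at F (Lower x) n = extension_pole F {\<zeta>. Im \<zeta> < 0} (of_real x) n"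
| "pole_at F (Branch \<mu>) n =
     extension_pole (\<lambda>z. F (of_real \<mu> + z\<^sup>2)) {z. Re z > 0 \<and> Im z > 0} 0 n"

definition Phi_pole ::
    "nat \<Rightarrow> real \<Rightarrow> (real \<Rightarrow> real) \<Rightarrow> (real \<Rightarrow> complex \<times> complex) \<Rightarrow> cut_point \<Rightarrow> nat \<Rightarrow> bool" where
  "Phi_pole \<kappa> m v h p n \<longleftrightarrow> (\<exists>F. continuation m (Phi \<kappa> m v h) F \<and> pole_at F p n)"

definition has_Phi_pole :: "nat \<Rightarrow> real \<Rightarrow> (real \<Rightarrow> real) \<Rightarrow> cut_point \<Rightarrow> bool" where
  "has_Phi_pole \<kappa> m v p \<longleftrightarrow> (\<exists>h\<in>test_functions. \<exists>n. Phi_pole \<kappa> m v h p n)"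

definition is_eigenvalue :: "nat \<Rightarrow> real \<Rightarrow> (real \<Rightarrow> real) \<Rightarrow> cut_point \<Rightarrow> bool" where
  "is_eigenvalue \<kappa> m v p \<longleftrightarrow> p \<in> g_plus m \<and> has_Phi_pole \<kappa> m v p"

definition is_resonance :: "nat \<Rightarrow> real \<Rightarrow> (real \<Rightarrow> real) \<Rightarrow> cut_point \<Rightarrow> bool" where
  "is_resonance \<kappa> m v p \<longleftrightarrow> p \<in> Lambda_minus m \<and> has_Phi_pole \<kappa> m v p"

definition is_virtual_state :: "nat \<Rightarrow> real \<Rightarrow> (real \<Rightarrow> real) \<Rightarrow> cut_point \<Rightarrow> bool" where
  "is_virtual_state \<kappa> m v p \<longleftrightarrow> p \<in> {Branch m, Branch (-m)} \<and> has_Phi_pole \<kappa> m v p"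

definition is_state :: "nat \<Rightarrow> real \<Rightarrow> (real \<Rightarrow> real) \<Rightarrow> cut_point \<Rightarrow> bool" where
  "is_state \<kappa> m v p \<longleftrightarrow>
     is_eigenvalue \<kappa> m v p \<or> is_resonance \<kappa> m v p \<or> is_virtual_state \<kappa> m v p"

definition is_antibound :: "nat \<Rightarrow> real \<Rightarrow> (real \<Rightarrow> real) \<Rightarrow> cut_point \<Rightarrow> bool" where
  "is_antibound \<kappa> m v p \<longleftrightarrow> is_state \<kappa> m v p \<and> p \<in> g_minus m"

text \<open>The maximal pole order over all test functions; \<open>\<infinity>\<close> if the orders were unbounded.\<close>

definition state_multiplicity :: "nat \<Rightarrow> real \<Rightarrow> (real \<Rightarrow> real) \<Rightarrow> cut_point \<Rightarrow> enat" where
  "state_multiplicity \<kappa> m v p =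
     Sup {enat n | n. \<exists>h\<in>test_functions. Phi_pole \<kappa> m v h p n}"

end

theory Submission
  imports Defs "HOL-Real_Asymp.Real_Asymp"
begin

text \<open>Let \<open>phi\<close> be the solution of \<open>(H - z) f = 0\<close> that is regular at \<open>0\<close> and \<open>psi(s)\<close> the explicit
  free solution behaving like \<open>exp (- s x)\<close> beyond the support of \<open>v\<close>, where \<open>s\<^sup>2 = m\<^sup>2 - z\<^sup>2\<close>.  The
  continuation of \<open>\<Phi>\<close> is \<open>A - C / J\<close> with the Jost function \<open>J(z, s)\<close>, the Wronskian of \<open>phi\<close> and
  \<open>psi(s)\<close>, so that states on the upper and lower rim are the zeros of \<open>J(z, s)\<close> with \<open>s > 0\<close> and
  \<open>s < 0\<close>, with multiplicities.  Both cannot vanish at the same \<open>z\<close>, because \<open>psi(s)\<close> and \<open>psi(- s)\<close>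
  are linearly independent.  The function \<open>t \<mapsto> J(m cos t, m sin t)\<close> is entire, hence has finitely
  many zeros on \<open>[0, \<pi>]\<close>.  At an eigenvalue \<open>psi(s) = c phi\<close>, the derivative of
  \<open>J(z, s(z))\<close> has the sign of \<open>c\<close> by Lagrange's identity, while \<open>J(z, - s)\<close> is \<open>1 / c\<close> times a
  quantity of constant sign.  Since the derivative has opposite signs at consecutive eigenvalues, so
  has \<open>J(z, - s)\<close>, which therefore has an odd number of zeros in between.\<close>

subsection \<open>Absolutely continuous functions\<close>

text \<open>Since \<open>v\<close> is merely square integrable, solutions are absolutely continuous
  rather than differentiable, and all Wronskian arguments are run on integrals. The coefficient
  \<open>\<kappa> / x\<close> rules out an ordinary initial value problem at 0. Factoring out
  \<open>x ^ \<kappa>\<close> leads to a Volterra system with kernels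
  \<open>(y / x) ^ n \<le> 1\<close>, whose Picard terms are polynomials in the spectral parameter;
  this yields holomorphy without differentiating under an integral. \<open>Phi\<close> rests on an
  arbitrary choice among the solutions of the resolvent relation, so the chosen element is paired
  with an explicit solution; the boundary terms vanish because the former is square integrable while
  the latter is O(x) at 0 and bounded at infinity. The sign of the derivative at an eigenvalue rests
  on \<open>c * J' = c\<^sup>2 * N + R\<close>, where \<open>N\<close> is the integral of
  \<open>phi\<^sup>2\<close> up to \<open>\<gamma>\<close>, found from 0, and \<open>R\<close>
  stands for that of \<open>psi\<^sup>2\<close> beyond \<open>\<gamma>\<close>, found from infinity.
  No simplicity of the zeros on the lower rim is claimed, so parity is counted with orders.\<close>

lemma is_interval_Icc_subset: "is_interval I \<Longrightarrow> a \<in> I \<Longrightarrow> b \<in> I \<Longrightarrow> {a..b} \<subseteq> I" for I :: "real set"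
  unfolding is_interval_1 by (meson atLeastAtMost_iff subsetI)

definition ac_on :: "real set \<Rightarrow> (real \<Rightarrow> complex) \<Rightarrow> (real \<Rightarrow> complex) \<Rightarrow> bool" where
  "ac_on I f f' \<longleftrightarrow> (\<forall>a\<in>I. \<forall>b\<in>I. a \<le> b \<longrightarrow>
     f' absolutely_integrable_on {a..b} \<and> f b - f a = integral {a..b} f')"

lemma ac_onD:
  assumes "ac_on I f f'" "a \<in> I" "b \<in> I" "a \<le> b"
  shows "f' absolutely_integrable_on {a..b}" "f b = f a + integral {a..b} f'"
  using assms unfolding ac_on_def by (force, metis add.commute diff_add_cancel)

lemma ac_on_subset: "ac_on I f f' \<Longrightarrow> J \<subseteq> I \<Longrightarrow> ac_on J f f'"
  unfolding ac_on_def by blast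

lemma ac_on_add:
  assumes "ac_on I f f'" "ac_on I g g'"
  shows "ac_on I (\<lambda>x. f x + g x) (\<lambda>x. f' x + g' x)"
  unfolding ac_on_def
proof (intro ballI impI)
  fix a b assume ab: "a \<in> I" "b \<in> I" "a \<le> b"
  note F = ac_onD[OF assms(1) ab] and G = ac_onD[OF assms(2) ab]
  show "(\<lambda>x. f' x + g' x) absolutely_integrable_on {a..b} \<and>
        f b + g b - (f a + g a) = integral {a..b} (\<lambda>x. f' x + g' x)"
    using F G set_lebesgue_integral_eq_integral(1)[OF F(1)] set_lebesgue_integral_eq_integral(1)[OF G(1)]
    by (auto simp: Henstock_Kurzweil_Integration.integral_add)
qed

lemma ac_on_linear:
  assumes "ac_on I f f'" "bounded_linear L"
  shows "ac_on I (\<lambda>x. L (f x)) (\<lambda>x. L (f' x))"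
  unfolding ac_on_def
proof (intro ballI impI)
  fix a b assume ab: "a \<in> I" "b \<in> I" "a \<le> b"
  note F = ac_onD[OF assms(1) ab]
  have "(L \<circ> f') absolutely_integrable_on {a..b}"
    by (intro absolutely_integrable_linear F assms)
  moreover have "integral {a..b} (L \<circ> f') = L (integral {a..b} f')"
    by (intro integral_linear set_lebesgue_integral_eq_integral(1) F assms)
  ultimately show "(\<lambda>x. L (f' x)) absolutely_integrable_on {a..b} \<and>
        L (f b) - L (f a) = integral {a..b} (\<lambda>x. L (f' x))"
    using F linear_add[OF bounded_linear.linear[OF assms(2)]] by (auto simp: o_def)
qed

lemmas ac_on_cmult = ac_on_linear[OF _ bounded_linear_mult_right]
lemmas ac_on_cnj = ac_on_linear[OF _ bounded_linear_cnj]

lemma ac_on_diff: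
  assumes "ac_on I f f'" "ac_on I g g'"
  shows "ac_on I (\<lambda>x. f x - g x) (\<lambda>x. f' x - g' x)"
  using ac_on_add[OF assms(1) ac_on_cmult[OF assms(2), of "-1"]] by simp

lemma ac_on_const: "ac_on I (\<lambda>x. c) (\<lambda>x. 0)"
  unfolding ac_on_def by auto

lemma ac_on_cong_AE:
  assumes f: "ac_on I f f'" and I: "is_interval I"
    and ae: "AE x in lebesgue. x \<in> I \<longrightarrow> f' x = g' x"
  shows "ac_on I f g'"
  unfolding ac_on_def
proof (intro ballI impI)
  fix a b assume ab: "a \<in> I" "b \<in> I" "a \<le> b"
  note F = ac_onD[OF f ab]
  have sub: "{a..b} \<subseteq> I"
    using I ab by (simp add: is_interval_Icc_subset)
  obtain N where N: "negligible N" "{x. \<not> (x \<in> I \<longrightarrow> g' x = f' x)} \<subseteq> N"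
    using ae by (auto simp: eventually_ae_filter negligible_iff_null_sets eq_commute)
  have eq: "\<And>x. x \<in> {a..b} - N \<Longrightarrow> g' x = f' x"
    using N(2) sub by blast
  have "g' absolutely_integrable_on {a..b}"
    using absolutely_integrable_spike[OF F(1) N(1) eq] by auto
  moreover have "integral {a..b} f' = integral {a..b} g'"
    by (rule integral_spike[OF N(1)]) (use eq in auto)
  ultimately show "g' absolutely_integrable_on {a..b} \<and> f b - f a = integral {a..b} g'"
    using F by auto
qed

lemma ac_on_cong:
  assumes f: "ac_on I f f'" and I: "is_interval I"
    and "\<And>x. x \<in> I \<Longrightarrow> g x = f x" "\<And>x. x \<in> I \<Longrightarrow> g' x = f' x"
  shows "ac_on I g g'"
proof -
  have "ac_on I f g'"
    by (rule ac_on_cong_AE[OF f I]) (use assms(4) in auto)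
  thus ?thesis using assms(3) unfolding ac_on_def by simp
qed

lemma ac_on_continuous_Icc:
  assumes "ac_on I f f'" "is_interval I" "a \<in> I" "b \<in> I" "a \<le> b"
  shows "continuous_on {a..b} f"
proof -
  have "continuous_on {a..b} (\<lambda>x. f a + integral {a..x} f')"
    by (intro continuous_intros indefinite_integral_continuous_1
        set_lebesgue_integral_eq_integral(1) ac_onD[OF assms(1,3-5)])
  moreover have "f x = f a + integral {a..x} f'" if "x \<in> {a..b}" for x
  proof -
    have "x \<in> I" using is_interval_Icc_subset[OF assms(2-4)] that by blast
    thus ?thesis using ac_onD(2)[OF assms(1,3)] that by auto
  qed
  ultimately show ?thesis by (metis (mono_tags, lifting) continuous_on_cong)
qed

lemma ac_on_C1:
  assumes I: "is_interval I" and d: "\<And>x. x \<in> I \<Longrightarrow> (f has_vector_derivative f' x) (at x within I)"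
    and c: "continuous_on I f'"
  shows "ac_on I f f'"
  unfolding ac_on_def
proof (intro ballI impI)
  fix a b assume ab: "a \<in> I" "b \<in> I" "a \<le> b"
  have sub: "{a..b} \<subseteq> I"
    using I ab by (simp add: is_interval_Icc_subset)
  have "(f' has_integral (f b - f a)) {a..b}"
    using sub d by (intro fundamental_theorem_of_calculus ab) (blast intro: has_vector_derivative_within_subset)
  moreover have "f' absolutely_integrable_on {a..b}"
    using c sub by (intro absolutely_integrable_continuous_real) (rule continuous_on_subset)
  ultimately show "f' absolutely_integrable_on {a..b} \<and> f b - f a = integral {a..b} f'"
    by (auto simp: integral_unique)
qed

text \<open>Both sides are the integral of \<open>f x * g y\<close> over the square, split along its diagonal.\<close>

lemma Fubini_triangles:
  fixes f g :: "real \<Rightarrow> complex"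
  assumes f: "f absolutely_integrable_on {a..b}" and g: "g absolutely_integrable_on {a..b}"
  shows "(\<lambda>x. f x * integral {a..x} g + integral {a..x} f * g x) absolutely_integrable_on {a..b}"
    and "integral {a..b} (\<lambda>x. f x * integral {a..x} g + integral {a..x} f * g x)
           = integral {a..b} f * integral {a..b} g"
proof -
  define M where "M = lebesgue_on {a..b}"
  have intM: "integrable M h \<longleftrightarrow> h absolutely_integrable_on {a..b}" for h :: "real \<Rightarrow> complex"
    unfolding M_def by (simp add: integrable_restrict_space set_integrable_def)
  have fM: "integrable M f" and gM: "integrable M g"
    using f g by (auto simp: intM)
  have intM_eq: "integral\<^sup>L M h = integral {a..b} h" if "integrable M h" for h :: "real \<Rightarrow> complex"
    using that unfolding intM M_def by (intro lebesgue_integral_eq_integral) (auto simp: integrable_restrict_space set_integrable_def)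
  interpret finite_measure M
    unfolding M_def by (intro finite_measure_lebesgue_on) auto
  interpret P: pair_sigma_finite M M ..
  have meas: "(\<lambda>x. x) \<in> borel_measurable M"
    unfolding M_def by (intro continuous_imp_measurable_on_sets_lebesgue) auto
  have pf [measurable]: "(\<lambda>p. f (fst p)) \<in> borel_measurable (M \<Otimes>\<^sub>M M)"
    using fM by (intro measurable_compose[OF measurable_fst] borel_measurable_integrable) 
  have pg [measurable]: "(\<lambda>p. g (snd p)) \<in> borel_measurable (M \<Otimes>\<^sub>M M)"
    using gM by (intro measurable_compose[OF measurable_snd] borel_measurable_integrable) 
  have m1 [measurable]: "fst \<in> borel_measurable (M \<Otimes>\<^sub>M M)" "snd \<in> borel_measurable (M \<Otimes>\<^sub>M M)"
    using measurable_compose[OF measurable_fst meas] measurable_compose[OF measurable_snd meas]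
    by (auto simp: id_def)
  have FG: "integrable (M \<Otimes>\<^sub>M M) (\<lambda>p. f (fst p) * g (snd p))"
  proof (rule P.Fubini_integrable)
    show "integrable M (\<lambda>x. \<integral>y. norm (f (fst (x, y)) * g (snd (x, y))) \<partial>M)"
      using fM gM by (auto simp: norm_mult)
  qed (use gM in auto)
  have int1: "integrable (M \<Otimes>\<^sub>M M) (\<lambda>p. if snd p \<le> fst p then f (fst p) * g (snd p) else 0)"
    by (rule Bochner_Integration.integrable_bound[OF FG]) auto
  have int2: "integrable (M \<Otimes>\<^sub>M M) (\<lambda>p. if fst p \<le> snd p then f (fst p) * g (snd p) else 0)"
    by (rule Bochner_Integration.integrable_bound[OF FG]) auto
  have part: "integrable M (\<lambda>y. if y \<le> x then h y else 0) \<and>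
       (\<integral>y. (if y \<le> x then h y else 0) \<partial>M) = integral {a..x} h"
    if x: "x \<in> {a..b}" and h: "integrable M h" for x and h :: "real \<Rightarrow> complex"
  proof -
    have hx: "h absolutely_integrable_on {a..x}"
      using h x unfolding intM by (rule_tac absolutely_integrable_on_subinterval) auto
    have i: "integrable M (\<lambda>y. if y \<le> x then h y else 0)"
      using meas h by (intro Bochner_Integration.integrable_bound[OF h]) (auto intro!: measurable_If borel_measurable_integrable)
    hence "(\<integral>y. (if y \<le> x then h y else 0) \<partial>M) = integral {a..b} (\<lambda>y. if y \<le> x then h y else 0)"
      by (rule intM_eq)
    also have "\<dots> = integral {a..b} (\<lambda>y. if y \<in> {a..x} then h y else 0)"
      by (rule integral_cong) auto
    also have "\<dots> = integral {a..x} h"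
      using x by (subst integral_restrict_Int) (auto simp: min_absorb1)
    finally show ?thesis using i by blast
  qed
  have A1: "integrable M (\<lambda>x. \<integral>y. (if y \<le> x then f x * g y else 0) \<partial>M)"
    using P.integrable_fst'[OF int1] by (simp cong: if_cong)
  have A2: "integrable M (\<lambda>y. \<integral>x. (if x \<le> y then f x * g y else 0) \<partial>M)"
    using P.integrable_snd[of "\<lambda>x y. if x \<le> y then f x * g y else 0"] int2 by (simp add: case_prod_beta' cong: if_cong)
  have spM: "space M = {a..b}" by (simp add: M_def)
  have B1: "(\<integral>y. (if y \<le> x then f x * g y else 0) \<partial>M) = f x * integral {a..x} g" if "x \<in> space M" for x
  proof -
    have "(\<integral>y. (if y \<le> x then f x * g y else 0) \<partial>M) = (\<integral>y. f x * (if y \<le> x then g y else 0) \<partial>M)"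
      by (intro Bochner_Integration.integral_cong) auto
    thus ?thesis using part[OF _ gM, of x] that spM by simp
  qed
  have B2: "(\<integral>y. (if y \<le> x then f y * g x else 0) \<partial>M) = integral {a..x} f * g x" if "x \<in> space M" for x
  proof -
    have "(\<integral>y. (if y \<le> x then f y * g x else 0) \<partial>M) = (\<integral>y. (if y \<le> x then f y else 0) * g x \<partial>M)"
      by (intro Bochner_Integration.integral_cong) auto
    thus ?thesis using part[OF _ fM, of x] that spM by simp
  qed
  have C1: "integrable M (\<lambda>x. f x * integral {a..x} g)"
    using A1 by (simp add: B1 cong: Bochner_Integration.integrable_cong)
  have C2: "integrable M (\<lambda>x. integral {a..x} f * g x)"
    using A2 by (simp add: B2 cong: Bochner_Integration.integrable_cong)
  show "(\<lambda>x. f x * integral {a..x} g + integral {a..x} f * g x) absolutely_integrable_on {a..b}"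
    using Bochner_Integration.integrable_add[OF C1 C2] by (simp add: intM)
  have "integral {a..b} (\<lambda>x. f x * integral {a..x} g + integral {a..x} f * g x)
     = (\<integral>x. f x * integral {a..x} g + integral {a..x} f * g x \<partial>M)"
    using Bochner_Integration.integrable_add[OF C1 C2] by (simp add: intM_eq)
  also have "\<dots> = (\<integral>x. f x * integral {a..x} g \<partial>M) + (\<integral>x. integral {a..x} f * g x \<partial>M)"
    using C1 C2 by simp
  also have "(\<integral>x. f x * integral {a..x} g \<partial>M) = (\<integral>x. \<integral>y. (if y \<le> x then f x * g y else 0) \<partial>M \<partial>M)"
    by (intro Bochner_Integration.integral_cong) (auto simp: B1)
  also have "\<dots> = (\<integral>p. (if snd p \<le> fst p then f (fst p) * g (snd p) else 0) \<partial>(M \<Otimes>\<^sub>M M))"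
    using P.integral_fst'[OF int1] by (simp cong: if_cong)
  also have "(\<integral>x. integral {a..x} f * g x \<partial>M) = (\<integral>y. \<integral>x. (if x \<le> y then f x * g y else 0) \<partial>M \<partial>M)"
    by (intro Bochner_Integration.integral_cong) (auto simp: B2)
  also have "\<dots> = (\<integral>p. (if fst p \<le> snd p then f (fst p) * g (snd p) else 0) \<partial>(M \<Otimes>\<^sub>M M))"
    using P.integral_snd[of "\<lambda>x y. if x \<le> y then f x * g y else 0"] int2 by (simp add: case_prod_beta' cong: if_cong)
  also have "(\<integral>p. (if snd p \<le> fst p then f (fst p) * g (snd p) else 0) \<partial>(M \<Otimes>\<^sub>M M)) + \<dots>
     = (\<integral>p. (if snd p \<le> fst p then f (fst p) * g (snd p) else 0) + 
             (if fst p \<le> snd p then f (fst p) * g (snd p) else 0) \<partial>(M \<Otimes>\<^sub>M M))"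
    using int1 int2 by simp
  also have "\<dots> = (\<integral>x. \<integral>y. (if y \<le> x then f x * g y else 0) + (if x \<le> y then f x * g y else 0) \<partial>M \<partial>M)"
    using P.integral_fst'[OF Bochner_Integration.integrable_add[OF int1 int2]] by (simp cong: if_cong)
  also have "\<dots> = (\<integral>x. \<integral>y. f x * g y \<partial>M \<partial>M)"
  proof (rule Bochner_Integration.integral_cong[OF refl])
    fix x
    \<comment> \<open>The two closed triangles overlap in the diagonal, which meets each vertical
      line in a single point.\<close>
    have ae: "AE y in M. y \<noteq> x"
      unfolding M_def by (intro AE_restrict_space_iff[THEN iffD2]) (auto intro!: AE_I'[of "{x}"])
    have m: "(\<lambda>y. if y \<le> x then h y else 0) \<in> borel_measurable M"
       "(\<lambda>y. if x \<le> y then h y else 0) \<in> borel_measurable M"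
      if "h \<in> borel_measurable M" for h :: "real \<Rightarrow> complex"
      using that meas by (auto intro!: measurable_If)
    show "(\<integral>y. (if y \<le> x then f x * g y else 0) + (if x \<le> y then f x * g y else 0) \<partial>M) = (\<integral>y. f x * g y \<partial>M)"
    proof (rule integral_cong_AE)
      show "AE y in M. (if y \<le> x then f x * g y else 0) + (if x \<le> y then f x * g y else 0) = f x * g y"
        using ae by eventually_elim auto
    next
      show fg: "(\<lambda>y. f x * g y) \<in> borel_measurable M"
        using gM by (intro borel_measurable_times borel_measurable_integrable) auto
      show "(\<lambda>y. (if y \<le> x then f x * g y else 0) + (if x \<le> y then f x * g y else 0)) \<in> borel_measurable M"
        by (intro borel_measurable_add m fg)
    qed
  qed
  also have "\<dots> = integral {a..b} f * integral {a..b} g"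
    using fM gM by (simp add: intM_eq)
  finally show "integral {a..b} (\<lambda>x. f x * integral {a..x} g + integral {a..x} f * g x)
           = integral {a..b} f * integral {a..b} g" .
qed

text \<open>Each factor is its value at \<open>a\<close> plus a primitive. The product of the two
  primitives is covered by \<open>Fubini_triangles\<close>, and the remaining terms are linear in
  \<open>f'\<close> or \<open>g'\<close>.\<close>

lemma ac_on_mult:
  assumes f: "ac_on I f f'" and g: "ac_on I g g'" and I: "is_interval I"
  shows "ac_on I (\<lambda>x. f x * g x) (\<lambda>x. f' x * g x + f x * g' x)"
  unfolding ac_on_def
proof (intro ballI impI)
  fix a b assume ab: "a \<in> I" "b \<in> I" "a \<le> b"
  note F = ac_onD[OF f ab] and G = ac_onD[OF g ab]
  have xI: "x \<in> I" if "x \<in> {a..b}" for x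
    using is_interval_Icc_subset[OF I ab(1,2)] that by blast
  have Fx: "f x = f a + integral {a..x} f'" and Gx: "g x = g a + integral {a..x} g'" if "x \<in> {a..b}" for x
    using ac_onD(2)[OF f ab(1) xI[OF that]] ac_onD(2)[OF g ab(1) xI[OF that]] that by auto
  let ?D = "\<lambda>x. f' x * integral {a..x} g' + integral {a..x} f' * g' x"
  have eq: "f' x * g x + f x * g' x = ?D x + (f' x * g a + f a * g' x)" if "x \<in> {a..b}" for x
    using Fx[OF that] Gx[OF that] by (simp add: algebra_simps)
  note D = Fubini_triangles[OF F(1) G(1)]
  have E1: "(\<lambda>x. f' x * g a) absolutely_integrable_on {a..b}"
    using absolutely_integrable_linear[OF F(1) bounded_linear_mult_left] by (simp add: o_def)
  have E2: "(\<lambda>x. f a * g' x) absolutely_integrable_on {a..b}"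
    using absolutely_integrable_linear[OF G(1) bounded_linear_mult_right] by (simp add: o_def)
  have E: "(\<lambda>x. f' x * g a + f a * g' x) absolutely_integrable_on {a..b}"
    using E1 E2 by auto
  have A: "(\<lambda>x. ?D x + (f' x * g a + f a * g' x)) absolutely_integrable_on {a..b}"
    using D(1) E by (rule set_integral_add(1))
  have A': "(\<lambda>x. f' x * g x + f x * g' x) absolutely_integrable_on {a..b}"
    by (rule absolutely_integrable_spike[OF A negligible_empty]) (use eq in auto)
  have "integral {a..b} (\<lambda>x. f' x * g x + f x * g' x)
     = integral {a..b} (\<lambda>x. ?D x + (f' x * g a + f a * g' x))"
    by (intro integral_cong eq)
  also have "\<dots> = integral {a..b} ?D + (integral {a..b} (\<lambda>x. f' x * g a) + integral {a..b} (\<lambda>x. f a * g' x))"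
    using set_lebesgue_integral_eq_integral(1)[OF D(1)] set_lebesgue_integral_eq_integral(1)[OF E1]
      set_lebesgue_integral_eq_integral(1)[OF E2] set_lebesgue_integral_eq_integral(1)[OF E]
    by (simp add: Henstock_Kurzweil_Integration.integral_add)
  also have "\<dots> = f b * g b - f a * g a"
    using D(2) F(2) G(2) by (simp add: algebra_simps)
  finally show "(\<lambda>x. f' x * g x + f x * g' x) absolutely_integrable_on {a..b} \<and>
      f b * g b - f a * g a = integral {a..b} (\<lambda>x. f' x * g x + f x * g' x)"
    using A' by simp
qed

lemma ac_on_zero_deriv:
  assumes "ac_on I f f'" "\<And>x. x \<in> I \<Longrightarrow> f' x = 0" "is_interval I" "a \<in> I" "b \<in> I"
  shows "f a = f b"
proof -
  have *: "f a = f b" if "a \<le> b" "a \<in> I" "b \<in> I" for a b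
  proof -
    have "integral {a..b} f' = integral {a..b} (\<lambda>x. 0)"
      using is_interval_Icc_subset[OF assms(3) that(2,3)] by (intro integral_cong assms(2)) blast
    thus ?thesis using ac_onD(2)[OF assms(1) that(2,3,1)] by simp
  qed
  show ?thesis using linorder_linear[of a b] *[OF _ assms(4,5)] *[OF _ assms(5,4)] by metis
qed

lemma ac_on_mono:
  assumes "ac_on I f f'" "is_interval I" "\<And>x. x \<in> I \<Longrightarrow> f' x \<in> \<real> \<and> Re (f' x) \<ge> 0" "a \<in> I" "b \<in> I" "a \<le> b"
  shows "Re (f a) \<le> Re (f b)"
proof -
  note F = ac_onD[OF assms(1,4-6)]
  have i: "f' integrable_on {a..b}" using F(1) by (rule set_lebesgue_integral_eq_integral(1))
  have "Re (integral {a..b} f') = integral {a..b} (\<lambda>x. Re (f' x))"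
    using integral_linear[OF i bounded_linear_Re] by (simp add: o_def)
  also have "\<dots> \<ge> 0"
    using assms by (intro Henstock_Kurzweil_Integration.integral_nonneg integrable_linear[OF i bounded_linear_Re, unfolded o_def])
      (use is_interval_Icc_subset[OF assms(2,4,5)] in blast)
  finally show ?thesis using F(2) by simp
qed

subsection \<open>Volterra systems with an entire parameter\<close>

text \<open>Integrability reaches down to 0 itself, in contrast to \<open>ac_on {0<..}\<close>; this
  is what allows a Volterra equation to start at the singular end point.\<close>

definition loc_int :: "(real \<Rightarrow> complex) \<Rightarrow> bool" where
  "loc_int w \<longleftrightarrow> (\<forall>X. w absolutely_integrable_on {0..X})"

text \<open>The solution of \<open>u' = - (n / x) * u + w * f\<close> that vanishes at 0, obtained
  with the integrating factor \<open>x ^ n\<close>. At \<open>x = 0\<close> the integral is over one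
  point, so the value is 0 whatever the inverse is.\<close>

definition volt :: "nat \<Rightarrow> (real \<Rightarrow> complex) \<Rightarrow> (real \<Rightarrow> complex) \<Rightarrow> real \<Rightarrow> complex" where
  "volt n w f x = inverse (of_real x ^ n) * integral {0..x} (\<lambda>y. of_real y ^ n * (w y * f y))"

lemma loc_int_mult:
  assumes "loc_int w" "continuous_on {0..} f"
  shows "loc_int (\<lambda>y. w y * f y)"
  unfolding loc_int_def
proof
  fix X
  have c: "continuous_on {0..X} f" using assms(2) by (rule continuous_on_subset) auto
  have "(\<lambda>y. f y * w y) absolutely_integrable_on {0..X}"
  proof (rule absolutely_integrable_bounded_measurable_product[OF bilinear_times])
    show "f \<in> borel_measurable (lebesgue_on {0..X})"
      using c by (intro continuous_imp_measurable_on_sets_lebesgue) auto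
    show "bounded (f ` {0..X})"
      using c by (intro compact_imp_bounded compact_continuous_image) auto
  qed (use assms in \<open>auto simp: loc_int_def\<close>)
  thus "(\<lambda>y. w y * f y) absolutely_integrable_on {0..X}" by (simp add: mult.commute)
qed

lemma loc_int_continuous: "continuous_on {0..} f \<Longrightarrow> loc_int f"
  unfolding loc_int_def
  by (intro allI absolutely_integrable_continuous_real) (auto elim: continuous_on_subset)

lemma loc_int_add: "loc_int f \<Longrightarrow> loc_int g \<Longrightarrow> loc_int (\<lambda>x. f x + g x)"
  unfolding loc_int_def by auto

lemma loc_int_integrable: "loc_int f \<Longrightarrow> f integrable_on {0..X}"
  unfolding loc_int_def by (metis set_lebesgue_integral_eq_integral(1))

lemma loc_int_volt:
  assumes "loc_int w" "continuous_on {0..} f"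
  shows "loc_int (\<lambda>y. of_real y ^ n * (w y * f y))"
  using loc_int_mult[OF loc_int_mult[OF assms], of "\<lambda>y. of_real y ^ n"]
  by (simp add: mult.commute continuous_intros)

lemma volt_add:
  assumes "loc_int w" "continuous_on {0..} f" "continuous_on {0..} g"
  shows "volt n w (\<lambda>y. f y + g y) x = volt n w f x + volt n w g x"
proof -
  have "integral {0..x} (\<lambda>y. of_real y ^ n * (w y * (f y + g y)))
      = integral {0..x} (\<lambda>y. of_real y ^ n * (w y * f y) + of_real y ^ n * (w y * g y))"
    by (intro integral_cong) (simp add: algebra_simps)
  also have "\<dots> = integral {0..x} (\<lambda>y. of_real y ^ n * (w y * f y)) + integral {0..x} (\<lambda>y. of_real y ^ n * (w y * g y))"
    by (intro Henstock_Kurzweil_Integration.integral_add loc_int_integrable loc_int_volt assms)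
  finally show ?thesis by (simp add: volt_def algebra_simps)
qed

lemma volt_mult_right: "volt n w (\<lambda>y. f y * c) x = volt n w f x * c"
proof -
  have "integral {0..x} (\<lambda>y. of_real y ^ n * (w y * (f y * c)))
      = integral {0..x} (\<lambda>y. (of_real y ^ n * (w y * f y)) * c)"
    by (intro integral_cong) (simp add: algebra_simps)
  thus ?thesis by (simp add: volt_def)
qed

lemma volt_weight:
  assumes "loc_int u" "continuous_on {0..} f"
  shows "volt n (\<lambda>y. u y + c) f x = volt n u f x + volt n (\<lambda>_. 1) f x * c"
proof -
  have "integral {0..x} (\<lambda>y. of_real y ^ n * ((u y + c) * f y))
      = integral {0..x} (\<lambda>y. of_real y ^ n * (u y * f y) + (of_real y ^ n * (1 * f y)) * c)"
    by (intro integral_cong) (simp add: algebra_simps)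
  also have "\<dots> = integral {0..x} (\<lambda>y. of_real y ^ n * (u y * f y)) + integral {0..x} (\<lambda>y. (of_real y ^ n * (1 * f y)) * c)"
    by (intro Henstock_Kurzweil_Integration.integral_add integrable_on_mult_left loc_int_integrable loc_int_volt assms loc_int_continuous continuous_intros)
  finally show ?thesis by (simp add: volt_def algebra_simps)
qed

text \<open>On \<open>{0..x}\<close> the effective weight is \<open>(y / x) ^ n \<le> 1\<close>, so
  the bound does not depend on \<open>n\<close> and shows no singularity at 0.\<close>

lemma volt_bound:
  assumes "loc_int w" "continuous_on {0..} f" "x \<ge> 0"
    and g: "\<And>y. y \<in> {0..x} \<Longrightarrow> norm (w y * f y) \<le> g y" "g integrable_on {0..x}"
  shows "norm (volt n w f x) \<le> integral {0..x} g"
proof (cases "x = 0")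
  case False
  with assms have x: "x > 0" by simp
  have "norm (integral {0..x} (\<lambda>y. of_real y ^ n * (w y * f y))) \<le> integral {0..x} (\<lambda>y. x ^ n * g y)"
  proof (rule integral_norm_bound_integral)
    fix y assume y: "y \<in> {0..x}"
    have "norm (complex_of_real y ^ n) \<le> x ^ n"
      using y by (simp add: norm_power power_mono)
    thus "norm (complex_of_real y ^ n * (w y * f y)) \<le> x ^ n * g y"
      using g(1)[OF y] x unfolding norm_mult[of "complex_of_real y ^ n"]
      by (intro mult_mono) auto
  qed (use assms in \<open>auto intro!: loc_int_integrable loc_int_volt integrable_on_mult_right\<close>)
  also have "\<dots> = x ^ n * integral {0..x} g" by simp
  finally have "inverse (x ^ n) * norm (integral {0..x} (\<lambda>y. of_real y ^ n * (w y * f y)))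
      \<le> inverse (x ^ n) * (x ^ n * integral {0..x} g)"
    using x by (intro mult_left_mono) auto
  also have "\<dots> = integral {0..x} g" using x by simp
  finally show ?thesis
    using x by (simp add: volt_def norm_mult norm_inverse norm_power)
qed (auto simp: volt_def)

lemma continuous_on_atLeast:
  fixes f :: "real \<Rightarrow> 'a::topological_space"
  assumes "\<And>X. continuous_on {0..X} f"
  shows "continuous_on {0..} f"
  unfolding continuous_on_eq_continuous_within
proof
  fix x :: real assume x: "x \<in> {0..}"
  have "at x within {0..x+1} = at x within {0..}"
    by (rule at_within_nhd[of _ "{..<x+1}"]) auto
  moreover have "continuous (at x within {0..x+1}) f"
    using assms[of "x+1"] x by (auto simp: continuous_on_eq_continuous_within)
  ultimately show "continuous (at x within {0..}) f" by (metis)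
qed

text \<open>At 0 the factor \<open>inverse (x ^ n)\<close> may blow up; continuity there comes from
  \<open>volt_bound\<close>, which dominates the value by the primitive \<open>H\<close>, and
  \<open>H\<close> tends to 0.\<close>

lemma continuous_volt:
  assumes "loc_int w" "continuous_on {0..} f"
  shows "continuous_on {0..} (volt n w f)"
proof (rule continuous_on_atLeast)
  fix X
  define H where "H = (\<lambda>x. integral {0..x} (\<lambda>y. norm (w y * f y)))"
  have ai: "(\<lambda>y. w y * f y) absolutely_integrable_on {0..X}"
    using loc_int_mult[OF assms] by (auto simp: loc_int_def)
  have iX: "(\<lambda>y. norm (w y * f y)) integrable_on {0..x}" for x
    using loc_int_mult[OF assms] by (auto simp: loc_int_def absolutely_integrable_on_def)
  have H: "continuous_on {0..X} H"
    unfolding H_def by (intro indefinite_integral_continuous_1 iX)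
  have I: "continuous_on {0..X} (\<lambda>x. integral {0..x} (\<lambda>y. of_real y ^ n * (w y * f y)))"
    by (intro indefinite_integral_continuous_1 loc_int_integrable loc_int_volt assms)
  show "continuous_on {0..X} (volt n w f)"
    unfolding continuous_on_eq_continuous_within
  proof
    fix x assume x: "x \<in> {0..X}"
    show "continuous (at x within {0..X}) (volt n w f)"
    proof (cases "x = 0")
      case False
      thus ?thesis using x I unfolding volt_def[abs_def]
        by (intro continuous_intros) (auto simp: continuous_on_eq_continuous_within)
    next
      case True
      have 0: "volt n w f 0 = 0" by (simp add: volt_def)
      have "(H \<longlongrightarrow> H 0) (at 0 within {0..X})"
        using H x True by (auto simp: continuous_on_eq_continuous_within continuous_within)
      hence "(H \<longlongrightarrow> 0) (at 0 within {0..X})" by (simp add: H_def)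
      moreover have "norm (volt n w f y) \<le> H y" if "y \<in> {0..X}" for y
        using that unfolding H_def by (intro volt_bound assms iX) auto
      hence "\<forall>\<^sub>F y in at 0 within {0..X}. norm (volt n w f y) \<le> H y"
        by (auto simp: eventually_at_filter)
      ultimately have "(volt n w f \<longlongrightarrow> 0) (at 0 within {0..X})"
        by (rule Lim_null_comparison[rotated])
      thus ?thesis using True 0 by (simp add: continuous_within)
    qed
  qed
qed

text \<open>Volterra operators with weights affine in \<open>z\<close> preserve this class, so all
  Picard terms belong to it. Integration over \<open>x\<close> acts on the coefficients alone, which
  makes holomorphy in \<open>z\<close> immediate.\<close>

inductive poly_param :: "(real \<Rightarrow> complex \<Rightarrow> complex) \<Rightarrow> bool" where
  monom: "continuous_on {0..} c \<Longrightarrow> poly_param (\<lambda>x z. c x * z ^ j)"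
| add: "poly_param F \<Longrightarrow> poly_param G \<Longrightarrow> poly_param (\<lambda>x z. F x z + G x z)"

lemma poly_param_const: "continuous_on {0..} c \<Longrightarrow> poly_param (\<lambda>x z. c x)"
  using poly_param.monom[of c 0] by simp

lemma poly_param_sum: "(\<And>i. i < (k::nat) \<Longrightarrow> poly_param (F i)) \<Longrightarrow> poly_param (\<lambda>x z. \<Sum>i<k. F i x z)"
  by (induction k) (auto intro: poly_param.add poly_param_const)

lemma poly_param_continuous:
  "poly_param F \<Longrightarrow> continuous_on ({0..} \<times> UNIV) (\<lambda>(x, z). F x z)"
proof (induction rule: poly_param.induct)
  case (monom c j)
  have "continuous_on ({0..} \<times> UNIV) (\<lambda>p::real \<times> complex. c (fst p))"
    by (rule continuous_on_compose2[OF monom]) (auto intro: continuous_intros)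
  thus ?case by (auto simp: case_prod_beta' intro!: continuous_intros)
next
  case (add F G)
  thus ?case by (auto simp: case_prod_beta' intro!: continuous_intros)
qed

lemma continuous_param_fst:
  assumes "continuous_on ({0..} \<times> UNIV) (\<lambda>(x::real, z::complex). F x z)"
  shows "continuous_on {0..} (\<lambda>x. F x z)"
proof -
  have "continuous_on {0..} (\<lambda>x. (\<lambda>(x, z). F x z) (x, z))"
    by (rule continuous_on_compose2[OF assms]) (auto intro: continuous_intros)
  thus ?thesis by simp
qed

lemmas poly_param_continuous_fst = continuous_param_fst[OF poly_param_continuous]

lemma poly_param_holomorphic: "poly_param F \<Longrightarrow> F x holomorphic_on UNIV"
  by (induction rule: poly_param.induct) (auto intro!: holomorphic_intros)

lemma poly_param_integral_holomorphic:
  assumes "poly_param F" and g: "continuous_on {0..X} g"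
  shows "(\<lambda>z. integral {0..X} (\<lambda>x. g x * F x z)) holomorphic_on UNIV"
  using assms(1)
proof (induction rule: poly_param.induct)
  case (monom c j)
  have "integral {0..X} (\<lambda>x. g x * (c x * z ^ j)) = integral {0..X} (\<lambda>x. g x * c x) * z ^ j" for z
    using integral_mult_left[of "{0..X}" "\<lambda>x. g x * c x" "z^j"] by (simp add: mult.assoc)
  thus ?case by (auto intro!: holomorphic_intros)
next
  case (add F G)
  have c: "continuous_on {0..X} (\<lambda>x. F x z)" "continuous_on {0..X} (\<lambda>x. G x z)" for z
    using add.hyps by (auto intro: continuous_on_subset[OF poly_param_continuous_fst])
  have "integral {0..X} (\<lambda>x. g x * (F x z + G x z)) = 
        integral {0..X} (\<lambda>x. g x * F x z) + integral {0..X} (\<lambda>x. g x * G x z)" for z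
    unfolding distrib_left
    by (intro Henstock_Kurzweil_Integration.integral_add integrable_continuous_real continuous_intros c g)
  thus ?case using add.IH by (auto intro!: holomorphic_intros)
qed

lemma poly_param_mult_param: "poly_param F \<Longrightarrow> poly_param (\<lambda>x z. F x z * (a * z))"
proof (induction rule: poly_param.induct)
  case (monom c j)
  have "poly_param (\<lambda>x z. (c x * a) * z ^ Suc j)"
    by (intro poly_param.monom continuous_intros monom)
  thus ?case by (simp add: algebra_simps)
next
  case (add F G)
  thus ?case using poly_param.add[OF add.IH] by (simp add: distrib_right)
qed

lemma poly_param_volt:
  assumes "loc_int w" "poly_param F"
  shows "poly_param (\<lambda>x z. volt n w (\<lambda>y. F y z) x)"
  using assms(2)
proof (induction rule: poly_param.induct)
  case (monom c j)
  show ?case unfolding volt_mult_right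
    by (intro poly_param.monom continuous_volt assms monom)
next
  case (add F G)
  have "volt n w (\<lambda>y. F y z + G y z) x = volt n w (\<lambda>y. F y z) x + volt n w (\<lambda>y. G y z) x" for x z
    by (intro volt_add assms poly_param_continuous_fst add)
  thus ?case using poly_param.add[OF add.IH] by simp
qed

text \<open>Uniformity on the sets \<open>{0..X} \<times> cball 0 R\<close> transfers joint
  continuity, holomorphy in the parameter and holomorphy of integrals over \<open>x\<close> from the
  approximants to the limit.\<close>

definition entire_param :: "(real \<Rightarrow> complex \<Rightarrow> complex) \<Rightarrow> bool" where
  "entire_param F \<longleftrightarrow> (\<exists>S. (\<forall>n::nat. poly_param (S n)) \<and>
     (\<forall>X R. uniform_limit ({0..X} \<times> cball 0 R) (\<lambda>n (x, z). S n x z) (\<lambda>(x, z). F x z) sequentially))"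

lemma entire_param_continuous:
  assumes "entire_param F"
  shows "continuous_on ({0..} \<times> UNIV) (\<lambda>(x, z). F x z)"
proof -
  obtain S where S: "\<And>n. poly_param (S n)"
    and u: "\<And>X R. uniform_limit ({0..X} \<times> cball 0 R) (\<lambda>n (x, z). S n x z) (\<lambda>(x, z). F x z) sequentially"
    using assms unfolding entire_param_def by blast
  have c: "continuous_on ({0..X} \<times> cball 0 R) (\<lambda>(x, z). F x z)" for X R
  proof (rule uniform_limit_theorem[OF _ u])
    have "continuous_on ({0..X} \<times> cball 0 R) (\<lambda>(x, z). S n x z)" for n
      by (rule continuous_on_subset[OF poly_param_continuous[OF S]]) auto
    thus "\<forall>\<^sub>F n in sequentially. continuous_on ({0..X} \<times> cball 0 R) (\<lambda>(x, z). S n x z)"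
      by simp
  qed auto
  show ?thesis
    unfolding continuous_on_eq_continuous_within
  proof
    fix p :: "real \<times> complex" assume p: "p \<in> {0..} \<times> UNIV"
    obtain x z where xz: "p = (x, z)" by force
    have "at p within {0..x+1} \<times> cball 0 (norm z + 1) = at p within {0..} \<times> UNIV"
      by (rule at_within_nhd[of _ "{..<x+1} \<times> ball 0 (norm z + 1)"])
        (auto simp: xz intro!: open_Times)
    moreover have "continuous (at p within {0..x+1} \<times> cball 0 (norm z + 1)) (\<lambda>(x, z). F x z)"
      using c[of "x+1" "norm z + 1"] p xz by (auto simp: continuous_on_eq_continuous_within)
    ultimately show "continuous (at p within {0..} \<times> UNIV) (\<lambda>(x, z). F x z)" by metis
  qed
qed

lemmas entire_param_continuous_fst = continuous_param_fst[OF entire_param_continuous]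

lemma entire_param_holomorphic:
  assumes "entire_param F" "x \<ge> 0"
  shows "F x holomorphic_on UNIV"
proof -
  obtain S where S: "\<And>n. poly_param (S n)"
    and u: "\<And>X R. uniform_limit ({0..X} \<times> cball 0 R) (\<lambda>n (x, z). S n x z) (\<lambda>(x, z). F x z) sequentially"
    using assms unfolding entire_param_def by blast
  show ?thesis
  proof (rule holomorphic_uniform_sequence)
    show "S n x holomorphic_on UNIV" for n by (rule poly_param_holomorphic[OF S])
    fix z :: complex
    have "uniform_limit (cball z 1) (\<lambda>n z. S n x z) (F x) sequentially"
    proof (rule uniform_limitI)
      fix e :: real assume "e > 0"
      have sub: "(x, w) \<in> {0..x} \<times> cball 0 (norm z + 1)" if "w \<in> cball z 1" for w
        using that assms(2) norm_triangle_sub[of w z] by (auto simp: dist_norm norm_minus_commute)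
      from uniform_limitD[OF u[of x "norm z + 1"] \<open>e > 0\<close>]
      show "\<forall>\<^sub>F n in sequentially. \<forall>w\<in>cball z 1. dist (S n x w) (F x w) < e"
        by eventually_elim (use sub in force)
    qed
    thus "\<exists>d>0. cball z d \<subseteq> UNIV \<and> uniform_limit (cball z d) (\<lambda>n. S n x) (F x) sequentially"
      by (intro exI[of _ 1]) auto
  qed auto
qed

text \<open>The integrals of the approximants are holomorphic in \<open>z\<close> and converge
  uniformly on discs, so the limit is holomorphic with no derivative taken inside the
  integral.\<close>

lemma entire_param_integral_holomorphic:
  assumes "entire_param F" and g: "continuous_on {0..X} g"
  shows "(\<lambda>z. integral {0..X} (\<lambda>x. g x * F x z)) holomorphic_on UNIV"
proof -
  obtain S where S: "\<And>n. poly_param (S n)"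
    and u: "\<And>X R. uniform_limit ({0..X} \<times> cball 0 R) (\<lambda>n (x, z). S n x z) (\<lambda>(x, z). F x z) sequentially"
    using assms unfolding entire_param_def by blast
  have cF: "continuous_on {0..X} (\<lambda>x. F x z)" for z
    by (rule continuous_on_subset[OF entire_param_continuous_fst[OF assms(1)]]) auto
  have cS: "continuous_on {0..X} (\<lambda>x. S n x z)" for z n
    by (rule continuous_on_subset[OF poly_param_continuous_fst[OF S]]) auto
  obtain B where B: "B > 0" "\<And>x. x \<in> {0..X} \<Longrightarrow> norm (g x) \<le> B"
    using compact_imp_bounded[OF compact_continuous_image[OF g compact_Icc]] unfolding bounded_pos by auto
  show ?thesis
  proof (rule holomorphic_uniform_sequence)
    show "(\<lambda>z. integral {0..X} (\<lambda>x. g x * S n x z)) holomorphic_on UNIV" for n 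
      by (rule poly_param_integral_holomorphic[OF S g])
    fix z :: complex
    have "uniform_limit (cball z 1) (\<lambda>n z. integral {0..X} (\<lambda>x. g x * S n x z))
       (\<lambda>z. integral {0..X} (\<lambda>x. g x * F x z)) sequentially"
    proof (rule uniform_limitI)
      fix e :: real assume "e > 0"
      \<comment> \<open>The summand 1 keeps the denominator positive for every \<open>X\<close> and
        makes the final estimate strict, since
        \<open>\<bar>X\<bar> / (\<bar>X\<bar> + 1) < 1\<close>.\<close>
      define d where "d = e / (B * (\<bar>X\<bar> + 1))"
      have "d > 0" using \<open>e > 0\<close> B by (auto simp: d_def)
      have sub: "w \<in> cball 0 (norm z + 1)" if "w \<in> cball z 1" for w
        using that norm_triangle_sub[of w z] by (auto simp: dist_norm norm_minus_commute)
      from uniform_limitD[OF u[of X "norm z + 1"] \<open>d > 0\<close>]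
      show "\<forall>\<^sub>F n in sequentially. \<forall>w\<in>cball z 1. dist (integral {0..X} (\<lambda>x. g x * S n x w)) (integral {0..X} (\<lambda>x. g x * F x w)) < e"
      proof eventually_elim
        case (elim n)
        show ?case
        proof
          fix w assume w: "w \<in> cball z 1"
          have "integral {0..X} (\<lambda>x. g x * S n x w) - integral {0..X} (\<lambda>x. g x * F x w)
            = integral {0..X} (\<lambda>x. g x * S n x w - g x * F x w)"
            by (intro Henstock_Kurzweil_Integration.integral_diff[symmetric] integrable_continuous_real continuous_intros g cS cF)
          also have "norm \<dots> \<le> integral {0..X} (\<lambda>x. B * d)"
          proof (rule integral_norm_bound_integral)
            show "(\<lambda>x. g x * S n x w - g x * F x w) integrable_on {0..X}"
              by (intro integrable_continuous_real continuous_intros g cS cF)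
            fix x assume x: "x \<in> {0..X}"
            have "norm (S n x w - F x w) \<le> d"
              using elim x sub[OF w] by (force simp: dist_norm)
            thus "norm (g x * S n x w - g x * F x w) \<le> B * d"
              using B(2)[OF x] B(1) by (auto simp flip: right_diff_distrib simp: norm_mult intro!: mult_mono)
          qed auto
          also have "\<dots> \<le> \<bar>X\<bar> * (B * d)"
            using B \<open>d > 0\<close> by (cases "X \<ge> 0") (auto intro: mult_nonpos_nonneg)
          also have "\<dots> = e * (\<bar>X\<bar> / (\<bar>X\<bar> + 1))"
            using B by (simp add: d_def)
          also have "\<dots> < e * 1"
            using \<open>e > 0\<close> by (intro mult_strict_left_mono) auto
          finally have "norm (integral {0..X} (\<lambda>x. g x * S n x w) - integral {0..X} (\<lambda>x. g x * F x w)) < e"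
            by simp
          thus "dist (integral {0..X} (\<lambda>x. g x * S n x w)) (integral {0..X} (\<lambda>x. g x * F x w)) < e"
            by (simp add: dist_norm)
        qed
      qed
    qed
    thus "\<exists>d>0. cball z d \<subseteq> UNIV \<and> uniform_limit (cball z d) (\<lambda>n z. integral {0..X} (\<lambda>x. g x * S n x z))
       (\<lambda>z. integral {0..X} (\<lambda>x. g x * F x z)) sequentially"
      by (intro exI[of _ 1]) auto
  qed auto
qed

lemma poly_param_mult: "poly_param F \<Longrightarrow> continuous_on {0..} c \<Longrightarrow> poly_param (\<lambda>x z. c x * F x z)"
proof (induction rule: poly_param.induct)
  case (monom c' j)
  have "poly_param (\<lambda>x z. (c x * c' x) * z ^ j)"
    by (intro poly_param.monom continuous_intros monom)
  thus ?case by (simp add: algebra_simps)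
next
  case (add F G)
  thus ?case using poly_param.add[OF add.IH] by (simp add: distrib_left)
qed

lemma entire_param_mult:
  assumes "entire_param F" and c: "continuous_on {0..} c"
  shows "entire_param (\<lambda>x z. c x * F x z)"
proof -
  obtain S where S: "\<And>n. poly_param (S n)"
    and u: "\<And>X R. uniform_limit ({0..X} \<times> cball 0 R) (\<lambda>n (x, z). S n x z) (\<lambda>(x, z). F x z) sequentially"
    using assms unfolding entire_param_def by blast
  have "uniform_limit ({0..X} \<times> cball 0 R) (\<lambda>n (x, z). c x * S n x z) (\<lambda>(x, z). c x * F x z) sequentially" for X R
  proof (rule uniform_limitI)
    fix e :: real assume e: "e > 0"
    have "bounded (c ` {0..X})"
      using c by (auto intro!: compact_imp_bounded compact_continuous_image elim: continuous_on_subset)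
    then obtain B where B: "B > 0" "\<forall>x\<in>{0..X}. norm (c x) \<le> B"
      unfolding bounded_pos ball_simps by blast
    from e B have "e / B > 0" by simp
    from uniform_limitD[OF u[of X R] this]
    show "\<forall>\<^sub>F n in sequentially. \<forall>p\<in>{0..X} \<times> cball 0 R. dist (case p of (x, z) \<Rightarrow> c x * S n x z) (case p of (x, z) \<Rightarrow> c x * F x z) < e"
    proof eventually_elim
      case (elim n)
      show ?case
      proof safe
        fix x z assume xz: "x \<in> {0..X}" "z \<in> cball (0::complex) R"
        have d: "norm (S n x z - F x z) < e / B" using elim xz by (force simp: dist_norm)
        have "norm (c x * S n x z - c x * F x z) = norm (c x) * norm (S n x z - F x z)"
          by (simp flip: norm_mult add: algebra_simps)
        also have "\<dots> \<le> B * norm (S n x z - F x z)" using B xz by (intro mult_right_mono) auto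
        also have "\<dots> < e" using d B by (simp add: field_simps)
        finally show "dist (c x * S n x z) (c x * F x z) < e" by (simp add: dist_norm)
      qed
    qed
  qed
  thus ?thesis unfolding entire_param_def
    by (intro exI[of _ "\<lambda>n x z. c x * S n x z"]) (use S c poly_param_mult in blast)
qed

lemma loc_int_ac_on:
  assumes "loc_int w"
  shows "ac_on {0..} (\<lambda>x. integral {0..x} w) w"
  unfolding ac_on_def
proof (intro ballI impI conjI)
  fix a b :: real assume ab: "a \<in> {0..}" "b \<in> {0..}" "a \<le> b"
  have "w absolutely_integrable_on {0..b}" "{a..b} \<subseteq> {0..b}"
    using assms ab unfolding loc_int_def by auto
  thus "w absolutely_integrable_on {a..b}" by (rule absolutely_integrable_on_subinterval)
  have "integral {0..a} w + integral {a..b} w = integral {0..b} w"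
    using ab by (intro Henstock_Kurzweil_Integration.integral_combine loc_int_integrable assms) auto
  thus "integral {0..b} w - integral {0..a} w = integral {a..b} w" by (metis add_diff_cancel_left')
qed

text \<open>The chain rule for powers of a primitive of \<open>\<rho>\<close>, obtained by iterating
  \<open>ac_on_mult\<close> because \<open>\<rho>\<close> is merely integrable. It is the source of
  the factorials in the Picard estimate. The passage to complex values is due to the type of
  \<open>ac_on\<close>.\<close>

lemma integral_mult_primitive_power:
  fixes \<rho> :: "real \<Rightarrow> real"
  assumes "loc_int (\<lambda>x. of_real (\<rho> x))" "x \<ge> 0"
  shows "(\<lambda>y. \<rho> y * integral {0..y} \<rho> ^ k) integrable_on {0..x}"
    and "integral {0..x} (\<lambda>y. \<rho> y * integral {0..y} \<rho> ^ k) = integral {0..x} \<rho> ^ Suc k / Suc k"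
proof -
  define P where "P = (\<lambda>x. integral {0..x} \<rho>)"
  have iv: "is_interval {0::real..}" by (simp add: is_interval_ci)
  have Pc: "integral {0..x} (\<lambda>y. of_real (\<rho> y)) = complex_of_real (P x)" for x
  proof -
    have "(\<lambda>y. Re (of_real (\<rho> y))) integrable_on {0..x}"
      using integrable_linear[OF loc_int_integrable[OF assms(1)] bounded_linear_Re] by (simp add: o_def)
    hence "\<rho> integrable_on {0..x}" by simp
    thus ?thesis
      using integral_linear[of \<rho> "{0..x}" complex_of_real] by (simp add: P_def o_def bounded_linear_of_real)
  qed
  have 1: "ac_on {0..} (\<lambda>x. complex_of_real (P x)) (\<lambda>x. of_real (\<rho> x))"
    using loc_int_ac_on[OF assms(1)] by (simp add: Pc)
  have 2: "ac_on {0..} (\<lambda>x. complex_of_real (P x) ^ Suc k) (\<lambda>x. of_nat (Suc k) * (of_real (\<rho> x) * of_real (P x) ^ k))"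
  proof (induction k)
    case 0 thus ?case using 1 by simp
  next
    case (Suc k)
    show ?case using ac_on_mult[OF 1 Suc iv] by (simp add: algebra_simps)
  qed
  have "P 0 = 0" by (simp add: P_def)
  have A: "(\<lambda>y. of_nat (Suc k) * (of_real (\<rho> y) * complex_of_real (P y) ^ k)) absolutely_integrable_on {0..x}"
    and B: "complex_of_real (P x) ^ Suc k = integral {0..x} (\<lambda>y. of_nat (Suc k) * (of_real (\<rho> y) * of_real (P y) ^ k))"
    using ac_onD[OF 2, of 0 x] assms(2) \<open>P 0 = 0\<close> by auto
  have C: "(\<lambda>y. of_nat (Suc k) * (of_real (\<rho> y) * complex_of_real (P y) ^ k)) integrable_on {0..x}"
    using A by (rule set_lebesgue_integral_eq_integral(1))
  have Re: "Re (of_nat (Suc k) * (of_real (\<rho> y) * complex_of_real (P y) ^ k)) = Suc k * (\<rho> y * P y ^ k)" for y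
    by (simp flip: of_real_power of_real_mult del: of_nat_Suc)
  have D: "((\<lambda>y. Suc k * (\<rho> y * P y ^ k)) has_integral P x ^ Suc k) {0..x}"
    using has_integral_linear[OF integrable_integral[OF C] bounded_linear_Re]
    unfolding o_def Re B[symmetric] by (simp flip: of_real_power of_real_mult)
  hence E: "((\<lambda>y. (1 / Suc k) * (Suc k * (\<rho> y * P y ^ k))) has_integral (1 / Suc k) * (P x ^ Suc k)) {0..x}"
    by (rule has_integral_mult_right)
  hence F: "((\<lambda>y. \<rho> y * P y ^ k) has_integral P x ^ Suc k / Suc k) {0..x}"
    by (simp del: of_nat_Suc)
  from F show "(\<lambda>y. \<rho> y * integral {0..y} \<rho> ^ k) integrable_on {0..x}"
    unfolding P_def by blast
  from F show "integral {0..x} (\<lambda>y. \<rho> y * integral {0..y} \<rho> ^ k) = integral {0..x} \<rho> ^ Suc k / Suc k"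
    unfolding P_def by (rule integral_unique)
qed

lemma integral_in_Reals:
  fixes f :: "real \<Rightarrow> complex"
  assumes "\<And>x. x \<in> S \<Longrightarrow> f x \<in> \<real>"
  shows "integral S f \<in> \<real>"
proof (cases "f integrable_on S")
  case True
  have "Im (integral S f) = integral S (\<lambda>x. Im (f x))"
    using integral_linear[OF True bounded_linear_Im] by (simp add: o_def)
  also have "\<dots> = integral S (\<lambda>x. 0)"
    by (intro integral_cong) (use assms in \<open>auto simp: complex_is_Real_iff\<close>)
  finally show ?thesis by (simp add: complex_is_Real_iff)
qed (simp add: not_integrable_integral)

lemma volt_in_Reals:
  "(\<And>y. w y \<in> \<real>) \<Longrightarrow> (\<And>y. f y \<in> \<real>) \<Longrightarrow> volt n w f x \<in> \<real>"
  unfolding volt_def by (intro Reals_mult Reals_inverse integral_in_Reals Reals_power) auto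

text \<open>These are the terms of the Neumann series, not its partial sums. Each step exchanges the
  components: once the diagonal part is absorbed into integrating factors, the coupling is purely
  off-diagonal.\<close>

primrec picard ::
  "nat \<Rightarrow> nat \<Rightarrow> (complex \<Rightarrow> real \<Rightarrow> complex) \<Rightarrow> (complex \<Rightarrow> real \<Rightarrow> complex) \<Rightarrow>
   (real \<Rightarrow> complex) \<Rightarrow> (real \<Rightarrow> complex) \<Rightarrow> nat \<Rightarrow>
   (real \<Rightarrow> complex \<Rightarrow> complex) \<times> (real \<Rightarrow> complex \<Rightarrow> complex)" where
  "picard n l p q \<alpha> \<beta> 0 = (\<lambda>x z. \<alpha> x, \<lambda>x z. \<beta> x)"
| "picard n l p q \<alpha> \<beta> (Suc k) =
     (\<lambda>x z. volt n (p z) (\<lambda>y. snd (picard n l p q \<alpha> \<beta> k) y z) x,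
      \<lambda>x z. volt l (q z) (\<lambda>y. fst (picard n l p q \<alpha> \<beta> k) y z) x)"

text \<open>On \<open>cball 0 R\<close> both weights are dominated by \<open>\<rho> R\<close>, so
  the \<open>k\<close>-th terms are at most \<open>M * (P R x ^ k / fact k)\<close>, where
  \<open>P R\<close> is the primitive of \<open>\<rho> R\<close>, and the series converges locally
  uniformly. With real data every term is real at real \<open>z\<close>, and the limit inherits
  this.\<close>

lemma volterra_system:
  fixes u1 u2 \<alpha> \<beta> :: "real \<Rightarrow> complex" and c1 c2 :: complex
  assumes u: "loc_int u1" "loc_int u2" and ab: "continuous_on {0..} \<alpha>" "continuous_on {0..} \<beta>"
  shows "\<exists>a b. entire_param a \<and> entire_param b \<and>
    (\<forall>x z. x \<ge> 0 \<longrightarrow> a x z = \<alpha> x + volt n (\<lambda>y. u1 y + c1 * z) (\<lambda>y. b y z) x) \<and>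
    (\<forall>x z. x \<ge> 0 \<longrightarrow> b x z = \<beta> x + volt l (\<lambda>y. u2 y + c2 * z) (\<lambda>y. a y z) x) \<and>
    (c1 \<in> \<real> \<longrightarrow> c2 \<in> \<real> \<longrightarrow> (\<forall>x. u1 x \<in> \<real> \<and> u2 x \<in> \<real> \<and> \<alpha> x \<in> \<real> \<and> \<beta> x \<in> \<real>) \<longrightarrow>
          (\<forall>x z. x \<ge> 0 \<longrightarrow> z \<in> \<real> \<longrightarrow> a x z \<in> \<real> \<and> b x z \<in> \<real>))"
proof -
  define p where "p = (\<lambda>z y. u1 y + c1 * z)"
  define q where "q = (\<lambda>z y. u2 y + c2 * z)"
  define A where "A = (\<lambda>k. fst (picard n l p q \<alpha> \<beta> k))"
  define B where "B = (\<lambda>k. snd (picard n l p q \<alpha> \<beta> k))"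
  have A0: "A 0 x z = \<alpha> x" and B0: "B 0 x z = \<beta> x" for x z by (simp_all add: A_def B_def)
  have AS: "A (Suc k) x z = volt n (p z) (\<lambda>y. B k y z) x"
    and BS: "B (Suc k) x z = volt l (q z) (\<lambda>y. A k y z) x" for k x z
    by (simp_all add: A_def B_def)
  have li: "loc_int (p z)" "loc_int (q z)" for z
    unfolding p_def q_def by (intro loc_int_add u loc_int_continuous continuous_intros)+
  have volt_poly: "poly_param (\<lambda>x z. volt N (\<lambda>y. w y + c * z) (\<lambda>y. F y z) x)"
    if w: "loc_int w" and F: "poly_param F" for N w c F
  proof -
    have "volt N (\<lambda>y. w y + c * z) (\<lambda>y. F y z) x
        = volt N w (\<lambda>y. F y z) x + volt N (\<lambda>_. 1) (\<lambda>y. F y z) x * (c * z)" for x z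
      by (intro volt_weight w poly_param_continuous_fst F)
    thus ?thesis
      by (simp only:) (intro poly_param.add poly_param_mult_param poly_param_volt w F loc_int_continuous continuous_intros)
  qed
  have poly: "poly_param (A k) \<and> poly_param (B k)" for k
  proof (induction k)
    case 0
    have "A 0 = (\<lambda>x z. \<alpha> x)" "B 0 = (\<lambda>x z. \<beta> x)" by (intro ext; simp add: A0 B0)+
    thus ?case using ab by (auto intro!: poly_param_const)
  next
    case (Suc k)
    have "A (Suc k) = (\<lambda>x z. volt n (p z) (\<lambda>y. B k y z) x)" "B (Suc k) = (\<lambda>x z. volt l (q z) (\<lambda>y. A k y z) x)"
      by (intro ext; simp add: AS BS)+
    thus ?case using Suc u by (auto simp: p_def q_def intro!: volt_poly)
  qed
  have cA: "continuous_on {0..} (\<lambda>y. A k y z)" and cB: "continuous_on {0..} (\<lambda>y. B k y z)" for k z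
    using poly by (auto intro: poly_param_continuous_fst)
  \<comment> \<open>The absolute value keeps the majorant nonnegative for every \<open>R\<close>,
    also for negative ones, where the disc is empty.\<close>
  define \<rho> where "\<rho> = (\<lambda>R y. norm (u1 y) + norm (u2 y) + (norm c1 + norm c2) * \<bar>R\<bar>)"
  define P where "P = (\<lambda>R x. integral {0..x} (\<rho> R))"
  have P_eq: "integral {0..x} (\<rho> R) = P R x" for R x by (simp add: P_def)
  have \<rho>: "loc_int (\<lambda>x. of_real (\<rho> R x))" for R
  proof -
    have n: "loc_int (\<lambda>x. of_real (norm (w x)))" if "loc_int w" for w
    proof -
      have "(\<lambda>x. norm (w x)) absolutely_integrable_on {0..X}" for X
        using that by (auto simp: loc_int_def intro: absolutely_integrable_norm[unfolded o_def])
      thus ?thesis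
        using absolutely_integrable_linear[OF _ bounded_linear_of_real]
        unfolding loc_int_def o_def by blast
    qed
    show ?thesis unfolding \<rho>_def of_real_add by (intro loc_int_add n u loc_int_continuous continuous_intros)
  qed
  have \<rho>0: "\<rho> R y \<ge> 0" for R y by (simp add: \<rho>_def)
  have \<rho>i: "(\<rho> R) integrable_on {0..x}" for R x
    using integrable_linear[OF loc_int_integrable[OF \<rho>] bounded_linear_Re] by (simp add: o_def)
  have P0: "P R x \<ge> 0" for R x unfolding P_def by (intro Henstock_Kurzweil_Integration.integral_nonneg \<rho>i \<rho>0)
  have Pmono: "P R x \<le> P R X" if "x \<le> X" for R x X
    unfolding P_def by (intro integral_subset_le \<rho>i) (use that \<rho>0 in auto)
  have pq: "norm (p z y) \<le> \<rho> R y" "norm (q z y) \<le> \<rho> R y" if "norm z \<le> R" for z y R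
  proof -
    have "norm (c1 * z) \<le> norm c1 * \<bar>R\<bar>" "norm (c2 * z) \<le> norm c2 * \<bar>R\<bar>"
      using that by (auto simp: norm_mult intro!: mult_left_mono)
    moreover have "0 \<le> norm c1 * \<bar>R\<bar>" "0 \<le> norm c2 * \<bar>R\<bar>" by auto
    ultimately show "norm (p z y) \<le> \<rho> R y" "norm (q z y) \<le> \<rho> R y"
      using norm_triangle_ineq[of "u1 y" "c1 * z"] norm_triangle_ineq[of "u2 y" "c2 * z"]
        norm_ge_zero[of "u1 y"] norm_ge_zero[of "u2 y"]
      unfolding p_def q_def \<rho>_def distrib_right by linarith+
  qed
  have bound: "\<exists>M\<ge>0. \<forall>k. \<forall>x\<in>{0..X}. \<forall>z\<in>cball 0 R. norm (A k x z) \<le> M * (P R x ^ k / fact k) \<and> norm (B k x z) \<le> M * (P R x ^ k / fact k)" for X R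
  proof -
    have "bounded (\<alpha> ` {0..X})" "bounded (\<beta> ` {0..X})"
      using ab by (auto intro!: compact_imp_bounded compact_continuous_image elim: continuous_on_subset)
    then obtain M1 M2 where M: "\<forall>x\<in>{0..X}. norm (\<alpha> x) \<le> M1" "\<forall>x\<in>{0..X}. norm (\<beta> x) \<le> M2"
      unfolding bounded_iff ball_simps by blast
    define M where "M = max 0 (max M1 M2)"
    have "norm (A k x z) \<le> M * (P R x ^ k / fact k) \<and> norm (B k x z) \<le> M * (P R x ^ k / fact k)"
      if "x \<in> {0..X}" "z \<in> cball 0 R" for k x z
      using that
    proof (induction k arbitrary: x)
      case 0
      thus ?case using M by (force simp: A0 B0 M_def)
    next
      case (Suc k)
      \<comment> \<open>The majorant of the integrand at stage \<open>k\<close> integrates exactly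
        to the bound claimed for \<open>Suc k\<close>.\<close>
      let ?g = "\<lambda>y. (M / fact k) * (\<rho> R y * P R y ^ k)"
      have x: "x \<ge> 0" using Suc by simp
      note I = integral_mult_primitive_power[where k = k, OF \<rho>[of R] x, unfolded P_eq]
      have gi: "?g integrable_on {0..x}" by (intro integrable_on_mult_right I(1))
      have "integral {0..x} ?g = (M / fact k) * (P R x ^ Suc k / Suc k)"
        unfolding I(2)[symmetric] by simp
      also have "\<dots> = M * (P R x ^ Suc k / fact (Suc k))" by (simp add: field_simps)
      finally have gI: "integral {0..x} ?g = M * (P R x ^ Suc k / fact (Suc k))" .
      have g: "norm (p z y * B k y z) \<le> ?g y" "norm (q z y * A k y z) \<le> ?g y" if y: "y \<in> {0..x}" for y
      proof -
        have "y \<in> {0..X}" using y Suc by auto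
        note IH = Suc.IH[OF this Suc.prems(2)]
        have R: "norm z \<le> R" using Suc by simp
        have "norm (p z y * B k y z) \<le> \<rho> R y * (M * (P R y ^ k / fact k))"
             "norm (q z y * A k y z) \<le> \<rho> R y * (M * (P R y ^ k / fact k))"
          unfolding norm_mult by (intro mult_mono pq[OF R] \<rho>0 conjunct1[OF IH] conjunct2[OF IH] norm_ge_zero)+
        thus "norm (p z y * B k y z) \<le> ?g y" "norm (q z y * A k y z) \<le> ?g y"
          by (simp_all add: mult_ac)
      qed
      show ?case
        unfolding AS BS gI[symmetric]
        by (intro conjI volt_bound li cA cB x gi g)
    qed
    thus ?thesis by (intro exI[of _ M]) (auto simp: M_def)
  qed
  define a where "a = (\<lambda>x z. \<Sum>k. A k x z)"
  define b where "b = (\<lambda>x z. \<Sum>k. B k x z)"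
  have ulim: "uniform_limit ({0..X} \<times> cball 0 R) (\<lambda>n (x, z). \<Sum>k<n. A k x z) (\<lambda>(x, z). a x z) sequentially \<and>
              uniform_limit ({0..X} \<times> cball 0 R) (\<lambda>n (x, z). \<Sum>k<n. B k x z) (\<lambda>(x, z). b x z) sequentially" for X R
  proof -
    obtain M where M: "M \<ge> 0" "\<And>k x z. x \<in> {0..X} \<Longrightarrow> z \<in> cball 0 R \<Longrightarrow> norm (A k x z) \<le> M * (P R x ^ k / fact k) \<and> norm (B k x z) \<le> M * (P R x ^ k / fact k)"
      using bound[of X R] by metis
    define Q where "Q = (\<lambda>k. M * (P R X ^ k / fact k))"
    have "summable Q"
      unfolding Q_def by (intro summable_mult) (use summable_exp[of "P R X"] in \<open>simp add: divide_inverse mult.commute\<close>)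
    moreover have "norm (A k x z) \<le> Q k \<and> norm (B k x z) \<le> Q k" if "x \<in> {0..X}" "z \<in> cball 0 R" for k x z
    proof -
      have "M * (P R x ^ k / fact k) \<le> Q k"
        unfolding Q_def using that M(1) P0 Pmono by (intro mult_left_mono divide_right_mono power_mono) auto
      thus ?thesis using M(2)[OF that, of k] by linarith
    qed
    ultimately show ?thesis
      using Weierstrass_m_test[of "{0..X} \<times> cball 0 R" "\<lambda>k (x, z). A k x z" Q]
        Weierstrass_m_test[of "{0..X} \<times> cball 0 R" "\<lambda>k (x, z). B k x z" Q]
      unfolding a_def b_def by (auto simp: case_prod_beta')
  qed
  have ea: "entire_param a" unfolding entire_param_def
    by (rule exI[of _ "\<lambda>n x z. \<Sum>k<n. A k x z"]) (use poly ulim in \<open>auto intro: poly_param_sum\<close>)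
  have eb: "entire_param b" unfolding entire_param_def
    by (rule exI[of _ "\<lambda>n x z. \<Sum>k<n. B k x z"]) (use poly ulim in \<open>auto intro: poly_param_sum\<close>)
  have limA: "(\<lambda>n. \<Sum>k<n. A k x z) \<longlonglongrightarrow> a x z" and limB: "(\<lambda>n. \<Sum>k<n. B k x z) \<longlonglongrightarrow> b x z" if "x \<ge> 0" for x z
    using tendsto_uniform_limitI[OF conjunct1[OF ulim[of x "norm z"]], of "(x, z)"]
      tendsto_uniform_limitI[OF conjunct2[OF ulim[of x "norm z"]], of "(x, z)"] that by auto
  \<comment> \<open>Uniform convergence on \<open>{0..x}\<close> passes through the Volterra
    operator, whose value at \<open>x\<close> changes by at most \<open>P (norm z) x\<close> times
    the uniform error.\<close>
  have volt_lim: "(\<lambda>n. volt N w (\<lambda>y. \<Sum>k<n. C k y z) x) \<longlonglongrightarrow> volt N w (\<lambda>y. c y z) x"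
    if w: "loc_int w" "\<And>y. norm (w y) \<le> \<rho> (norm z) y"
      and C: "\<And>k. continuous_on {0..} (\<lambda>y. C k y z)" and c: "continuous_on {0..} (\<lambda>y. c y z)"
      and u: "uniform_limit ({0..x} \<times> cball 0 (norm z)) (\<lambda>n (x, z). \<Sum>k<n. C k x z) (\<lambda>(x, z). c x z) sequentially"
      and x: "x \<ge> 0"
    for N w C c x z
  proof (rule tendstoI)
    fix e :: real assume e: "e > 0"
    define d where "d = e / (P (norm z) x + 1)"
    have d: "d > 0" using e P0[of "norm z" x] by (simp add: d_def)
    from uniform_limitD[OF u d]
    show "\<forall>\<^sub>F n in sequentially. dist (volt N w (\<lambda>y. \<Sum>k<n. C k y z) x) (volt N w (\<lambda>y. c y z) x) < e"
    proof eventually_elim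
      case (elim n)
      let ?s = "\<lambda>y. \<Sum>k<n. C k y z"
      have cs: "continuous_on {0..} ?s" by (intro continuous_intros C)
      have "volt N w ?s x - volt N w (\<lambda>y. c y z) x = volt N w (\<lambda>y. ?s y + c y z * (-1)) x"
        unfolding volt_add[OF w(1) cs continuous_on_mult_right[OF c]] volt_mult_right by simp
      also have "norm \<dots> \<le> integral {0..x} (\<lambda>y. \<rho> (norm z) y * d)"
      proof (rule volt_bound[OF w(1) _ x])
        show "continuous_on {0..} (\<lambda>y. ?s y + c y z * (-1))" by (intro continuous_intros cs c)
        show "(\<lambda>y. \<rho> (norm z) y * d) integrable_on {0..x}" by (intro integrable_on_mult_left \<rho>i)
        fix y assume "y \<in> {0..x}"
        hence "norm (?s y + c y z * (-1)) \<le> d" using elim by (force simp: dist_norm)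
        thus "norm (w y * (?s y + c y z * (-1))) \<le> \<rho> (norm z) y * d"
          unfolding norm_mult using w(2) d \<rho>0 by (intro mult_mono) auto
      qed
      also have "\<dots> = P (norm z) x * d" by (simp add: P_def)
      also have "\<dots> < e" using e P0[of "norm z" x] by (simp add: d_def field_simps)
      finally show ?case by (simp add: dist_norm)
    qed
  qed
  have volt_sum: "volt N w (\<lambda>y. \<Sum>k<j. C k y z) x = (\<Sum>k<j. volt N w (\<lambda>y. C k y z) x)"
    if w: "loc_int w" and C: "\<And>k. continuous_on {0..} (\<lambda>y. C k y z)" for N w C x z and j :: nat
  proof (induction j)
    case 0 show ?case by (simp add: volt_def)
  next
    case (Suc j)
    have "continuous_on {0..} (\<lambda>y. \<Sum>k<j. C k y z)" by (intro continuous_intros C)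
    from volt_add[OF w this C] Suc show ?case by simp
  qed
  have eqA: "a x z = \<alpha> x + volt n (p z) (\<lambda>y. b y z) x" if "x \<ge> 0" for x z
  proof (rule LIMSEQ_unique)
    show "(\<lambda>j. \<Sum>k<Suc j. A k x z) \<longlonglongrightarrow> a x z" using limA[OF that] by (rule LIMSEQ_Suc)
    have vs: "volt n (p z) (\<lambda>y. \<Sum>k<j. B k y z) x = (\<Sum>k<j. volt n (p z) (\<lambda>y. B k y z) x)" for j
      by (rule volt_sum[OF li(1) cB])
    \<comment> \<open>The operator maps partial sums of \<open>B\<close> to partial sums of
      \<open>A\<close> that lack the term of index 0; that term is \<open>\<alpha>\<close>. Both
      limits are thus limits of one sequence.\<close>
    have "(\<lambda>j. \<alpha> x + volt n (p z) (\<lambda>y. \<Sum>k<j. B k y z) x) \<longlonglongrightarrow> \<alpha> x + volt n (p z) (\<lambda>y. b y z) x"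
      using ulim by (intro tendsto_intros volt_lim li pq cB entire_param_continuous_fst[OF eb] that) auto
    moreover have "\<alpha> x + volt n (p z) (\<lambda>y. \<Sum>k<j. B k y z) x = (\<Sum>k<Suc j. A k x z)" for j
      unfolding vs AS[symmetric] A0[of x z, symmetric] sum.lessThan_Suc_shift ..
    ultimately show "(\<lambda>j. \<Sum>k<Suc j. A k x z) \<longlonglongrightarrow> \<alpha> x + volt n (p z) (\<lambda>y. b y z) x" by simp
  qed
  have eqB: "b x z = \<beta> x + volt l (q z) (\<lambda>y. a y z) x" if "x \<ge> 0" for x z
  proof (rule LIMSEQ_unique)
    show "(\<lambda>j. \<Sum>k<Suc j. B k x z) \<longlonglongrightarrow> b x z" using limB[OF that] by (rule LIMSEQ_Suc)
    have vs: "volt l (q z) (\<lambda>y. \<Sum>k<j. A k y z) x = (\<Sum>k<j. volt l (q z) (\<lambda>y. A k y z) x)" for j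
      by (rule volt_sum[OF li(2) cA])
    have "(\<lambda>j. \<beta> x + volt l (q z) (\<lambda>y. \<Sum>k<j. A k y z) x) \<longlonglongrightarrow> \<beta> x + volt l (q z) (\<lambda>y. a y z) x"
      using ulim by (intro tendsto_intros volt_lim li pq cA entire_param_continuous_fst[OF ea] that) auto
    moreover have "\<beta> x + volt l (q z) (\<lambda>y. \<Sum>k<j. A k y z) x = (\<Sum>k<Suc j. B k x z)" for j
      unfolding vs BS[symmetric] B0[of x z, symmetric] sum.lessThan_Suc_shift ..
    ultimately show "(\<lambda>j. \<Sum>k<Suc j. B k x z) \<longlonglongrightarrow> \<beta> x + volt l (q z) (\<lambda>y. a y z) x" by simp
  qed
  have real: "\<forall>x z. x \<ge> 0 \<longrightarrow> z \<in> \<real> \<longrightarrow> a x z \<in> \<real> \<and> b x z \<in> \<real>"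
    if c: "c1 \<in> \<real>" "c2 \<in> \<real>" and r: "\<And>x. u1 x \<in> \<real> \<and> u2 x \<in> \<real> \<and> \<alpha> x \<in> \<real> \<and> \<beta> x \<in> \<real>"
  proof (intro allI impI)
    fix x :: real and z :: complex assume x: "x \<ge> 0" and z: "z \<in> \<real>"
    have "A k y z \<in> \<real> \<and> B k y z \<in> \<real>" for k y
    proof (induction k arbitrary: y)
      case 0 thus ?case using r by (simp add: A0 B0)
    next
      case (Suc k)
      show ?case unfolding AS BS
        using c z r Suc by (intro conjI volt_in_Reals) (auto simp: p_def q_def)
    qed
    hence "(\<Sum>k<j. A k x z) \<in> \<real>" "(\<Sum>k<j. B k x z) \<in> \<real>" for j
      by (auto intro!: sum_in_Reals)
    thus "a x z \<in> \<real> \<and> b x z \<in> \<real>"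
      using closed_sequentially[OF closed_complex_Reals _ limA[OF x]] closed_sequentially[OF closed_complex_Reals _ limB[OF x]]
      by auto
  qed
  show ?thesis
    by (rule exI[of _ a], rule exI[of _ b])
      (use ea eb eqA[unfolded p_def] eqB[unfolded q_def] real in blast)
qed

subsection \<open>Free Jost solutions and solutions regular at the origin\<close>

text \<open>Up to the factor \<open>x ^ n * exp (s * x)\<close>, these are the reverse Bessel polynomials in \<open>s * x\<close>.\<close>

fun jost :: "nat \<Rightarrow> complex \<Rightarrow> real \<Rightarrow> complex" where
  "jost 0 s x = exp (- s * of_real x)"
| "jost (Suc 0) s x = (s + 1 / of_real x) * exp (- s * of_real x)"
| "jost (Suc (Suc n)) s x = of_nat (2 * n + 3) / of_real x * jost (Suc n) s x + s\<^sup>2 * jost n s x"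

lemma has_vector_derivative_inverse_of_real:
  assumes "x > 0"
  shows "((\<lambda>x. c / complex_of_real x) has_vector_derivative (- c / (of_real x)\<^sup>2)) (at x)"
proof -
  have "((\<lambda>z. c / z) has_field_derivative (- c / (of_real x)\<^sup>2)) (at (complex_of_real x))"
    using assms by (auto intro!: derivative_eq_intros simp: power2_eq_square)
  from has_vector_derivative_real_field[OF this]
  show ?thesis .
qed

text \<open>The recursion reaches two steps back, so consecutive indices are proved together;
  differentiating the recursion and using it once more closes the induction.\<close>

lemma jost_deriv:
  assumes "x > 0"
  shows "(jost n s has_vector_derivative (of_nat (n + 1) / of_real x * jost n s x - jost (Suc n) s x)) (at x)"
proof -
  let ?P = "\<lambda>n. (jost n s has_vector_derivative (of_nat (n + 1) / of_real x * jost n s x - jost (Suc n) s x)) (at x)"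
  have e: "((\<lambda>x. exp (- s * complex_of_real x)) has_vector_derivative (- s * exp (- s * of_real x))) (at x)"
  proof -
    have "((\<lambda>z. exp (- s * z)) has_field_derivative (- s * exp (- s * of_real x))) (at (complex_of_real x))"
      by (auto intro!: derivative_eq_intros)
    from has_vector_derivative_real_field[OF this]
    show ?thesis .
  qed
  have x: "complex_of_real x \<noteq> 0" using assms by auto
  have "?P n \<and> ?P (Suc n)"
  proof (induction n)
    case 0
    have "jost 0 s = (\<lambda>x. exp (- s * of_real x))" by auto
    hence 0: "?P 0" using e x by (auto simp: algebra_simps)
    have "((\<lambda>x. (s + 1 / of_real x) * exp (- s * of_real x)) has_vector_derivative
        ((s + 1 / of_real x) * (- s * exp (- s * of_real x)) + (0 + - 1 / (of_real x)\<^sup>2) * exp (- s * of_real x))) (at x)"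
      by (intro has_vector_derivative_mult has_vector_derivative_add has_vector_derivative_const
          has_vector_derivative_inverse_of_real e assms)
    moreover have "jost (Suc 0) s = (\<lambda>x. (s + 1 / of_real x) * exp (- s * of_real x))" by auto
    moreover have "of_nat (Suc 0 + 1) / of_real x * jost (Suc 0) s x - jost (Suc (Suc 0)) s x =
       ((s + 1 / of_real x) * (- s * exp (- s * of_real x)) + (0 + - 1 / (of_real x)\<^sup>2) * exp (- s * of_real x))"
      using x by (simp add: field_simps power2_eq_square)
    ultimately show ?case using 0 by metis
  next
    case (Suc n)
    let ?u0 = "jost n s x" and ?u1 = "jost (Suc n) s x"
    have "((\<lambda>x. of_nat (2 * n + 3) / of_real x * jost (Suc n) s x + s\<^sup>2 * jost n s x) has_vector_derivative
      ((of_nat (2 * n + 3) / of_real x * (of_nat (Suc n + 1) / of_real x * ?u1 - jost (Suc (Suc n)) s x)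
        + (- of_nat (2 * n + 3) / (of_real x)\<^sup>2) * ?u1) + (s\<^sup>2 * (of_nat (n + 1) / of_real x * ?u0 - ?u1) + 0 * ?u0))) (at x)"
      by (intro has_vector_derivative_mult has_vector_derivative_add has_vector_derivative_const
          has_vector_derivative_inverse_of_real conjunct1[OF Suc] conjunct2[OF Suc] assms)
    moreover have "jost (Suc (Suc n)) s = (\<lambda>x. of_nat (2 * n + 3) / of_real x * jost (Suc n) s x + s\<^sup>2 * jost n s x)"
      by auto
    moreover have "of_nat (Suc (Suc n) + 1) / of_real x * jost (Suc (Suc n)) s x - jost (Suc (Suc (Suc n))) s x =
      ((of_nat (2 * n + 3) / of_real x * (of_nat (Suc n + 1) / of_real x * ?u1 - jost (Suc (Suc n)) s x)
        + (- of_nat (2 * n + 3) / (of_real x)\<^sup>2) * ?u1) + (s\<^sup>2 * (of_nat (n + 1) / of_real x * ?u0 - ?u1) + 0 * ?u0))"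
      using x by (simp add: field_simps power2_eq_square)
    ultimately show ?case using Suc by metis
  qed
  thus ?thesis by blast
qed

text \<open>Eliminating \<open>jost (Suc (Suc n))\<close> leaves a relation between two consecutive
  functions. Together with \<open>jost_deriv\<close> it is, up to normalization, the free Dirac
  system with \<open>\<kappa> = Suc n\<close>.\<close>

lemma jost_deriv':
  assumes "x > 0"
  shows "(jost (Suc n) s has_vector_derivative
     (- (of_nat (Suc n) / of_real x * jost (Suc n) s x) - s\<^sup>2 * jost n s x)) (at x)"
proof -
  have "of_nat (Suc n + 1) / of_real x * jost (Suc n) s x - jost (Suc (Suc n)) s x
      = - (of_nat (Suc n) / of_real x * jost (Suc n) s x) - s\<^sup>2 * jost n s x"
    using assms by (simp add: field_simps)
  thus ?thesis using jost_deriv[OF assms, of "Suc n" s] by metis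
qed

lemma jost_continuous: "I \<subseteq> {0<..} \<Longrightarrow> continuous_on I (jost n s)"
  by (rule continuous_at_imp_continuous_on)
    (auto intro!: has_vector_derivative_continuous[OF jost_deriv])

text \<open>By the recursion, raising \<open>n\<close> by one multiplies the determinant by
  \<open>- s\<^sup>2\<close>; for \<open>n = 0\<close> the exponentials cancel.\<close>

lemma jost_wronskian:
  assumes "x > 0"
  shows "jost (Suc n) s x * jost n (- s) x - jost n s x * jost (Suc n) (- s) x = 2 * (- 1) ^ n * s ^ (2 * n + 1)"
proof (induction n)
  case 0
  have "exp (- s * of_real x) * exp (s * of_real x) = 1" by (simp flip: exp_add)
  moreover have "jost (Suc 0) s x * jost 0 (- s) x - jost 0 s x * jost (Suc 0) (- s) x
      = exp (- s * of_real x) * exp (s * of_real x) * (2 * s)" by (simp add: algebra_simps)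
  ultimately show ?case by simp
next
  case (Suc n)
  have "jost (Suc (Suc n)) s x * jost (Suc n) (- s) x - jost (Suc n) s x * jost (Suc (Suc n)) (- s) x
     = - s\<^sup>2 * (jost (Suc n) s x * jost n (- s) x - jost n s x * jost (Suc n) (- s) x)"
    by (simp add: algebra_simps)
  thus ?case by (simp add: Suc power2_eq_square)
qed

lemma jost_holomorphic:
  assumes "g holomorphic_on A"
  shows "(\<lambda>z. jost n (g z) x) holomorphic_on A"
  using assms
\<comment> \<open>The instance \<open>g 0\<close> merely lets the rule follow the recursion on
  \<open>n\<close>; the claim itself involves \<open>g z\<close> for all \<open>z\<close>.\<close>
proof (induction n "g 0" x rule: jost.induct)
qed (auto intro!: holomorphic_intros)

lemma jost_real: "jost n (of_real s) x \<in> \<real>"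
  by (induction n "complex_of_real s" x rule: jost.induct) (auto simp flip: of_real_minus of_real_mult exp_of_real intro!: Reals_add Reals_mult Reals_divide)

text \<open>For \<open>s > 0\<close> the two initial functions and all coefficients of the recursion
  are positive. This gives the derivative of the Wronskian of two decaying solutions a definite
  sign.\<close>

lemma jost_pos: "s > 0 \<Longrightarrow> x > 0 \<Longrightarrow> Re (jost n (of_real s) x) > 0"
proof (induction n "complex_of_real s" x rule: jost.induct)
  case (1 x) thus ?case by (simp add: Re_exp)
next
  case (2 x)
  have "jost (Suc 0) (of_real s) x = of_real ((s + 1 / x) * exp (- s * x))"
    by (simp flip: exp_of_real)
  thus ?case using 2 by (simp add: add_pos_pos del: jost.simps)
next
  case (3 n x)
  have "jost n (of_real s) x = of_real (Re (jost n (of_real s) x))"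
    "jost (Suc n) (of_real s) x = of_real (Re (jost (Suc n) (of_real s) x))"
    using jost_real by auto
  then obtain a b where ab: "jost n (of_real s) x = of_real a" "jost (Suc n) (of_real s) x = of_real b" by metis
  have "a > 0" "b > 0" using 3 ab by auto
  hence "real (2 * n + 3) / x * b + s\<^sup>2 * a > 0"
    using 3 by (intro add_pos_pos mult_pos_pos divide_pos_pos) auto
  also have "\<dots> = Re (jost (Suc (Suc n)) (of_real s) x)"
  proof -
    have "jost (Suc (Suc n)) (of_real s) x = complex_of_real (real (2 * n + 3) / x * b + s\<^sup>2 * a)"
      unfolding jost.simps ab by simp
    thus ?thesis by (simp only: Re_complex_of_real)
  qed
  finally show ?case .
qed

text \<open>For \<open>x \<ge> 1\<close> the coefficients \<open>1 / x\<close> are at most 1, and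
  the exponential factor is carried through the recursion unchanged.\<close>

lemma jost_bound: "\<exists>C\<ge>0. \<forall>x\<ge>1. norm (jost n s x) \<le> C * exp (- Re s * x)"
proof -
  let ?P = "\<lambda>n. \<exists>C\<ge>0. \<forall>x\<ge>1. norm (jost n s x) \<le> C * exp (- Re s * x)"
  have "?P n \<and> ?P (Suc n)"
  proof (induction n)
    case 0
    have "norm (jost (Suc 0) s x) \<le> (norm s + 1) * exp (- Re s * x)" if "x \<ge> 1" for x
    proof -
      have "norm (s + 1 / of_real x) \<le> norm s + 1"
        using that norm_triangle_ineq[of s "1 / of_real x"] by (simp add: norm_divide field_simps)
      thus ?thesis by (simp add: norm_mult mult_right_mono)
    qed
    thus ?case by (auto intro!: exI[of _ 1] exI[of _ "norm s + 1"])
  next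
    case (Suc n)
    then obtain C1 C2 where C: "C1 \<ge> 0" "\<And>x. x \<ge> 1 \<Longrightarrow> norm (jost n s x) \<le> C1 * exp (- Re s * x)"
      "C2 \<ge> 0" "\<And>x. x \<ge> 1 \<Longrightarrow> norm (jost (Suc n) s x) \<le> C2 * exp (- Re s * x)"
      by metis
    have "norm (jost (Suc (Suc n)) s x) \<le> (of_nat (2 * n + 3) * C2 + (norm s)\<^sup>2 * C1) * exp (- Re s * x)" if x: "x \<ge> 1" for x
    proof -
      have k: "norm (of_nat k / complex_of_real x) \<le> of_nat k" for k
        using x unfolding norm_divide norm_of_nat norm_of_real by (simp add: divide_le_eq mult_le_cancel_left1)
      have "norm (of_nat (2 * n + 3) / of_real x * jost (Suc n) s x) \<le> of_nat (2 * n + 3) * (C2 * exp (- Re s * x))"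
        unfolding norm_mult by (intro mult_mono k C(4)[OF x]) auto
      moreover have "norm (s\<^sup>2 * jost n s x) \<le> (norm s)\<^sup>2 * (C1 * exp (- Re s * x))"
        unfolding norm_mult norm_power using C(2)[OF x] by (intro mult_mono) auto
      ultimately show ?thesis
        using norm_triangle_ineq[of "of_nat (2 * n + 3) / of_real x * jost (Suc n) s x" "s\<^sup>2 * jost n s x"]
        unfolding jost.simps by (simp only: distrib_right mult.assoc)
    qed
    moreover have "of_nat (2 * n + 3) * C2 + (norm s)\<^sup>2 * C1 \<ge> 0" using C by simp
    ultimately show ?case using Suc by metis
  qed
  thus ?thesis by blast
qed

section \<open>The radial Dirac system with a compactly supported potential\<close>

locale dirac =
  fixes \<kappa> :: nat and m \<gamma> :: real and v :: "real \<Rightarrow> real"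
  assumes kappa: "\<kappa> \<ge> 1" and m_pos: "m > 0" and gamma_pos: "\<gamma> > 0"
    and v_L2: "v \<in> L2" and v_loc: "loc_int (\<lambda>x. of_real (v x))"
    and v_supp: "AE x in lebesgue. x \<ge> \<gamma> \<longrightarrow> v x = 0"
begin

text \<open>\<open>sol I z h1 h2 f1 f2\<close>: on \<open>I\<close>, the spinor \<open>(f1, f2)\<close> solves \<open>(H - z) f = (h1, h2)\<close>.\<close>

definition sol :: "real set \<Rightarrow> complex \<Rightarrow> (real \<Rightarrow> complex) \<Rightarrow> (real \<Rightarrow> complex) \<Rightarrow>
    (real \<Rightarrow> complex) \<Rightarrow> (real \<Rightarrow> complex) \<Rightarrow> bool" where
  "sol I z h1 h2 f1 f2 \<longleftrightarrow>
     ac_on I f1 (\<lambda>x. - (of_real (real \<kappa> / x) * f1 x) + (z + of_real m - of_real (v x)) * f2 x + h2 x) \<and>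
     ac_on I f2 (\<lambda>x. of_real (real \<kappa> / x) * f2 x + (of_real m - z + of_real (v x)) * f1 x - h1 x)"

lemma sol_subset: "sol I z h1 h2 f1 f2 \<Longrightarrow> J \<subseteq> I \<Longrightarrow> sol J z h1 h2 f1 f2"
  unfolding sol_def by (auto intro: ac_on_subset)

text \<open>Lagrange's identity: the terms with \<open>\<kappa> / x\<close>, \<open>m\<close> and
  \<open>v\<close> cancel. The pairing is bilinear, which keeps it holomorphic in the spectral
  parameters; conjugates are inserted through \<open>sol_cnj\<close> where a norm is wanted.\<close>

lemma sol_wronskian:
  assumes "sol I z h1 h2 f1 f2" "sol I w k1 k2 g1 g2" "is_interval I"
  shows "ac_on I (\<lambda>x. f1 x * g2 x - f2 x * g1 x)
    (\<lambda>x. (z - w) * (f1 x * g1 x + f2 x * g2 x) + (h1 x * g1 x + h2 x * g2 x) - (f1 x * k1 x + f2 x * k2 x))"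
proof -
  note f = assms(1)[unfolded sol_def] and g = assms(2)[unfolded sol_def]
  show ?thesis
    by (rule ac_on_cong[OF ac_on_diff[OF ac_on_mult[OF conjunct1[OF f] conjunct2[OF g] assms(3)]
      ac_on_mult[OF conjunct2[OF f] conjunct1[OF g] assms(3)]] assms(3)]) (simp_all add: algebra_simps)
qed

lemma sol_cnj:
  assumes "sol I z h1 h2 f1 f2" "is_interval I"
  shows "sol I (cnj z) (\<lambda>x. cnj (h1 x)) (\<lambda>x. cnj (h2 x)) (\<lambda>x. cnj (f1 x)) (\<lambda>x. cnj (f2 x))"
  unfolding sol_def
  by (intro conjI ac_on_cong[OF ac_on_cnj[OF conjunct1[OF assms(1)[unfolded sol_def]]] assms(2)]
      ac_on_cong[OF ac_on_cnj[OF conjunct2[OF assms(1)[unfolded sol_def]]] assms(2)]) auto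

lemma sol_add_cmult:
  assumes "sol I z h1 h2 f1 f2" "sol I z k1 k2 g1 g2" "is_interval I"
  shows "sol I z (\<lambda>x. h1 x + c * k1 x) (\<lambda>x. h2 x + c * k2 x) (\<lambda>x. f1 x + c * g1 x) (\<lambda>x. f2 x + c * g2 x)"
proof -
  note f = assms(1)[unfolded sol_def] and g = assms(2)[unfolded sol_def]
  show ?thesis unfolding sol_def
    by (intro conjI ac_on_cong[OF ac_on_add[OF conjunct1[OF f] ac_on_cmult[OF conjunct1[OF g], of c]] assms(3)]
        ac_on_cong[OF ac_on_add[OF conjunct2[OF f] ac_on_cmult[OF conjunct2[OF g], of c]] assms(3)])
      (simp_all add: algebra_simps)
qed

text \<open>The factor \<open>z - m\<close> of \<open>psi2\<close> is dictated by the second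
  equation, and \<open>(z - m) * (z + m) = - s\<^sup>2\<close> then yields the first. The pair is
  entire in \<open>z\<close> and \<open>s\<close>, and no branch of the root is chosen, so
  \<open>s\<close> and \<open>- s\<close> are on the same footing.\<close>

definition psi1 :: "complex \<Rightarrow> real \<Rightarrow> complex" where
  "psi1 s x = jost \<kappa> s x"

definition psi2 :: "complex \<Rightarrow> complex \<Rightarrow> real \<Rightarrow> complex" where
  "psi2 z s x = (z - of_real m) * jost (\<kappa> - 1) s x"

lemma psi_sol:
  assumes "s\<^sup>2 = (of_real m)\<^sup>2 - z\<^sup>2"
  shows "sol {\<gamma>..} z (\<lambda>_. 0) (\<lambda>_. 0) (psi1 s) (psi2 z s)"
proof -
  define n where "n = \<kappa> - 1"
  have n: "Suc n = \<kappa>" "n + 1 = \<kappa>" using kappa by (auto simp: n_def)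
  have iv: "is_interval {\<gamma>..}" by (simp add: is_interval_ci)
  have pos: "x > 0" if "x \<in> {\<gamma>..}" for x using gamma_pos that by auto
  have cont: "continuous_on {\<gamma>..} (jost k s)" for k
    by (rule jost_continuous) (use pos in auto)
  have d1: "ac_on {\<gamma>..} (jost \<kappa> s) (\<lambda>x. - (of_nat \<kappa> / of_real x * jost \<kappa> s x) - s\<^sup>2 * jost n s x)"
  proof (rule ac_on_C1[OF iv])
    show "(jost \<kappa> s has_vector_derivative (- (of_nat \<kappa> / of_real x * jost \<kappa> s x) - s\<^sup>2 * jost n s x)) (at x within {\<gamma>..})"
      if "x \<in> {\<gamma>..}" for x
      using has_vector_derivative_at_within[OF jost_deriv'[OF pos[OF that], of n s]] unfolding n .
    show "continuous_on {\<gamma>..} (\<lambda>x. - (of_nat \<kappa> / of_real x * jost \<kappa> s x) - s\<^sup>2 * jost n s x)"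
      using pos by (intro continuous_intros cont) force
  qed
  have d2: "ac_on {\<gamma>..} (jost n s) (\<lambda>x. of_nat \<kappa> / of_real x * jost n s x - jost \<kappa> s x)"
  proof (rule ac_on_C1[OF iv])
    show "(jost n s has_vector_derivative (of_nat \<kappa> / of_real x * jost n s x - jost \<kappa> s x)) (at x within {\<gamma>..})"
      if "x \<in> {\<gamma>..}" for x
      using has_vector_derivative_at_within[OF jost_deriv[OF pos[OF that], of n s]] unfolding n .
    show "continuous_on {\<gamma>..} (\<lambda>x. of_nat \<kappa> / of_real x * jost n s x - jost \<kappa> s x)"
      using pos by (intro continuous_intros cont) force
  qed
  have psi2: "psi2 z s = (\<lambda>x. (z - of_real m) * jost n s x)" by (auto simp: psi2_def n_def)
  have psi1: "psi1 s = jost \<kappa> s" by (auto simp: psi1_def)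
  show ?thesis
    unfolding sol_def psi1 psi2
  proof
    show "ac_on {\<gamma>..} (jost \<kappa> s) (\<lambda>x. - (of_real (real \<kappa> / x) * jost \<kappa> s x) + (z + of_real m - of_real (v x)) * ((z - of_real m) * jost n s x) + 0)"
    proof (rule ac_on_cong_AE[OF d1 iv])
      show "AE x in lebesgue. x \<in> {\<gamma>..} \<longrightarrow> - (of_nat \<kappa> / of_real x * jost \<kappa> s x) - s\<^sup>2 * jost n s x =
          - (of_real (real \<kappa> / x) * jost \<kappa> s x) + (z + of_real m - of_real (v x)) * ((z - of_real m) * jost n s x) + 0"
        using v_supp unfolding assms
        by eventually_elim (auto simp: power2_eq_square algebra_simps simp del: jost.simps)
    qed
    show "ac_on {\<gamma>..} (\<lambda>x. (z - of_real m) * jost n s x) (\<lambda>x. of_real (real \<kappa> / x) * ((z - of_real m) * jost n s x) + (of_real m - z + of_real (v x)) * jost \<kappa> s x - 0)"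
    proof (rule ac_on_cong_AE[OF ac_on_cmult[OF d2] iv])
      show "AE x in lebesgue. x \<in> {\<gamma>..} \<longrightarrow> (z - of_real m) * (of_nat \<kappa> / of_real x * jost n s x - jost \<kappa> s x) =
          of_real (real \<kappa> / x) * ((z - of_real m) * jost n s x) + (of_real m - z + of_real (v x)) * jost \<kappa> s x - 0"
        using v_supp
      proof eventually_elim
        case (elim x)
        show ?case
        proof
          assume "x \<in> {\<gamma>..}"
          hence "x > 0" "v x = 0" using elim pos by auto
          thus "(z - of_real m) * (of_nat \<kappa> / of_real x * jost n s x - jost \<kappa> s x) =
            of_real (real \<kappa> / x) * ((z - of_real m) * jost n s x) + (of_real m - z + of_real (v x)) * jost \<kappa> s x - 0"
            by (simp add: field_simps del: jost.simps)
        qed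
      qed
    qed
  qed
qed

text \<open>The right-hand side vanishes only for \<open>z = m\<close> or \<open>s = 0\<close>.
  Otherwise psi(s) and psi(- s) form a fundamental system beyond the support of
  \<open>v\<close>.\<close>

lemma psi_wronskian:
  assumes "x > 0"
  shows "psi1 s x * psi2 z (- s) x - psi2 z s x * psi1 (- s) x
     = (z - of_real m) * (2 * (- 1) ^ (\<kappa> - 1) * s ^ (2 * \<kappa> - 1))"
proof -
  define n where "n = \<kappa> - 1"
  have n: "Suc n = \<kappa>" "2 * n + 1 = 2 * \<kappa> - 1" using kappa by (auto simp: n_def)
  show ?thesis using arg_cong[OF jost_wronskian[OF assms, of n s], of "\<lambda>c. (z - of_real m) * c"]
    unfolding psi1_def psi2_def n n_def[symmetric] by (simp add: algebra_simps del: jost.simps)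
qed

text \<open>The first equation has the integrating factor \<open>x ^ \<kappa>\<close>, the second
  its inverse. For the quotients \<open>a\<close>, \<open>b\<close> of the components by
  \<open>x ^ \<kappa>\<close> this gives a Volterra system with exponents
  \<open>2 * \<kappa>\<close> and \<open>0\<close>. The free constant \<open>\<delta>\<close> is the
  leading coefficient of the second component at 0.\<close>

lemma regular_solution:
  fixes h1 h2 :: "real \<Rightarrow> complex" and \<delta> :: complex
  assumes h: "continuous_on UNIV h1" "continuous_on UNIV h2" and e: "e > 0" "\<And>x. x < e \<Longrightarrow> h1 x = 0 \<and> h2 x = 0"
  shows "\<exists>a b. entire_param a \<and> entire_param b \<and>
    (\<forall>z. sol {0<..} z h1 h2 (\<lambda>x. of_real x ^ \<kappa> * a x z) (\<lambda>x. of_real x ^ \<kappa> * b x z)) \<and>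
    (\<forall>z. b 0 z = \<delta>) \<and>
    (h1 = (\<lambda>_. 0) \<longrightarrow> h2 = (\<lambda>_. 0) \<longrightarrow> \<delta> \<in> \<real> \<longrightarrow>
       (\<forall>x z. x \<ge> 0 \<longrightarrow> z \<in> \<real> \<longrightarrow> a x z \<in> \<real> \<and> b x z \<in> \<real>))"
proof -
  \<comment> \<open>The source enters divided by \<open>x ^ \<kappa>\<close>; the quotient is
    continuous at 0 because the source vanishes on \<open>x < e\<close>.\<close>
  define K where "K = (\<lambda>k x. inverse (complex_of_real x ^ \<kappa>) * k x)"
  have K: "continuous_on {0..} (K k)" if "continuous_on UNIV k" "\<And>x. x < e \<Longrightarrow> k x = 0" for k
  proof -
    have "continuous_on {0<..} (K k)"
      unfolding K_def using that(1) by (auto intro!: continuous_intros elim: continuous_on_subset)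
    moreover have "continuous_on {..<e} (K k)"
      using continuous_on_cong[of "{..<e}" "{..<e}" "K k" "\<lambda>_. 0"] that(2) by (simp add: K_def)
    ultimately have "continuous_on ({0<..} \<union> {..<e}) (K k)"
      by (intro continuous_on_open_Un) auto
    thus ?thesis by (rule continuous_on_subset) (use e in auto)
  qed
  have K1: "continuous_on {0..} (K h1)" and K2: "continuous_on {0..} (K h2)" using h e by (auto intro: K)
  define \<alpha> where "\<alpha> = volt (2 * \<kappa>) (\<lambda>_. 1) (K h2)"
  define \<beta> where "\<beta> = (\<lambda>x. \<delta> - volt 0 (\<lambda>_. 1) (K h1) x)"
  have l1: "loc_int (\<lambda>_. 1)" by (intro loc_int_continuous continuous_intros)
  have lv: "loc_int (\<lambda>x. of_real m - of_real (v x))" "loc_int (\<lambda>x. of_real m + of_real (v x))"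
    using loc_int_add[OF loc_int_continuous[of "\<lambda>_. of_real m"] v_loc]
      loc_int_add[OF loc_int_continuous[of "\<lambda>_. of_real m"] loc_int_mult[OF v_loc, of "\<lambda>_. -1"]] by auto
  have \<alpha>: "continuous_on {0..} \<alpha>" unfolding \<alpha>_def by (intro continuous_volt l1 K2)
  have \<beta>: "continuous_on {0..} \<beta>" unfolding \<beta>_def by (intro continuous_intros continuous_volt l1 K1)
  define p where "p = (\<lambda>z y. of_real m - of_real (v y) + 1 * z :: complex)"
  define q where "q = (\<lambda>z y. of_real m + of_real (v y) + - 1 * z :: complex)"
  obtain a b where ab: "entire_param a" "entire_param b"
    and a: "\<And>x z. x \<ge> 0 \<Longrightarrow> a x z = \<alpha> x + volt (2 * \<kappa>) (p z) (\<lambda>y. b y z) x"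
    and b: "\<And>x z. x \<ge> 0 \<Longrightarrow> b x z = \<beta> x + volt 0 (q z) (\<lambda>y. a y z) x"
    and r: "(1::complex) \<in> \<real> \<longrightarrow> (- 1::complex) \<in> \<real> \<longrightarrow> (\<forall>x. of_real m - of_real (v x) \<in> (\<real>::complex set) \<and> of_real m + of_real (v x) \<in> (\<real>::complex set) \<and> \<alpha> x \<in> \<real> \<and> \<beta> x \<in> \<real>) \<longrightarrow>
          (\<forall>x z. x \<ge> 0 \<longrightarrow> z \<in> \<real> \<longrightarrow> a x z \<in> \<real> \<and> b x z \<in> \<real>)"
    using volterra_system[where n = "2 * \<kappa>" and l = 0 and ?c1.0 = 1 and ?c2.0 = "- 1", OF lv \<alpha> \<beta>]
    unfolding p_def q_def by blast
  have ca: "continuous_on {0..} (\<lambda>x. a x z)" and cb: "continuous_on {0..} (\<lambda>x. b x z)" for z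
    using ab by (auto intro: entire_param_continuous_fst)
  have lp: "loc_int (p z)" and lq: "loc_int (q z)" for z
    unfolding p_def q_def by (intro loc_int_add lv loc_int_continuous continuous_intros)+
  have iv: "is_interval {0::real<..}" by (simp add: is_interval_oi)
  have S: "sol {0<..} z h1 h2 (\<lambda>x. of_real x ^ \<kappa> * a x z) (\<lambda>x. of_real x ^ \<kappa> * b x z)" for z
  proof -
    let ?A' = "\<lambda>y. of_real y ^ (2 * \<kappa>) * (1 * K h2 y) + of_real y ^ (2 * \<kappa>) * (p z y * b y z)"
    let ?A = "\<lambda>x. integral {0..x} ?A'"
    let ?B' = "\<lambda>y. of_real y ^ 0 * ((- 1) * K h1 y) + of_real y ^ 0 * (q z y * a y z)"
    let ?B = "\<lambda>x. integral {0..x} ?B'"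
    have l1': "loc_int (\<lambda>_. - 1)" by (intro loc_int_continuous continuous_intros)
    have lA: "loc_int ?A'" "loc_int ?B'"
      by (intro loc_int_add loc_int_volt l1 l1' K1 K2 lp lq ca cb)+
    have A: "ac_on {0<..} ?A ?A'" "ac_on {0<..} ?B ?B'"
      by (rule ac_on_subset[OF loc_int_ac_on]; use lA in force)+
    have a': "of_real x ^ \<kappa> * a x z = inverse (of_real x ^ \<kappa>) * ?A x" if "x > 0" for x
    proof -
      have "?A x = integral {0..x} (\<lambda>y. of_real y ^ (2 * \<kappa>) * (1 * K h2 y)) + integral {0..x} (\<lambda>y. of_real y ^ (2 * \<kappa>) * (p z y * b y z))"
        by (intro Henstock_Kurzweil_Integration.integral_add loc_int_integrable loc_int_volt l1 K2 lp cb)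
      hence "a x z = inverse (of_real x ^ (2 * \<kappa>)) * ?A x"
        using that by (simp add: a \<alpha>_def volt_def algebra_simps)
      moreover have "complex_of_real x ^ \<kappa> * inverse (of_real x ^ (2 * \<kappa>)) = inverse (of_real x ^ \<kappa>)"
        using that by (simp add: mult_2 power_add)
      ultimately show ?thesis by (simp add: mult.assoc[symmetric])
    qed
    have b': "b x z = \<delta> + ?B x" if "x > 0" for x
    proof -
      have "?B x = integral {0..x} (\<lambda>y. of_real y ^ 0 * (- 1 * K h1 y)) + integral {0..x} (\<lambda>y. of_real y ^ 0 * (q z y * a y z))"
        by (intro Henstock_Kurzweil_Integration.integral_add loc_int_integrable loc_int_volt l1' K1 lq ca)
      thus ?thesis using that by (simp add: b \<beta>_def volt_def algebra_simps)
    qed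
    \<comment> \<open>Under the product rule the prefactors \<open>x ^ \<kappa>\<close> and
      \<open>inverse (x ^ \<kappa>)\<close> reproduce the diagonal terms of the system with
      coefficients \<open>\<kappa> / x\<close> and \<open>- \<kappa> / x\<close>.\<close>
    have pw: "ac_on {0<..} (\<lambda>x. complex_of_real x ^ \<kappa>) (\<lambda>x. of_nat \<kappa> / of_real x * of_real x ^ \<kappa>)"
    proof (rule ac_on_C1[OF iv])
      fix x :: real assume "x \<in> {0<..}"
      hence x: "complex_of_real x \<noteq> 0" by auto
      have "((\<lambda>z. z ^ \<kappa>) has_field_derivative (of_nat \<kappa> / of_real x * of_real x ^ \<kappa>)) (at (complex_of_real x))"
        using x kappa by (auto intro!: derivative_eq_intros simp: field_simps simp flip: power_Suc)
      from has_vector_derivative_real_field[OF this]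
      show "((\<lambda>x. complex_of_real x ^ \<kappa>) has_vector_derivative (of_nat \<kappa> / of_real x * of_real x ^ \<kappa>)) (at x within {0<..})" .
    qed (auto intro!: continuous_intros)
    have pw': "ac_on {0<..} (\<lambda>x. inverse (complex_of_real x ^ \<kappa>)) (\<lambda>x. - (of_nat \<kappa> / of_real x * inverse (of_real x ^ \<kappa>)))"
    proof (rule ac_on_C1[OF iv])
      fix x :: real assume "x \<in> {0<..}"
      hence x: "complex_of_real x \<noteq> 0" by auto
      have "((\<lambda>z. z ^ \<kappa>) has_field_derivative (of_nat \<kappa> / of_real x * of_real x ^ \<kappa>)) (at (complex_of_real x))"
        using x kappa by (auto intro!: derivative_eq_intros simp: field_simps simp flip: power_Suc)
      from DERIV_inverse'[OF this]
      have "((\<lambda>z. inverse (z ^ \<kappa>)) has_field_derivative (- (of_nat \<kappa> / of_real x * inverse (of_real x ^ \<kappa>)))) (at (complex_of_real x))"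
        using x by (simp add: mult.assoc) (simp add: mult.commute)
      from has_vector_derivative_real_field[OF this]
      show "((\<lambda>x. inverse (complex_of_real x ^ \<kappa>)) has_vector_derivative (- (of_nat \<kappa> / of_real x * inverse (of_real x ^ \<kappa>)))) (at x within {0<..})" .
    qed (auto intro!: continuous_intros)
    show ?thesis unfolding sol_def
    proof
      show "ac_on {0<..} (\<lambda>x. of_real x ^ \<kappa> * a x z) (\<lambda>x. - (of_real (real \<kappa> / x) * (of_real x ^ \<kappa> * a x z)) +
          (z + of_real m - of_real (v x)) * (of_real x ^ \<kappa> * b x z) + h2 x)"
      proof (rule ac_on_cong[OF ac_on_mult[OF pw' A(1) iv] iv])
        fix x :: real assume "x \<in> {0<..}"
        hence x: "x > 0" by simp
        define P where "P = complex_of_real x ^ \<kappa>"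
        define I where "I = ?A x"
        have Kx: "K h2 x = inverse P * h2 x" by (simp add: K_def P_def)
        have P: "P \<noteq> 0" "complex_of_real x ^ (2 * \<kappa>) = P * P"
          using x by (auto simp: P_def mult_2 power_add)
        have aP: "P * a x z = inverse P * I" using a'[OF x] by (simp add: P_def I_def)
        show "complex_of_real x ^ \<kappa> * a x z = inverse (complex_of_real x ^ \<kappa>) * ?A x" by (rule a'[OF x])
        have "- (of_real (real \<kappa> / x) * (P * a x z)) + (z + of_real m - of_real (v x)) * (P * b x z) + h2 x =
          - (of_nat \<kappa> / of_real x * inverse P) * I + inverse P * (P * P * (1 * (inverse P * h2 x)) + P * P * (p z x * b x z))"
          using P(1) unfolding aP p_def by (simp add: field_simps)
        thus "- (of_real (real \<kappa> / x) * (of_real x ^ \<kappa> * a x z)) + (z + of_real m - of_real (v x)) * (of_real x ^ \<kappa> * b x z) + h2 x =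
          - (of_nat \<kappa> / of_real x * inverse (of_real x ^ \<kappa>)) * ?A x + inverse (of_real x ^ \<kappa>) * ?A' x"
          unfolding Kx P(2) by (simp only: P_def I_def)
      qed
      show "ac_on {0<..} (\<lambda>x. of_real x ^ \<kappa> * b x z) (\<lambda>x. of_real (real \<kappa> / x) * (of_real x ^ \<kappa> * b x z) +
          (of_real m - z + of_real (v x)) * (of_real x ^ \<kappa> * a x z) - h1 x)"
      proof (rule ac_on_cong[OF ac_on_mult[OF pw ac_on_add[OF ac_on_const A(2)] iv] iv])
        fix x :: real assume "x \<in> {0<..}"
        hence x: "x > 0" by simp
        define P where "P = complex_of_real x ^ \<kappa>"
        define I where "I = \<delta> + ?B x"
        have Kx: "K h1 x = inverse P * h1 x" by (simp add: K_def P_def)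
        have P: "P \<noteq> 0" using x by (auto simp: P_def)
        have bI: "b x z = I" using b'[OF x] by (simp add: I_def)
        show "complex_of_real x ^ \<kappa> * b x z = of_real x ^ \<kappa> * (\<delta> + ?B x)" by (simp only: b'[OF x])
        have "of_real (real \<kappa> / x) * (P * b x z) + (of_real m - z + of_real (v x)) * (P * a x z) - h1 x
          = of_nat \<kappa> / of_real x * P * I + P * (0 + (1 * (- 1 * (inverse P * h1 x)) + 1 * (q z x * a x z)))"
          using P unfolding bI q_def by (simp add: field_simps)
        thus "of_real (real \<kappa> / x) * (of_real x ^ \<kappa> * b x z) + (of_real m - z + of_real (v x)) * (of_real x ^ \<kappa> * a x z) - h1 x
          = of_nat \<kappa> / of_real x * of_real x ^ \<kappa> * (\<delta> + ?B x) + of_real x ^ \<kappa> * (0 + ?B' x)"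
          unfolding Kx by (simp only: P_def I_def power_0)
      qed
    qed
  qed
  have R: "\<forall>x z. x \<ge> 0 \<longrightarrow> z \<in> \<real> \<longrightarrow> a x z \<in> \<real> \<and> b x z \<in> \<real>"
    if "h1 = (\<lambda>_. 0)" "h2 = (\<lambda>_. 0)" "\<delta> \<in> \<real>"
  proof -
    have "\<forall>x. of_real m - of_real (v x) \<in> (\<real>::complex set) \<and> of_real m + of_real (v x) \<in> (\<real>::complex set) \<and> \<alpha> x \<in> \<real> \<and> \<beta> x \<in> \<real>"
      using that by (auto simp: \<alpha>_def \<beta>_def K_def volt_def)
    with r show ?thesis by simp
  qed
  have "b 0 z = \<delta>" for z by (simp add: b \<beta>_def volt_def)
  with ab S R show ?thesis by blast
qed

text \<open>\<open>\<kappa> \<ge> 1\<close> gives \<open>x ^ \<kappa> \<le> x\<close> on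
  \<open>{0..1}\<close>; the resulting linear bound provides the boundary condition and removes
  boundary terms at 0. If \<open>\<delta>\<close> is nonzero, continuity of \<open>b\<close> makes
  the second component nonzero at points close to 0.\<close>

lemma regular_solution_entire:
  fixes h1 h2 :: "real \<Rightarrow> complex" and \<delta> :: complex
  assumes h: "continuous_on UNIV h1" "continuous_on UNIV h2" and e: "e > 0" "\<And>x. x < e \<Longrightarrow> h1 x = 0 \<and> h2 x = 0"
  shows "\<exists>f1 f2. entire_param f1 \<and> entire_param f2 \<and>
    (\<forall>z. sol {0<..} z h1 h2 (\<lambda>x. f1 x z) (\<lambda>x. f2 x z)) \<and>
    (\<forall>z. \<exists>C. \<forall>x\<in>{0..1}. norm (f1 x z) \<le> C * x \<and> norm (f2 x z) \<le> C * x) \<and>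
    (\<delta> \<noteq> 0 \<longrightarrow> (\<forall>z. \<exists>x\<in>{0<..<\<gamma>}. f2 x z \<noteq> 0)) \<and>
    (h1 = (\<lambda>_. 0) \<longrightarrow> h2 = (\<lambda>_. 0) \<longrightarrow> \<delta> \<in> \<real> \<longrightarrow> (\<forall>x z. x \<ge> 0 \<longrightarrow> z \<in> \<real> \<longrightarrow> f1 x z \<in> \<real> \<and> f2 x z \<in> \<real>))"
proof -
  obtain a b where ab: "entire_param a" "entire_param b"
    and sol: "\<And>z. sol {0<..} z h1 h2 (\<lambda>x. of_real x ^ \<kappa> * a x z) (\<lambda>x. of_real x ^ \<kappa> * b x z)"
    and b0: "\<And>z. b 0 z = \<delta>"
    and r: "\<lbrakk>h1 = (\<lambda>_. 0); h2 = (\<lambda>_. 0); \<delta> \<in> \<real>\<rbrakk> \<Longrightarrow> \<forall>x z. x \<ge> 0 \<longrightarrow> z \<in> \<real> \<longrightarrow> a x z \<in> \<real> \<and> b x z \<in> \<real>"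
    using regular_solution[OF h e, of \<delta>] by blast
  define f1 where "f1 = (\<lambda>x z. complex_of_real x ^ \<kappa> * a x z)"
  define f2 where "f2 = (\<lambda>x z. complex_of_real x ^ \<kappa> * b x z)"
  have "entire_param f1" "entire_param f2"
    unfolding f1_def f2_def
    by (rule entire_param_mult[OF ab(1)] entire_param_mult[OF ab(2)], intro continuous_intros)+
  moreover have "\<exists>C. \<forall>x\<in>{0..1}. norm (f1 x z) \<le> C * x \<and> norm (f2 x z) \<le> C * x" for z
  proof -
    have "bounded ((\<lambda>x. a x z) ` {0..1})" "bounded ((\<lambda>x. b x z) ` {0..1})"
      using entire_param_continuous_fst[OF ab(1), of z] entire_param_continuous_fst[OF ab(2), of z]
      by (auto intro!: compact_imp_bounded compact_continuous_image elim: continuous_on_subset)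
    then obtain M1 M2 where M: "\<forall>x\<in>{0..1}. norm (a x z) \<le> M1" "\<forall>x\<in>{0..1}. norm (b x z) \<le> M2"
      unfolding bounded_iff ball_simps by blast
    have "norm (f1 x z) \<le> max M1 M2 * x \<and> norm (f2 x z) \<le> max M1 M2 * x" if x: "x \<in> {0..1}" for x
    proof -
      have "x ^ \<kappa> \<le> x ^ 1" using x kappa by (intro power_decreasing) auto
      hence "x ^ \<kappa> * norm (a x z) \<le> x * max M1 M2" "x ^ \<kappa> * norm (b x z) \<le> x * max M1 M2"
        using x M by (auto intro!: mult_mono simp: le_max_iff_disj)
      thus ?thesis using x by (simp add: f1_def f2_def norm_mult norm_power mult.commute)
    qed
    thus ?thesis by blast
  qed
  moreover have "\<exists>x\<in>{0<..<\<gamma>}. f2 x z \<noteq> 0" if "\<delta> \<noteq> 0" for z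
  proof (rule ccontr)
    assume "\<not> ?thesis"
    hence 0: "b x z = 0" if "0 < x" "x < \<gamma>" for x using that by (auto simp: f2_def)
    have "continuous (at 0 within {0..}) (\<lambda>x. b x z)"
      using entire_param_continuous_fst[OF ab(2), of z] by (simp add: continuous_on_eq_continuous_within)
    hence "((\<lambda>x. b x z) \<longlongrightarrow> \<delta>) (at_right 0)"
      unfolding continuous_within b0 by (rule tendsto_mono[rotated]) (auto intro!: at_le)
    moreover have "\<forall>\<^sub>F x in at_right 0. b x z = 0"
      using eventually_at_right_less[of 0] eventually_at_right_real[OF gamma_pos]
      by eventually_elim (use 0 in auto)
    hence "((\<lambda>x. b x z) \<longlongrightarrow> 0) (at_right 0)" by (rule tendsto_eventually)
    ultimately show False using that tendsto_unique[OF trivial_limit_at_right_real] by blast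
  qed
  moreover have "\<forall>x z. x \<ge> 0 \<longrightarrow> z \<in> \<real> \<longrightarrow> f1 x z \<in> \<real> \<and> f2 x z \<in> \<real>"
    if "h1 = (\<lambda>_. 0)" "h2 = (\<lambda>_. 0)" "\<delta> \<in> \<real>"
    using r[OF that] by (auto simp: f1_def f2_def intro!: Reals_mult Reals_power)
  moreover have "sol {0<..} z h1 h2 (\<lambda>x. f1 x z) (\<lambda>x. f2 x z)" for z
    unfolding f1_def f2_def by (rule sol)
  ultimately show ?thesis by blast
qed

end

subsection \<open>The Jost function\<close>

text \<open>Solutions are absolutely continuous on the open half-line, while Wronskians and their
  derivatives extend continuously to 0. The lower limit can be moved to 0 because \<open>G\<close>
  is continuous there and constant on \<open>(0, x]\<close>.\<close>

lemma ac_on_vanishing_at_0: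
  assumes W: "ac_on {0<..} W D" and D: "continuous_on {0..} D" and Wc: "continuous_on {0..} W" "W 0 = 0" and x: "x \<ge> 0"
  shows "W x = integral {0..x} D"
proof (cases "x = 0")
  case False
  with x have x: "x > 0" by simp
  define G where "G = (\<lambda>e. W e - integral {0..e} D)"
  have Di: "D integrable_on {0..e}" for e
    using D by (intro integrable_continuous_real) (auto elim: continuous_on_subset)
  have G: "G e = G x" if "e \<in> {0<..x}" for e
  proof -
    have "W x = W e + integral {e..x} D" using ac_onD(2)[OF W, of e x] that by auto
    moreover have "integral {0..e} D + integral {e..x} D = integral {0..x} D"
      using that by (intro Henstock_Kurzweil_Integration.integral_combine Di) auto
    ultimately show ?thesis by (simp add: G_def algebra_simps)
  qed
  have "continuous_on {0..x} G"
    unfolding G_def using Wc(1) by (auto intro!: continuous_intros indefinite_integral_continuous_1 Di elim: continuous_on_subset)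
  hence "(G \<longlongrightarrow> G 0) (at 0 within {0..x})"
    using x by (auto simp: continuous_on_def)
  hence "(G \<longlongrightarrow> G 0) (at_right 0)"
    using x by (simp add: at_within_Icc_at_right)
  moreover have "\<forall>\<^sub>F e in at_right 0. G e = G x"
    using eventually_at_right_real[OF x] by eventually_elim (rule G, auto)
  hence "(G \<longlongrightarrow> G x) (at_right 0)" by (rule tendsto_eventually)
  ultimately have "G 0 = G x" by (rule tendsto_unique[OF trivial_limit_at_right_real])
  thus ?thesis by (simp add: G_def Wc)
qed (use Wc in auto)

lemma integral_cmod_square_pos:
  fixes f g :: "real \<Rightarrow> complex"
  assumes c: "continuous_on {0..X} f" "continuous_on {0..X} g" and x: "x \<in> {0<..<X}" "g x \<noteq> 0"
  shows "Re (integral {0..X} (\<lambda>x. f x * cnj (f x) + g x * cnj (g x))) > 0"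
    and "Im (integral {0..X} (\<lambda>x. f x * cnj (f x) + g x * cnj (g x))) = 0"
proof -
  let ?q = "\<lambda>x. (norm (f x))\<^sup>2 + (norm (g x))\<^sup>2"
  have cq: "continuous_on {0..X} ?q" by (intro continuous_intros c)
  have "integral {0..X} (\<lambda>x. f x * cnj (f x) + g x * cnj (g x)) = integral {0..X} (complex_of_real \<circ> ?q)"
    by (intro integral_cong) (simp only: o_def of_real_add complex_norm_square)
  also have "\<dots> = of_real (integral {0..X} ?q)"
    by (intro integral_linear integrable_continuous_real cq bounded_linear_of_real)
  finally have eq: "integral {0..X} (\<lambda>x. f x * cnj (f x) + g x * cnj (g x)) = of_real (integral {0..X} ?q)" .
  have "integral {0..X} ?q \<noteq> 0"
  proof
    assume "integral {0..X} ?q = 0"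
    hence "(?q has_integral 0) (cbox 0 X)"
      using integrable_integral[OF integrable_continuous_real[OF cq]] by simp
    moreover have "continuous_on (cbox 0 X) ?q" using cq by simp
    ultimately have "?q x = 0"
      using x by (rule_tac has_integral_0_cbox_imp_0[of 0 X ?q x]) auto
    thus False using x(2) by (simp add: add_nonneg_eq_0_iff)
  qed
  moreover have "integral {0..X} ?q \<ge> 0"
    by (intro Henstock_Kurzweil_Integration.integral_nonneg integrable_continuous_real cq) auto
  ultimately show "Re (integral {0..X} (\<lambda>x. f x * cnj (f x) + g x * cnj (g x))) > 0"
    and "Im (integral {0..X} (\<lambda>x. f x * cnj (f x) + g x * cnj (g x))) = 0"
    unfolding eq by auto
qed

text \<open>A single family \<open>phi\<close> serves all \<open>z\<close>, entire in
  \<open>z\<close>, so that what is built from it is holomorphic. \<open>phi_nz\<close> supplies a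
  nonzero value before \<open>\<gamma>\<close>, which makes the norm of \<open>phi\<close> over
  \<open>{0..\<gamma>}\<close> positive.\<close>

locale dirac_regular = dirac +
  fixes phi1 phi2 :: "real \<Rightarrow> complex \<Rightarrow> complex"
  assumes phi_entire: "entire_param phi1" "entire_param phi2"
    and phi_sol: "sol {0<..} z (\<lambda>_. 0) (\<lambda>_. 0) (\<lambda>x. phi1 x z) (\<lambda>x. phi2 x z)"
    and phi_bound: "\<exists>C. \<forall>x\<in>{0..1}. norm (phi1 x z) \<le> C * x \<and> norm (phi2 x z) \<le> C * x"
    and phi_nz: "\<exists>x\<in>{0<..<\<gamma>}. phi2 x z \<noteq> 0"
    and phi_real: "x \<ge> 0 \<Longrightarrow> z \<in> \<real> \<Longrightarrow> phi1 x z \<in> \<real> \<and> phi2 x z \<in> \<real>"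
begin

lemma ray_intervals: "is_interval {0::real<..}" "is_interval {c::real..}"
  by (simp_all add: is_interval_oi is_interval_ci)

lemma phi_continuous: "continuous_on {0..} (\<lambda>x. phi1 x z)" "continuous_on {0..} (\<lambda>x. phi2 x z)"
  using phi_entire by (auto intro: entire_param_continuous_fst)

lemma phi_0: "phi1 0 z = 0" "phi2 0 z = 0"
proof -
  obtain C where "\<forall>x\<in>{0..1}. norm (phi1 x z) \<le> C * x \<and> norm (phi2 x z) \<le> C * x" using phi_bound by metis
  from bspec[OF this, of 0] show "phi1 0 z = 0" "phi2 0 z = 0" by auto
qed

text \<open>The arguments \<open>z\<close> and \<open>s\<close> are independent: the sign of
  \<open>s\<close> selects the sheet, and no branch of the root enters. For
  \<open>s\<^sup>2 = m\<^sup>2 - z\<^sup>2\<close> the point \<open>\<gamma>\<close> may be replaced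
  by any later one, by \<open>jost_fn_eq\<close>.\<close>

definition jost_fn :: "complex \<Rightarrow> complex \<Rightarrow> complex" where
  "jost_fn z s = phi1 \<gamma> z * psi2 z s \<gamma> - phi2 \<gamma> z * psi1 s \<gamma>"

lemma psi_wronskian_const:
  assumes "s\<^sup>2 = (of_real m)\<^sup>2 - z\<^sup>2" "sol {X..} z (\<lambda>_. 0) (\<lambda>_. 0) f1 f2" "X \<ge> \<gamma>" "x \<ge> X"
  shows "f1 x * psi2 z s x - f2 x * psi1 s x = f1 X * psi2 z s X - f2 X * psi1 s X"
proof -
  have "ac_on {X..} (\<lambda>x. f1 x * psi2 z s x - f2 x * psi1 s x) 
     (\<lambda>x. (z - z) * (f1 x * psi1 s x + f2 x * psi2 z s x) + (0 * psi1 s x + 0 * psi2 z s x) - (f1 x * 0 + f2 x * 0))"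
    by (rule sol_wronskian[OF assms(2) sol_subset[OF psi_sol[OF assms(1)]] ray_intervals(2)]) (use assms(3) in auto)
  from ac_on_zero_deriv[OF this _ ray_intervals(2), of x X] show ?thesis using assms by auto
qed

lemma jost_fn_eq:
  assumes "s\<^sup>2 = (of_real m)\<^sup>2 - z\<^sup>2" "x \<ge> \<gamma>"
  shows "phi1 x z * psi2 z s x - phi2 x z * psi1 s x = jost_fn z s"
  unfolding jost_fn_def using gamma_pos
  by (intro psi_wronskian_const assms sol_subset[OF phi_sol]) auto

lemma wronskian_integral:
  assumes f: "sol {0<..} z h1 h2 f1 f2" and g: "sol {0<..} w k1 k2 g1 g2"
    and fc: "continuous_on {0..} f1" "continuous_on {0..} f2" and gc: "continuous_on {0..} g1" "continuous_on {0..} g2"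
    and hc: "continuous_on {0..} h1" "continuous_on {0..} h2" and kc: "continuous_on {0..} k1" "continuous_on {0..} k2"
    and f0: "f1 0 = 0" "f2 0 = 0" and x: "x \<ge> 0"
  shows "f1 x * g2 x - f2 x * g1 x = integral {0..x}
    (\<lambda>x. (z - w) * (f1 x * g1 x + f2 x * g2 x) + (h1 x * g1 x + h2 x * g2 x) - (f1 x * k1 x + f2 x * k2 x))"
  by (rule ac_on_vanishing_at_0[OF sol_wronskian[OF f g ray_intervals(1)]])
    (auto intro!: continuous_intros fc gc hc kc simp: f0 x)

lemma phi_wronskian:
  assumes "x \<ge> 0"
  shows "phi1 x z * phi2 x w - phi2 x z * phi1 x w = (z - w) * integral {0..x} (\<lambda>x. phi1 x z * phi1 x w + phi2 x z * phi2 x w)"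
  using wronskian_integral[OF phi_sol[of z] phi_sol[of w] phi_continuous phi_continuous _ _ _ _ phi_0 assms]
  by (auto intro: continuous_intros)

lemma phi_wronskian_cnj:
  assumes "x \<ge> 0"
  shows "phi1 x z * cnj (phi2 x z) - phi2 x z * cnj (phi1 x z)
    = (z - cnj z) * integral {0..x} (\<lambda>x. phi1 x z * cnj (phi1 x z) + phi2 x z * cnj (phi2 x z))"
proof -
  have c: "continuous_on {0..} (\<lambda>x. cnj (phi1 x z))" "continuous_on {0..} (\<lambda>x. cnj (phi2 x z))"
    by (intro continuous_intros phi_continuous)+
  show ?thesis
    using wronskian_integral[OF phi_sol[of z] sol_cnj[OF phi_sol[of z] ray_intervals(1)] phi_continuous c _ _ _ _ phi_0 assms]
    by (auto intro: continuous_intros)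
qed

lemma phi_norm_pos:
  assumes "x \<ge> \<gamma>"
  shows "Re (integral {0..x} (\<lambda>x. phi1 x z * cnj (phi1 x z) + phi2 x z * cnj (phi2 x z))) > 0"
    and "Im (integral {0..x} (\<lambda>x. phi1 x z * cnj (phi1 x z) + phi2 x z * cnj (phi2 x z))) = 0"
proof -
  obtain y where y: "y \<in> {0<..<\<gamma>}" "phi2 y z \<noteq> 0" using phi_nz by blast
  have y': "y \<in> {0<..<x}" using y assms by auto
  have c: "continuous_on {0..x} (\<lambda>x. phi1 x z)" "continuous_on {0..x} (\<lambda>x. phi2 x z)"
    by (rule continuous_on_subset[OF phi_continuous(1)] continuous_on_subset[OF phi_continuous(2)], force)+
  show "Re (integral {0..x} (\<lambda>x. phi1 x z * cnj (phi1 x z) + phi2 x z * cnj (phi2 x z))) > 0"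
    and "Im (integral {0..x} (\<lambda>x. phi1 x z * cnj (phi1 x z) + phi2 x z * cnj (phi2 x z))) = 0"
    using integral_cmod_square_pos[OF c y' y(2)] by auto
qed

lemma psi_nz:
  assumes "s \<noteq> 0" "z \<noteq> of_real m" "x > 0"
  shows "psi1 s x \<noteq> 0 \<or> psi2 z s x \<noteq> 0"
  using psi_wronskian[OF assms(3), of s z] assms by auto

lemma psi_bound:
  "\<exists>C\<ge>0. \<forall>x\<ge>1. norm (psi1 s x) \<le> C * exp (- Re s * x) \<and> norm (psi2 z s x) \<le> C * exp (- Re s * x)"
proof -
  obtain C1 C2 where C: "C1 \<ge> 0" "\<And>x. x \<ge> 1 \<Longrightarrow> norm (jost \<kappa> s x) \<le> C1 * exp (- Re s * x)"
    "C2 \<ge> 0" "\<And>x. x \<ge> 1 \<Longrightarrow> norm (jost (\<kappa> - 1) s x) \<le> C2 * exp (- Re s * x)"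
    using jost_bound[of \<kappa> s] jost_bound[of "\<kappa> - 1" s] by metis
  define C where "C = max C1 (norm (z - of_real m) * C2)"
  have "norm (psi1 s x) \<le> C * exp (- Re s * x) \<and> norm (psi2 z s x) \<le> C * exp (- Re s * x)" if "x \<ge> 1" for x
  proof -
    have "norm (psi1 s x) \<le> C1 * exp (- Re s * x)" unfolding psi1_def by (rule C(2)[OF that])
    moreover have "norm (psi2 z s x) \<le> norm (z - of_real m) * (C2 * exp (- Re s * x))"
      unfolding psi2_def norm_mult using C(4)[OF that] by (intro mult_left_mono) auto
    moreover have "C1 * exp (- Re s * x) \<le> C * exp (- Re s * x)"
      "norm (z - of_real m) * C2 * exp (- Re s * x) \<le> C * exp (- Re s * x)"
      unfolding C_def by (auto intro!: mult_right_mono)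
    ultimately show ?thesis unfolding mult.assoc by (meson order_trans)
  qed
  moreover have "C \<ge> 0" using C by (simp add: C_def le_max_iff_disj)
  ultimately show ?thesis by blast
qed

lemma psi_tendsto_0:
  assumes "Re s > 0"
  shows "(psi1 s \<longlongrightarrow> 0) at_top" "(psi2 z s \<longlongrightarrow> 0) at_top"
proof -
  obtain C where C: "C \<ge> 0" "\<forall>x\<ge>1. norm (psi1 s x) \<le> C * exp (- Re s * x) \<and> norm (psi2 z s x) \<le> C * exp (- Re s * x)"
    using psi_bound by blast
  have "((\<lambda>x. C * exp (- Re s * x)) \<longlongrightarrow> 0) at_top"
    using assms by real_asymp
  moreover have "\<forall>\<^sub>F x in at_top. norm (psi1 s x) \<le> C * exp (- Re s * x)" "\<forall>\<^sub>F x in at_top. norm (psi2 z s x) \<le> C * exp (- Re s * x)"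
    using eventually_ge_at_top[of 1] by (eventually_elim, use C in auto)+
  ultimately show "(psi1 s \<longlongrightarrow> 0) at_top" "(psi2 z s \<longlongrightarrow> 0) at_top"
    by (auto intro: Lim_null_comparison)
qed

text \<open>Beyond \<open>X\<close> the solutions are spanned by psi(s) and psi(- s), and the
  Wronskian with psi(s) detects the component along psi(- s). The factor is \<open>c / w\<close> by
  Cramer's rule.\<close>

lemma parallel_psi:
  assumes s: "s\<^sup>2 = (of_real m)\<^sup>2 - z\<^sup>2" "s \<noteq> 0" "z \<noteq> of_real m"
    and f: "sol {X..} z (\<lambda>_. 0) (\<lambda>_. 0) f1 f2" "X \<ge> \<gamma>"
    and W: "f1 X * psi2 z s X - f2 X * psi1 s X = 0"
  obtains d where "\<And>x. x \<ge> X \<Longrightarrow> f1 x = d * psi1 s x \<and> f2 x = d * psi2 z s x"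
proof -
  define w where "w = (z - of_real m) * (2 * (- 1) ^ (\<kappa> - 1) * s ^ (2 * \<kappa> - 1))"
  have w: "w \<noteq> 0" using s by (simp add: w_def)
  define c where "c = f1 X * psi2 z (- s) X - f2 X * psi1 (- s) X"
  have s': "(- s)\<^sup>2 = (of_real m)\<^sup>2 - z\<^sup>2" using s by simp
  have "f1 x = c / w * psi1 s x \<and> f2 x = c / w * psi2 z s x" if x: "x \<ge> X" for x
  proof -
    have 1: "f1 x * psi2 z s x - f2 x * psi1 s x = 0"
      using psi_wronskian_const[OF s(1) f x] W by simp
    have 2: "f1 x * psi2 z (- s) x - f2 x * psi1 (- s) x = c"
      using psi_wronskian_const[OF s' f x] by (simp add: c_def)
    have 3: "psi1 s x * psi2 z (- s) x - psi2 z s x * psi1 (- s) x = w"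
      unfolding w_def using x f gamma_pos by (intro psi_wronskian) auto
    have "f1 x * w = (f1 x * psi2 z (- s) x - f2 x * psi1 (- s) x) * psi1 s x - (f1 x * psi2 z s x - f2 x * psi1 s x) * psi1 (- s) x"
      "f2 x * w = (f1 x * psi2 z (- s) x - f2 x * psi1 (- s) x) * psi2 z s x - (f1 x * psi2 z s x - f2 x * psi1 s x) * psi2 z (- s) x"
      unfolding 3[symmetric] by (simp_all add: algebra_simps)
    hence "f1 x * w = c * psi1 s x" "f2 x * w = c * psi2 z s x" unfolding 1 2 by simp_all
    thus ?thesis using w by (simp add: field_simps)
  qed
  thus thesis by (rule that)
qed

text \<open>Proportionality is taken at one point and with \<open>phi\<close> as the reference, so
  that \<open>c\<close> is nonzero because psi does not vanish.\<close>

lemma phi_parallel_psi: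
  assumes s: "s\<^sup>2 = (of_real m)\<^sup>2 - z\<^sup>2" "s \<noteq> 0" "z \<noteq> of_real m" and J: "jost_fn z s = 0" and x: "x \<ge> \<gamma>"
    and nz: "phi1 x z \<noteq> 0 \<or> phi2 x z \<noteq> 0"
  obtains c where "c \<noteq> 0" "psi1 s x = c * phi1 x z" "psi2 z s x = c * phi2 x z"
proof -
  have W: "phi1 x z * psi2 z s x - phi2 x z * psi1 s x = 0" using jost_fn_eq[OF s(1) x] J by simp
  have pz: "psi1 s x \<noteq> 0 \<or> psi2 z s x \<noteq> 0" using psi_nz[OF s(2,3), of x] x gamma_pos by auto
  define c where "c = (if phi1 x z \<noteq> 0 then psi1 s x / phi1 x z else psi2 z s x / phi2 x z)"
  have e: "psi1 s x = c * phi1 x z" "psi2 z s x = c * phi2 x z"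
    using W nz by (auto simp: c_def field_simps)
  moreover have "c \<noteq> 0" using e pz by auto
  ultimately show thesis using that by blast
qed

text \<open>Self-adjointness in concrete form. Lagrange's identity from 0 makes
  \<open>Im (phi1 * cnj phi2)\<close> strictly positive at \<open>\<gamma>\<close>. If psi(s) were
  proportional to \<open>phi\<close> there, the same expression for psi would be positive at
  \<open>\<gamma>\<close>, yet it is nondecreasing beyond \<open>\<gamma>\<close> and tends to
  0.\<close>

lemma jost_fn_nz_upper:
  assumes s: "s\<^sup>2 = (of_real m)\<^sup>2 - z\<^sup>2" and z: "Im z > 0" and Re: "Re s > 0"
  shows "jost_fn z s \<noteq> 0"
proof
  assume J: "jost_fn z s = 0"
  have nz: "s \<noteq> 0" "z \<noteq> of_real m" using z Re by auto
  let ?I = "integral {0..\<gamma>} (\<lambda>x. phi1 x z * cnj (phi1 x z) + phi2 x z * cnj (phi2 x z))"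
  have "phi1 \<gamma> z * cnj (phi2 \<gamma> z) - phi2 \<gamma> z * cnj (phi1 \<gamma> z) = (z - cnj z) * ?I"
    using gamma_pos by (intro phi_wronskian_cnj) auto
  hence "Im (phi1 \<gamma> z * cnj (phi2 \<gamma> z) - phi2 \<gamma> z * cnj (phi1 \<gamma> z)) = 2 * Im z * Re ?I"
    using phi_norm_pos[of \<gamma> z] by simp
  hence P: "Im (phi1 \<gamma> z * cnj (phi2 \<gamma> z)) > 0"
    using mult_pos_pos[OF z phi_norm_pos(1)[OF order_refl, of z]] by (simp add: algebra_simps)
  hence "phi1 \<gamma> z \<noteq> 0 \<or> phi2 \<gamma> z \<noteq> 0" by auto
  then obtain c where c: "c \<noteq> 0" "psi1 s \<gamma> = c * phi1 \<gamma> z" "psi2 z s \<gamma> = c * phi2 \<gamma> z"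
    using phi_parallel_psi[OF s nz J order_refl] by blast
  have "psi1 s \<gamma> * cnj (psi2 z s \<gamma>) = of_real ((norm c)\<^sup>2) * (phi1 \<gamma> z * cnj (phi2 \<gamma> z))"
    unfolding c complex_norm_square by simp
  hence Q: "Im (psi1 s \<gamma> * cnj (psi2 z s \<gamma>)) > 0"
    using P c(1) by simp
  let ?W = "\<lambda>x. psi1 s x * cnj (psi2 z s x) - psi2 z s x * cnj (psi1 s x)"
  have "ac_on {\<gamma>..} ?W (\<lambda>x. (z - cnj z) * (psi1 s x * cnj (psi1 s x) + psi2 z s x * cnj (psi2 z s x)) +
     (0 * cnj (psi1 s x) + 0 * cnj (psi2 z s x)) - (psi1 s x * cnj 0 + psi2 z s x * cnj 0))"
    by (rule sol_wronskian[OF psi_sol[OF s] sol_cnj[OF psi_sol[OF s] ray_intervals(2)] ray_intervals(2)])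
  hence "ac_on {\<gamma>..} (\<lambda>x. - \<i> * ?W x) (\<lambda>x. - \<i> * ((z - cnj z) * (psi1 s x * cnj (psi1 s x) + psi2 z s x * cnj (psi2 z s x)) +
     (0 * cnj (psi1 s x) + 0 * cnj (psi2 z s x)) - (psi1 s x * cnj 0 + psi2 z s x * cnj 0)))"
    by (rule ac_on_cmult)
  hence mono: "Re (- \<i> * ?W \<gamma>) \<le> Re (- \<i> * ?W x)" if "x \<ge> \<gamma>" for x
  proof (rule ac_on_mono[OF _ ray_intervals(2)])
    fix y
    have "- \<i> * ((z - cnj z) * (psi1 s y * cnj (psi1 s y) + psi2 z s y * cnj (psi2 z s y)) +
     (0 * cnj (psi1 s y) + 0 * cnj (psi2 z s y)) - (psi1 s y * cnj 0 + psi2 z s y * cnj 0))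
       = of_real (2 * Im z * ((norm (psi1 s y))\<^sup>2 + (norm (psi2 z s y))\<^sup>2))"
      unfolding complex_diff_cnj complex_norm_square[symmetric] by simp
    moreover have "2 * Im z * ((norm (psi1 s y))\<^sup>2 + (norm (psi2 z s y))\<^sup>2) \<ge> 0" using z by simp
    ultimately show "- \<i> * ((z - cnj z) * (psi1 s y * cnj (psi1 s y) + psi2 z s y * cnj (psi2 z s y)) +
     (0 * cnj (psi1 s y) + 0 * cnj (psi2 z s y)) - (psi1 s y * cnj 0 + psi2 z s y * cnj 0)) \<in> \<real> \<and>
     0 \<le> Re (- \<i> * ((z - cnj z) * (psi1 s y * cnj (psi1 s y) + psi2 z s y * cnj (psi2 z s y)) +
     (0 * cnj (psi1 s y) + 0 * cnj (psi2 z s y)) - (psi1 s y * cnj 0 + psi2 z s y * cnj 0)))"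
      by (metis Re_complex_of_real Reals_of_real)
  qed (use that in auto)
  have "((\<lambda>x. Re (- \<i> * ?W x)) \<longlongrightarrow> Re (- \<i> * (0 * cnj 0 - 0 * cnj 0))) at_top"
    by (intro tendsto_intros psi_tendsto_0 Re)
  hence "((\<lambda>x. Re (- \<i> * ?W x)) \<longlongrightarrow> 0) at_top" by simp
  moreover have "\<forall>\<^sub>F x in at_top. Re (- \<i> * ?W \<gamma>) \<le> Re (- \<i> * ?W x)"
    using eventually_ge_at_top[of \<gamma>] by eventually_elim (rule mono)
  ultimately have "Re (- \<i> * ?W \<gamma>) \<le> 0"
    by (intro tendsto_lowerbound) auto
  moreover have "Re (- \<i> * ?W \<gamma>) = 2 * Im (psi1 s \<gamma> * cnj (psi2 z s \<gamma>))" by (simp add: algebra_simps)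
  ultimately show False using Q by simp
qed

end

subsection \<open>The resolvent\<close>

lemma L2_I:
  fixes f :: "real \<Rightarrow> 'a::euclidean_space"
  assumes "f \<in> borel_measurable half_line" "integrable half_line g" "\<And>x. x > 0 \<Longrightarrow> (norm (f x))\<^sup>2 \<le> g x"
  shows "f \<in> L2"
  unfolding L2_def
proof (intro CollectI conjI assms(1))
  show "integrable half_line (\<lambda>x. (norm (f x))\<^sup>2)"
    by (rule Bochner_Integration.integrable_bound[OF assms(2)])
      (use assms in \<open>auto intro!: AE_I2 order_trans[OF assms(3)]\<close>)
qed

lemma L2_measurable: "f \<in> L2 \<Longrightarrow> f \<in> borel_measurable half_line"
  and L2_integrable: "f \<in> L2 \<Longrightarrow> integrable half_line (\<lambda>x. (norm (f x))\<^sup>2)"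
  by (auto simp: L2_def)

lemma L2_add:
  fixes f g :: "real \<Rightarrow> 'a::euclidean_space"
  assumes "f \<in> L2" "g \<in> L2"
  shows "(\<lambda>x. f x + g x) \<in> L2"
proof (rule L2_I)
  show "(\<lambda>x. f x + g x) \<in> borel_measurable half_line"
    using assms by (intro borel_measurable_add L2_measurable)
  show "integrable half_line (\<lambda>x. 2 * (norm (f x))\<^sup>2 + 2 * (norm (g x))\<^sup>2)"
    using assms by (auto intro!: L2_integrable)
  fix x
  have "(norm (f x + g x))\<^sup>2 \<le> (norm (f x) + norm (g x))\<^sup>2"
    by (intro power_mono norm_triangle_ineq) auto
  also have "\<dots> \<le> 2 * (norm (f x))\<^sup>2 + 2 * (norm (g x))\<^sup>2"
    using sum_squares_bound[of "norm (f x)" "norm (g x)"] by (simp add: power2_sum)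
  finally show "(norm (f x + g x))\<^sup>2 \<le> 2 * (norm (f x))\<^sup>2 + 2 * (norm (g x))\<^sup>2" .
qed

lemma L2_linear:
  fixes f :: "real \<Rightarrow> 'a::euclidean_space" and L :: "'a \<Rightarrow> 'b::euclidean_space"
  assumes "f \<in> L2" "bounded_linear L"
  shows "(\<lambda>x. L (f x)) \<in> L2"
proof -
  obtain K where K: "\<And>x. norm (L x) \<le> norm x * K" using bounded_linear.bounded[OF assms(2)] by blast
  show ?thesis
  proof (rule L2_I)
    have "L \<in> borel_measurable borel"
      by (intro borel_measurable_continuous_onI linear_continuous_on assms)
    from measurable_compose[OF L2_measurable[OF assms(1)] this]
    show "(\<lambda>x. L (f x)) \<in> borel_measurable half_line" .
    show "integrable half_line (\<lambda>x. K\<^sup>2 * (norm (f x))\<^sup>2)"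
      using assms by (auto intro!: L2_integrable)
    show "(norm (L (f x)))\<^sup>2 \<le> K\<^sup>2 * (norm (f x))\<^sup>2" for x
      using power_mono[OF K[of "f x"] norm_ge_zero, of 2] by (simp add: power_mult_distrib mult.commute)
  qed
qed

lemma L2_lower_bound:
  fixes f :: "real \<Rightarrow> 'a::euclidean_space"
  assumes "f \<in> L2" "0 < s" "s \<le> t" "\<And>x. x \<in> {s..t} \<Longrightarrow> b \<le> (norm (f x))\<^sup>2"
  shows "(t - s) * b \<le> (LINT x|half_line. (norm (f x))\<^sup>2)"
proof -
  have i: "integrable half_line (\<lambda>x. indicator {s..t} x *\<^sub>R b)"
    and v: "(LINT x|half_line. indicator {s..t} x *\<^sub>R b) = (t - s) * b"
  proof -
    have eq: "(\<lambda>x. indicator {0<..} x *\<^sub>R (indicator {s..t} x *\<^sub>R b)) = (\<lambda>x. indicator {s..t} x *\<^sub>R b)"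
      using assms by (auto simp: indicator_def fun_eq_iff)
    have j: "integrable lebesgue (\<lambda>x. indicator {s..t} x *\<^sub>R b)"
      using assms by (intro integrable_scaleR_left impI integrable_real_indicator) auto
    thus "integrable half_line (\<lambda>x. indicator {s..t} x *\<^sub>R b)"
      by (subst integrable_restrict_space, simp) (simp only: eq)
    have "(LINT x|half_line. indicator {s..t} x *\<^sub>R b) = (LINT x|lebesgue. indicator {s..t} x *\<^sub>R b)"
      by (subst integral_restrict_space, simp) (simp only: eq)
    also have "\<dots> = (t - s) * b" using assms by (simp add: integral_scaleR_left)
    finally show "(LINT x|half_line. indicator {s..t} x *\<^sub>R b) = (t - s) * b" .
  qed
  have "(LINT x|half_line. indicator {s..t} x *\<^sub>R b) \<le> (LINT x|half_line. (norm (f x))\<^sup>2)"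
    by (intro integral_mono i L2_integrable assms) (use assms(4) in \<open>auto simp: indicator_def\<close>)
  thus ?thesis unfolding v .
qed

text \<open>A positive lower bound \<open>c / M\<close> of the norm on \<open>{X..}\<close> makes
  the square integral over a sufficiently long interval exceed the total \<open>N\<close>; the
  length is chosen to produce \<open>\<bar>N\<bar> + 1\<close>.\<close>

lemma L2_no_lower_bound_at_infinity:
  fixes f :: "real \<Rightarrow> 'a::euclidean_space"
  assumes "f \<in> L2" "\<And>x. x \<ge> X \<Longrightarrow> c \<le> M * norm (f x)"
  shows "c \<le> 0"
proof (rule ccontr)
  assume "\<not> c \<le> 0"
  hence c: "c > 0" by simp
  have M: "M > 0" using assms(2)[of X] c by (smt (verit) norm_ge_zero mult_nonpos_nonneg)
  define N where "N = (LINT x|half_line. (norm (f x))\<^sup>2)"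
  define s where "s = max X 1"
  define t where "t = s + (\<bar>N\<bar> + 1) / (c / M)\<^sup>2"
  have "s \<le> t" unfolding t_def by simp
  have "(t - s) * (c / M)\<^sup>2 \<le> N"
    unfolding N_def
  proof (rule L2_lower_bound[OF assms(1) _ \<open>s \<le> t\<close>])
    fix x assume "x \<in> {s..t}"
    hence "c \<le> M * norm (f x)" by (intro assms(2)) (auto simp: s_def)
    hence "c / M \<le> norm (f x)" using M by (simp add: field_simps)
    thus "(c / M)\<^sup>2 \<le> (norm (f x))\<^sup>2" using c M by (intro power_mono) auto
  qed (simp add: s_def)
  moreover have "(t - s) * (c / M)\<^sup>2 = \<bar>N\<bar> + 1" using c M by (simp add: t_def)
  ultimately show False by linarith
qed

text \<open>For positive \<open>c\<close> the norm would stay above \<open>c / (M * x)\<close>,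
  whose square is not integrable at 0: the interval \<open>{t..2*t}\<close> alone contributes at
  least \<open>(c / M)\<^sup>2 / (4 * t)\<close>. The application is to a Wronskian that is constant
  near 0.\<close>

lemma L2_no_pole_at_0:
  fixes f :: "real \<Rightarrow> 'a::euclidean_space"
  assumes "f \<in> L2" "d > 0" "\<And>x. 0 < x \<Longrightarrow> x \<le> d \<Longrightarrow> c \<le> M * x * norm (f x)"
  shows "c \<le> 0"
proof (rule ccontr)
  assume "\<not> c \<le> 0"
  hence c: "c > 0" by simp
  have M: "M > 0" using assms(3)[of d] assms(2) c by (smt (verit) norm_ge_zero mult_nonpos_nonneg mult_nonneg_nonneg mult_pos_pos zero_less_mult_pos2)
  define N where "N = (LINT x|half_line. (norm (f x))\<^sup>2)"
  have *: "(c / M)\<^sup>2 / (4 * t) \<le> N" if t: "0 < t" "2 * t \<le> d" for t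
  proof -
    have "(2 * t - t) * (c / (M * (2 * t)))\<^sup>2 \<le> N"
      unfolding N_def
    proof (rule L2_lower_bound[OF assms(1)])
      fix x assume x: "x \<in> {t..2*t}"
      have "c \<le> M * x * norm (f x)" using x t by (intro assms(3)) auto
      also have "\<dots> \<le> M * (2 * t) * norm (f x)" using x M by (intro mult_right_mono mult_left_mono) auto
      finally have "c / (M * (2 * t)) \<le> norm (f x)" using M t by (simp add: field_simps)
      thus "(c / (M * (2 * t)))\<^sup>2 \<le> (norm (f x))\<^sup>2" using c M t by (intro power_mono) auto
    qed (use t in auto)
    also have "(2 * t - t) * (c / (M * (2 * t)))\<^sup>2 = (c / M)\<^sup>2 / (4 * t)"
      using t M by (simp add: field_simps power2_eq_square)
    finally show ?thesis .
  qed
  define t where "t = min (d / 2) ((c / M)\<^sup>2 / (4 * (\<bar>N\<bar> + 1)))"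
  have q: "(c / M)\<^sup>2 > 0" using c M by simp
  have "(c / M)\<^sup>2 / (4 * (\<bar>N\<bar> + 1)) > 0" using q by (intro divide_pos_pos) auto
  hence t: "0 < t" "2 * t \<le> d" using assms(2) unfolding t_def by auto
  have "t \<le> (c / M)\<^sup>2 / (4 * (\<bar>N\<bar> + 1))" by (simp add: t_def)
  hence "\<bar>N\<bar> + 1 \<le> (c / M)\<^sup>2 / (4 * t)"
    using t unfolding pos_le_divide_eq[OF mult_pos_pos[OF zero_less_numeral t(1)]]
    by (subst (asm) pos_le_divide_eq) (auto simp: algebra_simps)
  thus False using *[OF t] by linarith
qed

section \<open>Operator graphs and test functions in terms of the first-order system\<close>

lemma has_ac_derivative_iff_components:
  "has_ac_derivative f f' \<longleftrightarrow>
     ac_on {0<..} (\<lambda>x. fst (f x)) (\<lambda>x. fst (f' x)) \<and> ac_on {0<..} (\<lambda>x. snd (f x)) (\<lambda>x. snd (f' x))"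
proof
  assume L: "has_ac_derivative f f'"
  have "L (f b) - L (f a) = integral {a..b} (\<lambda>x. L (f' x)) \<and> (\<lambda>x. L (f' x)) absolutely_integrable_on {a..b}"
    if "bounded_linear L" "0 < a" "a \<le> b" for L :: "complex \<times> complex \<Rightarrow> complex" and a b
  proof -
    have F: "f' absolutely_integrable_on {a..b}" "f b - f a = integral {a..b} f'"
      using L that unfolding has_ac_derivative_def by auto
    have "L (f b) - L (f a) = L (f b - f a)" using linear_diff[OF bounded_linear.linear[OF that(1)]] by simp
    also have "\<dots> = integral {a..b} (L \<circ> f')"
      unfolding F(2) by (rule integral_linear[symmetric]) (use F that set_lebesgue_integral_eq_integral(1) in auto)
    finally show ?thesis using absolutely_integrable_linear[OF F(1) that(1)] by (simp add: o_def)
  qed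
  from this[OF bounded_linear_fst] this[OF bounded_linear_snd]
  show "ac_on {0<..} (\<lambda>x. fst (f x)) (\<lambda>x. fst (f' x)) \<and> ac_on {0<..} (\<lambda>x. snd (f x)) (\<lambda>x. snd (f' x))"
    unfolding ac_on_def by auto
next
  assume R: "ac_on {0<..} (\<lambda>x. fst (f x)) (\<lambda>x. fst (f' x)) \<and> ac_on {0<..} (\<lambda>x. snd (f x)) (\<lambda>x. snd (f' x))"
  show "has_ac_derivative f f'"
    unfolding has_ac_derivative_def
  proof (intro allI impI)
    fix a b :: real assume ab: "0 < a" "a \<le> b"
    have ab': "a \<in> {0<..}" "b \<in> {0<..}" using ab by auto
    note F = ac_onD[OF conjunct1[OF R] ab' ab(2)] and G = ac_onD[OF conjunct2[OF R] ab' ab(2)]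
    have l1: "bounded_linear (\<lambda>x::complex. (x, 0::complex))" and l2: "bounded_linear (\<lambda>x::complex. (0::complex, x))"
      by (auto intro!: bounded_linear_Pair bounded_linear_ident bounded_linear_zero)
    have A: "(\<lambda>x. (fst (f' x), 0::complex)) absolutely_integrable_on {a..b}"
      "(\<lambda>x. (0::complex, snd (f' x))) absolutely_integrable_on {a..b}"
      using absolutely_integrable_linear[OF F(1) l1] absolutely_integrable_linear[OF G(1) l2] by (simp_all add: o_def)
    have I: "integral {a..b} (\<lambda>x. (fst (f' x), 0::complex)) = (fst (f b) - fst (f a), 0)"
      "integral {a..b} (\<lambda>x. (0::complex, snd (f' x))) = (0, snd (f b) - snd (f a))"
      using integral_linear[OF set_lebesgue_integral_eq_integral(1)[OF F(1)] l1]
        integral_linear[OF set_lebesgue_integral_eq_integral(1)[OF G(1)] l2] F(2) G(2) by (simp_all add: o_def)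
    have eq: "f' = (\<lambda>x. (fst (f' x), 0) + (0, snd (f' x)))" by auto
    have 1: "f' absolutely_integrable_on {a..b}"
      using set_integral_add(1)[OF A] by (subst eq)
    have "integral {a..b} (\<lambda>x. (fst (f' x), 0) + (0, snd (f' x))) = (fst (f b) - fst (f a), 0) + (0, snd (f b) - snd (f a))"
      unfolding I[symmetric] by (intro Henstock_Kurzweil_Integration.integral_add set_lebesgue_integral_eq_integral(1) A)
    hence "integral {a..b} f' = f b - f a"
      unfolding eq[symmetric] by (simp add: prod_eq_iff)
    with 1 show "f' absolutely_integrable_on {a..b} \<and> f b - f a = integral {a..b} f'" by simp
  qed
qed

text \<open>Test functions are total and arbitrary on \<open>x \<le> 0\<close>. With the value 0
  there, the source becomes continuous on the whole line, as \<open>regular_solution\<close>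
  demands.\<close>

definition cutoff :: "(real \<Rightarrow> complex) \<Rightarrow> real \<Rightarrow> complex" where
  "cutoff f x = (if x > 0 then f x else 0)"

lemma test_function_support:
  assumes "h \<in> test_functions"
  obtains e X where "0 < e" "\<And>x. 0 < x \<Longrightarrow> x \<le> e \<Longrightarrow> h x = 0" "\<And>x. x \<ge> X \<Longrightarrow> h x = 0" "X \<ge> X0" "e < X"
    "continuous_on UNIV (cutoff (\<lambda>x. fst (h x)))" "continuous_on UNIV (cutoff (\<lambda>x. snd (h x)))"
proof -
  obtain K where K: "continuous_on {0<..} h" "compact K" "K \<subseteq> {0<..}" "\<And>x. x > 0 \<Longrightarrow> x \<notin> K \<Longrightarrow> h x = 0"
    using assms unfolding test_functions_def by blast
  have "open (- K)" "0 \<in> - K" using K by (auto simp: compact_imp_closed)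
  then obtain d where d: "d > 0" "ball 0 d \<subseteq> - K" using open_contains_ball by blast
  obtain B where B: "\<And>x. x \<in> K \<Longrightarrow> \<bar>x\<bar> \<le> B"
    using compact_imp_bounded[OF K(2)] unfolding bounded_iff by auto
  define e where "e = d / 2"
  define X where "X = max (max X0 (e + 1)) (\<bar>B\<bar> + 1)"
  have e: "e > 0" using d by (simp add: e_def)
  have h0: "h x = 0" if "0 < x" "x \<le> e" for x
  proof -
    have "x \<in> ball 0 d" using that e by (auto simp: e_def)
    thus ?thesis using d K(4) that by blast
  qed
  have hX: "h x = 0" if "x \<ge> X" for x
  proof (rule K(4))
    show "x > 0" using that e by (auto simp: X_def)
    show "x \<notin> K" using B[of x] that by (auto simp: X_def)
  qed
  have cont: "continuous_on UNIV (cutoff f)" if "continuous_on {0<..} f" "\<And>x. 0 < x \<Longrightarrow> x \<le> e \<Longrightarrow> f x = 0" for f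
  proof -
    have "continuous_on {0<..} (cutoff f)"
      using that(1) by (rule continuous_on_eq) (auto simp: cutoff_def)
    moreover have "continuous_on {..<e} (cutoff f)"
      by (rule continuous_on_eq[OF continuous_on_const[of _ 0]]) (use that(2) in \<open>auto simp: cutoff_def\<close>)
    ultimately have "continuous_on ({0<..} \<union> {..<e}) (cutoff f)"
      by (intro continuous_on_open_Un) auto
    moreover have "{0<..} \<union> {..<e} = UNIV" using e by auto
    ultimately show ?thesis by simp
  qed
  show thesis
    by (rule that[of e X]) (use e h0 hX K(1) in \<open>auto simp: X_def intro!: cont continuous_intros\<close>)
qed

lemma AE_half_line_iff: "(AE x in half_line. P x) \<longleftrightarrow> (AE x in lebesgue. x \<in> {0<..} \<longrightarrow> P x)"
  by (rule AE_restrict_space_iff) auto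

context dirac_regular
begin

text \<open>\<open>X\<close> is chosen beyond the supports of \<open>v\<close> and of the source.\<close>

definition admissible :: "real \<Rightarrow> complex \<Rightarrow> complex \<Rightarrow> (real \<Rightarrow> complex) \<Rightarrow> (real \<Rightarrow> complex) \<Rightarrow> bool" where
  "admissible X z s f1 f2 \<longleftrightarrow> continuous_on {0..} f1 \<and> continuous_on {0..} f2 \<and>
     (\<exists>C. \<forall>x\<in>{0..1}. norm (f1 x) \<le> C * x \<and> norm (f2 x) \<le> C * x) \<and>
     (\<exists>d. \<forall>x\<ge>X. f1 x = d * psi1 s x \<and> f2 x = d * psi2 z s x)"

lemma admissible_decay:
  assumes "admissible X z s f1 f2" "Re s > 0"
  obtains M where "M \<ge> 0" "\<And>x. x > 0 \<Longrightarrow> norm (f1 x) \<le> M * exp (- Re s * x) \<and> norm (f2 x) \<le> M * exp (- Re s * x)"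
proof -
  obtain d where d: "\<And>x. x \<ge> X \<Longrightarrow> f1 x = d * psi1 s x \<and> f2 x = d * psi2 z s x"
    using assms unfolding admissible_def by blast
  obtain C where C: "C \<ge> 0" "\<forall>x\<ge>1. norm (psi1 s x) \<le> C * exp (- Re s * x) \<and> norm (psi2 z s x) \<le> C * exp (- Re s * x)"
    using psi_bound by blast
  define Y where "Y = max X 1"
  have "bounded (f1 ` {0..Y})" "bounded (f2 ` {0..Y})"
    using assms(1) by (auto simp: admissible_def intro!: compact_imp_bounded compact_continuous_image elim: continuous_on_subset)
  then obtain M1 M2 where M: "\<forall>x\<in>{0..Y}. norm (f1 x) \<le> M1" "\<forall>x\<in>{0..Y}. norm (f2 x) \<le> M2"
    unfolding bounded_iff ball_simps by blast
  \<comment> \<open>The factor \<open>exp (Re s * Y)\<close> compensates the decay on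
    \<open>{0..Y}\<close>, so that one exponential bound covers both ranges of
    \<open>x\<close>.\<close>
  define N where "N = max 0 (max M1 M2) * exp (Re s * Y)"
  define M' where "M' = N + norm d * C"
  have N0: "N \<ge> 0" "norm d * C \<ge> 0" using C by (auto simp: N_def)
  have "norm (f1 x) \<le> M' * exp (- Re s * x) \<and> norm (f2 x) \<le> M' * exp (- Re s * x)" if x: "x > 0" for x
  proof (cases "x \<le> Y")
    case True
    have "max 0 (max M1 M2) * 1 \<le> max 0 (max M1 M2) * (exp (Re s * Y) * exp (- Re s * x))"
      using True assms(2) by (intro mult_left_mono) (auto simp flip: exp_add)
    also have "\<dots> = N * exp (- Re s * x)" by (simp add: N_def)
    also have "\<dots> \<le> M' * exp (- Re s * x)" using N0 by (intro mult_right_mono) (auto simp: M'_def)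
    finally have "max 0 (max M1 M2) \<le> M' * exp (- Re s * x)" by simp
    moreover have "norm (f1 x) \<le> M1" "norm (f2 x) \<le> M2" using M True x by auto
    ultimately show ?thesis by linarith
  next
    case False
    hence x: "x \<ge> X" "x \<ge> 1" by (auto simp: Y_def)
    have "norm d * (C * exp (- Re s * x)) \<le> M' * exp (- Re s * x)"
      unfolding mult.assoc[symmetric] using N0 by (intro mult_right_mono) (auto simp: M'_def)
    moreover have "norm (f1 x) \<le> norm d * (C * exp (- Re s * x))" "norm (f2 x) \<le> norm d * (C * exp (- Re s * x))"
      using d[OF x(1)] C(2) x(2) by (auto simp: norm_mult intro!: mult_left_mono)
    ultimately show ?thesis by linarith
  qed
  thus thesis using that[of M'] N0 by (auto simp: M'_def)
qed

lemma admissible_L2: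
  assumes "admissible X z s f1 f2" "Re s > 0"
  shows "(\<lambda>x. (f1 x, f2 x)) \<in> L2"
proof -
  obtain M where M: "M \<ge> 0" "\<And>x. x > 0 \<Longrightarrow> norm (f1 x) \<le> M * exp (- Re s * x) \<and> norm (f2 x) \<le> M * exp (- Re s * x)"
    using admissible_decay[OF assms] by blast
  show ?thesis
  proof (rule L2_I)
    have "continuous_on {0<..} (\<lambda>x. (f1 x, f2 x))"
      using assms(1) by (auto simp: admissible_def intro!: continuous_on_Pair elim: continuous_on_subset)
    thus "(\<lambda>x. (f1 x, f2 x)) \<in> borel_measurable half_line"
      by (intro continuous_imp_measurable_on_sets_lebesgue) auto
    have "(\<lambda>x. exp (- (2 * Re s) * x)) integrable_on {0..}"
      using assms(2) by (intro integrable_on_exp_minus_to_infinity) auto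
    hence "(\<lambda>x. exp (- (2 * Re s) * x)) absolutely_integrable_on {0..}"
      by (intro nonnegative_absolutely_integrable_1) auto
    hence "(\<lambda>x. exp (- (2 * Re s) * x)) absolutely_integrable_on {0<..}"
      by (rule set_integrable_subset) auto
    hence "integrable half_line (\<lambda>x. exp (- (2 * Re s) * x))"
      by (simp add: set_integrable_def integrable_restrict_space)
    thus "integrable half_line (\<lambda>x. 2 * M\<^sup>2 * exp (- (2 * Re s) * x))" by simp
    fix x :: real assume x: "x > 0"
    have "(norm (f1 x))\<^sup>2 + (norm (f2 x))\<^sup>2 \<le> (M * exp (- Re s * x))\<^sup>2 + (M * exp (- Re s * x))\<^sup>2"
      using M(2)[OF x] by (intro add_mono power_mono) auto
    also have "\<dots> = 2 * M\<^sup>2 * exp (- (2 * Re s) * x)"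
      by (simp add: power_mult_distrib power2_eq_square flip: exp_add)
    finally show "(norm (f1 x, f2 x))\<^sup>2 \<le> 2 * M\<^sup>2 * exp (- (2 * Re s) * x)"
      by (simp add: norm_prod_def)
  qed
qed

lemma mult_potential_L2:
  assumes f: "f \<in> borel_measurable half_line" and M: "\<And>x. x > 0 \<Longrightarrow> norm (f x :: complex \<times> complex) \<le> M"
  shows "(\<lambda>x. v x *\<^sub>R f x) \<in> L2"
proof (rule L2_I)
  show "(\<lambda>x. v x *\<^sub>R f x) \<in> borel_measurable half_line"
    using L2_measurable[OF v_L2] f by (intro borel_measurable_scaleR)
  show "integrable half_line (\<lambda>x. M\<^sup>2 * (norm (v x))\<^sup>2)"
    using L2_integrable[OF v_L2] by simp
  fix x :: real assume "x > 0"
  from M[OF this] have "\<bar>v x\<bar> * norm (f x) \<le> \<bar>v x\<bar> * M" by (intro mult_left_mono) auto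
  from power_mono[OF this, of 2] show "(norm (v x *\<^sub>R f x))\<^sup>2 \<le> M\<^sup>2 * (norm (v x))\<^sup>2"
    by (simp add: power_mult_distrib mult.commute)
qed

text \<open>The solution decays, hence it is bounded and square integrable, and \<open>v * f\<close>
  is square integrable because \<open>v\<close> is. So \<open>h + z * f - v * f\<close>, the image
  under the free operator, lies in \<open>L2\<close>; the boundary condition follows from the linear
  bound at 0.\<close>

lemma resolvent_relation_of_sol:
  assumes sol: "sol {0<..} z h1 h2 f1 f2" and adm: "admissible X z s f1 f2" and s: "Re s > 0"
    and h: "(\<lambda>x. (h1 x, h2 x)) \<in> L2"
  shows "\<exists>g. H_graph \<kappa> m v (\<lambda>x. (f1 x, f2 x)) g \<and>
     (AE x in half_line. (fst (g x) - z * f1 x, snd (g x) - z * f2 x) = (h1 x, h2 x))"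
proof -
  let ?f = "\<lambda>x. (f1 x, f2 x)"
  define f' where "f' = (\<lambda>x. (- (of_real (real \<kappa> / x) * f1 x) + (z + of_real m - of_real (v x)) * f2 x + h2 x,
     of_real (real \<kappa> / x) * f2 x + (of_real m - z + of_real (v x)) * f1 x - h1 x))"
  have fL2: "?f \<in> L2" by (rule admissible_L2[OF adm s])
  obtain M where M: "M \<ge> 0" "\<And>x. x > 0 \<Longrightarrow> norm (f1 x) \<le> M * exp (- Re s * x) \<and> norm (f2 x) \<le> M * exp (- Re s * x)"
    using admissible_decay[OF adm s] by blast
  have bnd: "norm (?f x) \<le> M + M" if "x > 0" for x
  proof -
    have "exp (- Re s * x) \<le> 1" using that s by simp
    hence "M * exp (- Re s * x) \<le> M" using M(1) mult_left_le by blast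
    hence "norm (f1 x) \<le> M" "norm (f2 x) \<le> M" using M(2)[OF that] by auto
    thus ?thesis using norm_Pair_le[of "f1 x" "f2 x"] by linarith
  qed
  have vf: "(\<lambda>x. v x *\<^sub>R ?f x) \<in> L2"
    by (rule mult_potential_L2[OF L2_measurable[OF fL2] bnd])
  have zf: "(\<lambda>x. (z * f1 x, z * f2 x)) \<in> L2"
    using L2_linear[OF fL2, of "\<lambda>p. (z * fst p, z * snd p)"]
    by (simp add: bounded_linear_Pair bounded_linear_const_mult bounded_linear_fst bounded_linear_snd)
  define g0 where "g0 = (\<lambda>x. ((h1 x, h2 x) + (z * f1 x, z * f2 x)) + (- 1) *\<^sub>R (v x *\<^sub>R ?f x))"
  have g0: "g0 \<in> L2"
    unfolding g0_def by (intro L2_add h zf L2_linear[OF vf] bounded_linear_scaleR_right)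
  obtain C where C: "\<forall>x\<in>{0..1}. norm (f1 x) \<le> C * x \<and> norm (f2 x) \<le> C * x"
    using adm unfolding admissible_def by blast
  have f10: "(f1 \<longlongrightarrow> 0) (at_right 0)"
  proof (rule Lim_null_comparison)
    show "\<forall>\<^sub>F x in at_right 0. norm (f1 x) \<le> C * x"
      using eventually_at_right_real[OF zero_less_one] by eventually_elim (use C in auto)
    show "((\<lambda>x. C * x) \<longlongrightarrow> 0) (at_right 0)"
      by (rule tendsto_eq_intros | simp)+
  qed
  have ac: "has_ac_derivative ?f f'"
    unfolding has_ac_derivative_iff_components f'_def using sol by (simp add: sol_def)
  have "H0_graph \<kappa> m ?f g0"
    unfolding H0_graph_def
    by (intro conjI exI[of _ f'] fL2 g0 ac)
      (auto simp: f10 f'_def g0_def scaleR_conv_of_real algebra_simps)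
  hence "H_graph \<kappa> m v ?f (\<lambda>x. g0 x + v x *\<^sub>R ?f x)"
    unfolding H_graph_def using vf by blast
  thus ?thesis
    by (intro exI[of _ "\<lambda>x. g0 x + v x *\<^sub>R ?f x"]) (auto simp: g0_def)
qed

text \<open>This is applied to the element picked by the choice operator in
  \<open>resolvent\<close>, of whose form nothing else is known.\<close>

lemma sol_of_resolvent_relation:
  assumes "H_graph \<kappa> m v f g" "AE x in half_line. (fst (g x) - z * fst (f x), snd (g x) - z * snd (f x)) = h x"
  shows "sol {0<..} z (\<lambda>x. fst (h x)) (\<lambda>x. snd (h x)) (\<lambda>x. fst (f x)) (\<lambda>x. snd (f x))" "f \<in> L2"
proof -
  obtain g0 where g0: "H0_graph \<kappa> m f g0" "AE x in half_line. g x = g0 x + v x *\<^sub>R f x"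
    using assms(1) unfolding H_graph_def by blast
  then obtain f' where f': "has_ac_derivative f f'"
    and eq: "AE x in half_line. fst (g0 x) = of_real m * fst (f x) - snd (f' x) + of_real (real \<kappa> / x) * snd (f x) \<and>
           snd (g0 x) = fst (f' x) + of_real (real \<kappa> / x) * fst (f x) - of_real m * snd (f x)"
    unfolding H0_graph_def by blast
  show "f \<in> L2" using g0 unfolding H0_graph_def by blast
  have ae: "AE x in half_line. fst (f' x) = - (of_real (real \<kappa> / x) * fst (f x)) + (z + of_real m - of_real (v x)) * snd (f x) + snd (h x)
      \<and> snd (f' x) = of_real (real \<kappa> / x) * snd (f x) + (of_real m - z + of_real (v x)) * fst (f x) - fst (h x)"
    using assms(2) g0(2) eq
  proof eventually_elim
    case (elim x)
    have h: "fst (h x) = fst (g x) - z * fst (f x)" "snd (h x) = snd (g x) - z * snd (f x)"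
      using elim(1) by (metis fst_conv, metis snd_conv)
    show ?case unfolding h elim(2) using elim(3)
      by (auto simp: scaleR_conv_of_real algebra_simps)
  qed
  show "sol {0<..} z (\<lambda>x. fst (h x)) (\<lambda>x. snd (h x)) (\<lambda>x. fst (f x)) (\<lambda>x. snd (f x))"
    unfolding sol_def
    using f' ae unfolding has_ac_derivative_iff_components AE_half_line_iff
    by (intro conjI; rule_tac ac_on_cong_AE[OF _ ray_intervals(1)]) (auto elim: AE_mp)
qed

text \<open>Lagrange's identity for the resolvent element \<open>f\<close> and an admissible solution \<open>e\<close> with the
  conjugate source: the boundary terms vanish because \<open>f\<close> is square integrable.\<close>

lemma resolvent_pairing:
  assumes H: "H_graph \<kappa> m v f g" "AE x in half_line. (fst (g x) - z * fst (f x), snd (g x) - z * snd (f x)) = h x"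
    and d: "0 < d" "\<And>x. 0 < x \<Longrightarrow> x \<le> d \<Longrightarrow> h x = 0" and X: "\<And>x. x \<ge> X \<Longrightarrow> h x = 0" "d < X" "X \<ge> \<gamma>"
    and hc: "continuous_on UNIV (cutoff (\<lambda>x. fst (h x)))" "continuous_on UNIV (cutoff (\<lambda>x. snd (h x)))"
    and e: "sol {0<..} z (\<lambda>x. cnj (cutoff (\<lambda>x. fst (h x)) x)) (\<lambda>x. cnj (cutoff (\<lambda>x. snd (h x)) x)) e1 e2" "admissible X z s e1 e2" "Re s > 0"
  shows "L2_inner f h = integral {0..X} (\<lambda>x. cutoff (\<lambda>x. fst (h x)) x * e1 x + cutoff (\<lambda>x. snd (h x)) x * e2 x)"
proof -
  note f = sol_of_resolvent_relation[OF H]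
  define h1 where "h1 = cutoff (\<lambda>x. fst (h x))"
  define h2 where "h2 = cutoff (\<lambda>x. snd (h x))"
  define f1 where "f1 = (\<lambda>x. fst (f x))"
  define f2 where "f2 = (\<lambda>x. snd (f x))"
  have hx: "fst (h x) = h1 x" "snd (h x) = h2 x" if "x > 0" for x using that by (auto simp: h1_def h2_def cutoff_def)
  have h0: "h1 x = 0" "h2 x = 0" if "x \<le> d \<or> x \<ge> X" for x
    using that d X by (auto simp: h1_def h2_def cutoff_def)
  have fs: "sol {0<..} z h1 h2 f1 f2"
    unfolding sol_def f1_def f2_def
    by (intro conjI ac_on_cong[OF conjunct1[OF f(1)[unfolded sol_def]] ray_intervals(1)]
        ac_on_cong[OF conjunct2[OF f(1)[unfolded sol_def]] ray_intervals(1)]) (auto simp: hx)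
  have es: "sol {0<..} z (\<lambda>x. cnj (h1 x)) (\<lambda>x. cnj (h2 x)) e1 e2" using e(1) by (simp add: h1_def h2_def)
  define W where "W = (\<lambda>x. f1 x * e2 x - f2 x * e1 x)"
  define p where "p = (\<lambda>x. h1 x * e1 x + h2 x * e2 x)"
  define q where "q = (\<lambda>x. f1 x * cnj (h1 x) + f2 x * cnj (h2 x))"
  have W: "ac_on {0<..} W (\<lambda>x. p x - q x)"
    using sol_wronskian[OF fs es ray_intervals(1)] by (simp add: W_def p_def q_def)
  have pq0: "p x = 0" "q x = 0" if "x \<le> d \<or> x \<ge> X" for x using h0[OF that] by (auto simp: p_def q_def)
  have nf: "norm (f1 x) \<le> norm (f x)" "norm (f2 x) \<le> norm (f x)" for x
    using norm_fst_le[of "fst (f x)" "snd (f x)"] norm_snd_le[of "snd (f x)" "fst (f x)"] by (auto simp: f1_def f2_def)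
  obtain C where C: "\<forall>x\<in>{0..1}. norm (e1 x) \<le> C * x \<and> norm (e2 x) \<le> C * x"
    using e(2) unfolding admissible_def by blast
  have C0: "C \<ge> 0" using C[rule_format, of 1] order_trans[OF norm_ge_zero, of "e1 1" C] by auto
  \<comment> \<open>The sources vanish on \<open>(0, d]\<close>, so \<open>W\<close> is constant
    there. Near 0 its norm is at most \<open>2 * C * x * norm (f x)\<close>, which excludes a
    nonzero constant.\<close>
  have Wd: "W d = 0"
  proof -
    have "norm (W d) \<le> 0"
    proof (rule L2_no_pole_at_0[OF f(2), of "min d 1"])
      fix x assume x: "0 < x" "x \<le> min d 1"
      have iv': "is_interval {0<..d}" by (simp add: is_interval_oc)
      have "W x = W d"
        by (rule ac_on_zero_deriv[OF ac_on_subset[OF W] _ iv']) (use x pq0 d in auto)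
      moreover have "norm (W x) \<le> norm (f1 x) * norm (e2 x) + norm (f2 x) * norm (e1 x)"
        unfolding W_def by (metis norm_mult norm_triangle_ineq4)
      moreover have "norm (f1 x) * norm (e2 x) \<le> norm (f x) * (C * x)" "norm (f2 x) * norm (e1 x) \<le> norm (f x) * (C * x)"
        using nf C x C0 by (auto intro!: mult_mono)
      ultimately show "norm (W d) \<le> (2 * C) * x * norm (f x)" by (simp add: algebra_simps)
    qed (use d in auto)
    thus ?thesis by simp
  qed
  obtain M where M: "M \<ge> 0" "\<And>x. x > 0 \<Longrightarrow> norm (e1 x) \<le> M * exp (- Re s * x) \<and> norm (e2 x) \<le> M * exp (- Re s * x)"
    using admissible_decay[OF e(2,3)] by blast
  \<comment> \<open>Beyond \<open>X\<close> the Wronskian is again constant and at most a multiple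
    of \<open>norm (f x)\<close>, so it vanishes by square integrability.\<close>
  have WX: "W X = 0"
  proof -
    have "norm (W X) \<le> 0"
    proof (rule L2_no_lower_bound_at_infinity[OF f(2), of X])
      fix x assume x: "x \<ge> X"
      hence x0: "x > 0" using X d by auto
      have "W x = W X"
        by (rule ac_on_zero_deriv[OF ac_on_subset[OF W] _ ray_intervals(2)[of X]]) (use x pq0 X d in auto)
      moreover have "norm (W x) \<le> norm (f1 x) * norm (e2 x) + norm (f2 x) * norm (e1 x)"
        unfolding W_def by (metis norm_mult norm_triangle_ineq4)
      moreover have "exp (- Re s * x) \<le> 1" using x0 e(3) by simp
      hence "M * exp (- Re s * x) \<le> M" using M(1) mult_left_le by blast
      hence "norm (e1 x) \<le> M" "norm (e2 x) \<le> M" using M(2)[OF x0] by auto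
      hence "norm (f1 x) * norm (e2 x) \<le> norm (f x) * M" "norm (f2 x) * norm (e1 x) \<le> norm (f x) * M"
        using nf by (auto intro!: mult_mono)
      ultimately show "norm (W X) \<le> (2 * M) * norm (f x)" by (simp add: algebra_simps)
    qed
    thus ?thesis by simp
  qed
  have hc': "continuous_on {d..X} h1" "continuous_on {d..X} h2"
    using hc by (auto simp: h1_def h2_def elim: continuous_on_subset)
  have ec: "continuous_on {0..X} e1" "continuous_on {0..X} e2"
    using e(2) by (auto simp: admissible_def elim: continuous_on_subset)
  have fc: "continuous_on {d..X} f1" "continuous_on {d..X} f2"
    using fs d X unfolding sol_def by (auto intro!: ac_on_continuous_Icc[OF _ ray_intervals(1)])
  have pc: "continuous_on {0..X} p"
    unfolding p_def using hc by (auto intro!: continuous_intros ec simp: h1_def h2_def elim: continuous_on_subset)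
  have pc': "continuous_on {d..X} p" using pc by (rule continuous_on_subset) (use d in auto)
  have qc: "continuous_on {d..X} q" unfolding q_def by (intro continuous_intros hc' fc)
  have pi: "p integrable_on {d..X}" "q integrable_on {d..X}" by (intro integrable_continuous_real pc' qc)+
  have "0 = integral {d..X} (\<lambda>x. p x - q x)"
    using ac_onD(2)[OF W, of d X] d X Wd WX by auto
  also have "\<dots> = integral {d..X} p - integral {d..X} q"
    by (intro Henstock_Kurzweil_Integration.integral_diff pi)
  finally have eq: "integral {d..X} q = integral {d..X} p" by simp
  have "integral {0..d} p + integral {d..X} p = integral {0..X} p"
    using d X pc by (intro Henstock_Kurzweil_Integration.integral_combine integrable_continuous_real) auto
  moreover have "integral {0..d} p = integral {0..d} (\<lambda>x. 0)" using pq0 by (intro integral_cong) auto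
  ultimately have p: "integral {d..X} p = integral {0..X} p" by simp
  \<comment> \<open>\<open>q\<close> is the integrand of the inner product because the source of
    \<open>e\<close> is the conjugate of \<open>h\<close>; it vanishes outside \<open>{d..X}\<close>
    on the half-line.\<close>
  have "L2_inner f h = (LINT x|half_line. q x)"
    unfolding L2_inner_def by (intro Bochner_Integration.integral_cong) (auto simp: q_def f1_def f2_def hx)
  also have "\<dots> = (LINT x|lebesgue. indicator {0<..} x *\<^sub>R q x)"
    by (subst integral_restrict_space) auto
  also have "(\<lambda>x. indicator {0<..} x *\<^sub>R q x) = (\<lambda>x. indicator {d..X} x *\<^sub>R q x)"
    using d pq0 by (auto simp: indicator_def fun_eq_iff)
  also have "(LINT x|lebesgue. indicator {d..X} x *\<^sub>R q x) = integral {d..X} q"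
    using set_lebesgue_integral_eq_integral(2)[OF absolutely_integrable_continuous_real[OF qc]]
    by (simp add: set_lebesgue_integral_def)
  finally show ?thesis using eq p by (simp add: p_def h1_def h2_def)
qed

text \<open>Adding a multiple of \<open>phi\<close> changes neither the source nor the type of
  behaviour at 0. The multiple makes the Wronskian with psi(s) vanish at \<open>X\<close>, which
  removes the component along psi(- s); it exists because the Jost function is nonzero here.\<close>

lemma corrected_admissible:
  assumes \<eta>: "sol {0<..} z h1 h2 \<eta>1 \<eta>2" "continuous_on {0..} \<eta>1" "continuous_on {0..} \<eta>2"
      "\<exists>C. \<forall>x\<in>{0..1}. norm (\<eta>1 x) \<le> C * x \<and> norm (\<eta>2 x) \<le> C * x"
    and h: "\<And>x. x \<ge> X \<Longrightarrow> h1 x = 0 \<and> h2 x = 0" and X: "X \<ge> \<gamma>"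
    and s: "s\<^sup>2 = (of_real m)\<^sup>2 - z\<^sup>2" and z: "Im z > 0" and Re: "Re s > 0"
  defines "c \<equiv> - (\<eta>1 X * psi2 z s X - \<eta>2 X * psi1 s X) / jost_fn z s"
  shows "sol {0<..} z h1 h2 (\<lambda>x. \<eta>1 x + c * phi1 x z) (\<lambda>x. \<eta>2 x + c * phi2 x z)"
    and "admissible X z s (\<lambda>x. \<eta>1 x + c * phi1 x z) (\<lambda>x. \<eta>2 x + c * phi2 x z)"
proof -
  have J: "jost_fn z s \<noteq> 0" by (rule jost_fn_nz_upper[OF s z Re])
  have nz: "s \<noteq> 0" "z \<noteq> of_real m" using z Re by auto
  show sol: "sol {0<..} z h1 h2 (\<lambda>x. \<eta>1 x + c * phi1 x z) (\<lambda>x. \<eta>2 x + c * phi2 x z)"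
    using sol_add_cmult[OF \<eta>(1) phi_sol[of z] ray_intervals(1), of c] by simp
  have sub: "{X..} \<subseteq> {0<..}" using X gamma_pos by auto
  have solX: "sol {X..} z (\<lambda>_. 0) (\<lambda>_. 0) (\<lambda>x. \<eta>1 x + c * phi1 x z) (\<lambda>x. \<eta>2 x + c * phi2 x z)"
    unfolding sol_def
    by (intro conjI ac_on_cong[OF conjunct1[OF sol_subset[OF sol sub, unfolded sol_def]] ray_intervals(2)]
        ac_on_cong[OF conjunct2[OF sol_subset[OF sol sub, unfolded sol_def]] ray_intervals(2)]) (auto simp: h)
  have W: "(\<eta>1 X + c * phi1 X z) * psi2 z s X - (\<eta>2 X + c * phi2 X z) * psi1 s X = 0"
  proof -
    have "(\<eta>1 X + c * phi1 X z) * psi2 z s X - (\<eta>2 X + c * phi2 X z) * psi1 s X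
       = (\<eta>1 X * psi2 z s X - \<eta>2 X * psi1 s X) + c * (phi1 X z * psi2 z s X - phi2 X z * psi1 s X)"
      by (simp add: algebra_simps)
    also have "\<dots> = 0" unfolding jost_fn_eq[OF s X] using J by (simp add: c_def)
    finally show ?thesis .
  qed
  obtain d where d: "\<And>x. x \<ge> X \<Longrightarrow> \<eta>1 x + c * phi1 x z = d * psi1 s x \<and> \<eta>2 x + c * phi2 x z = d * psi2 z s x"
    using parallel_psi[OF s nz solX X W] by blast
  obtain C where C: "\<forall>x\<in>{0..1}. norm (\<eta>1 x) \<le> C * x \<and> norm (\<eta>2 x) \<le> C * x" using \<eta>(4) by blast
  obtain D where D: "\<forall>x\<in>{0..1}. norm (phi1 x z) \<le> D * x \<and> norm (phi2 x z) \<le> D * x" using phi_bound by blast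
  have "norm (\<eta>1 x + c * phi1 x z) \<le> (C + norm c * D) * x \<and> norm (\<eta>2 x + c * phi2 x z) \<le> (C + norm c * D) * x"
    if "x \<in> {0..1}" for x
  proof -
    have "norm c * norm (phi1 x z) \<le> norm c * (D * x)" "norm c * norm (phi2 x z) \<le> norm c * (D * x)"
      using D that by (auto intro!: mult_left_mono)
    moreover have "norm (\<eta>1 x) \<le> C * x" "norm (\<eta>2 x) \<le> C * x" using C that by auto
    ultimately show ?thesis
      using norm_triangle_ineq[of "\<eta>1 x" "c * phi1 x z"] norm_triangle_ineq[of "\<eta>2 x" "c * phi2 x z"]
      unfolding norm_mult by (simp add: algebra_simps)
  qed
  thus "admissible X z s (\<lambda>x. \<eta>1 x + c * phi1 x z) (\<lambda>x. \<eta>2 x + c * phi2 x z)"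
    unfolding admissible_def using d
    by (intro conjI continuous_intros \<eta>(2,3) phi_continuous) blast+
qed

text \<open>Two auxiliary solutions play different roles. \<open>\<theta>\<close>, with source
  \<open>h\<close>, shows that the resolvent relation is solvable, so that the choice in
  \<open>resolvent\<close> satisfies it. \<open>\<eta>\<close>, with source \<open>cnj h\<close>,
  evaluates the inner product by \<open>resolvent_pairing\<close>. Then \<open>A\<close> is the
  pairing of \<open>h\<close> with \<open>\<eta>\<close>, and \<open>E1\<close>, \<open>E2\<close>
  are the components of \<open>\<eta>\<close> at \<open>X\<close>; Lagrange's identity from 0 turns
  their Wronskian with \<open>phi\<close> into the pairing with \<open>cnj h\<close>.\<close>

lemma Phi_formula:
  assumes h: "h \<in> test_functions"
  defines "h1 \<equiv> cutoff (\<lambda>x. fst (h x))" and "h2 \<equiv> cutoff (\<lambda>x. snd (h x))"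
  shows "\<exists>X A E1 E2. X \<ge> \<gamma> \<and> A holomorphic_on UNIV \<and> E1 holomorphic_on UNIV \<and> E2 holomorphic_on UNIV \<and>
    (\<lambda>z. integral {0..X} (\<lambda>x. h1 x * phi1 x z + h2 x * phi2 x z)) holomorphic_on UNIV \<and>
    continuous_on {0..X} h1 \<and> continuous_on {0..X} h2 \<and>
    (\<forall>z. E1 z * phi2 X z - E2 z * phi1 X z = integral {0..X} (\<lambda>x. cnj (h1 x) * phi1 x z + cnj (h2 x) * phi2 x z)) \<and>
    (\<forall>z s. Im z > 0 \<longrightarrow> s\<^sup>2 = (of_real m)\<^sup>2 - z\<^sup>2 \<longrightarrow> Re s > 0 \<longrightarrow>
       Phi \<kappa> m v h z = A z - (E1 z * psi2 z s X - E2 z * psi1 s X) *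
          integral {0..X} (\<lambda>x. h1 x * phi1 x z + h2 x * phi2 x z) / jost_fn z s)"
proof -
  obtain d X where d: "0 < d" "\<And>x. 0 < x \<Longrightarrow> x \<le> d \<Longrightarrow> h x = 0" and X: "\<And>x. x \<ge> X \<Longrightarrow> h x = 0" "X \<ge> \<gamma>" "d < X"
    and hc: "continuous_on UNIV h1" "continuous_on UNIV h2"
    using test_function_support[OF h, of \<gamma>] unfolding h1_def h2_def by metis
  have h0: "h1 x = 0" "h2 x = 0" if "x \<le> d \<or> x \<ge> X" for x
    using that d X by (auto simp: h1_def h2_def cutoff_def)
  have hd: "h1 x = 0 \<and> h2 x = 0" if "x < d" for x using h0 that by auto
  have kd: "cnj (h1 x) = 0 \<and> cnj (h2 x) = 0" if "x < d" for x using h0 that by auto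
  have kc: "continuous_on UNIV (\<lambda>x. cnj (h1 x))" "continuous_on UNIV (\<lambda>x. cnj (h2 x))" by (intro continuous_intros hc)+
  \<comment> \<open>The leading coefficient at 0 is set to 0; the multiple of \<open>phi\<close>
    added by \<open>corrected_admissible\<close> accounts for the remaining freedom.\<close>
  obtain \<theta>1 \<theta>2 where \<theta>: "entire_param \<theta>1" "entire_param \<theta>2" "\<And>z. sol {0<..} z h1 h2 (\<lambda>x. \<theta>1 x z) (\<lambda>x. \<theta>2 x z)"
    "\<And>z. \<exists>C. \<forall>x\<in>{0..1}. norm (\<theta>1 x z) \<le> C * x \<and> norm (\<theta>2 x z) \<le> C * x"
    using regular_solution_entire[OF hc d(1) hd, of 0] by blast
  obtain \<eta>1 \<eta>2 where \<eta>: "entire_param \<eta>1" "entire_param \<eta>2" "\<And>z. sol {0<..} z (\<lambda>x. cnj (h1 x)) (\<lambda>x. cnj (h2 x)) (\<lambda>x. \<eta>1 x z) (\<lambda>x. \<eta>2 x z)"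
    "\<And>z. \<exists>C. \<forall>x\<in>{0..1}. norm (\<eta>1 x z) \<le> C * x \<and> norm (\<eta>2 x z) \<le> C * x"
    using regular_solution_entire[OF kc d(1) kd, of 0] by blast
  have X0: "X \<ge> 0" using X gamma_pos by auto
  have hcX: "continuous_on {0..X} h1" "continuous_on {0..X} h2" using hc by (auto elim: continuous_on_subset)
  have ci: "(\<lambda>x. F x z) integrable_on {0..X}" "(\<lambda>x. k x * F x z) integrable_on {0..X}"
    if "entire_param F" "continuous_on {0..X} k" for F k z
  proof -
    have "continuous_on {0..X} (\<lambda>x. F x z)"
      by (rule continuous_on_subset[OF entire_param_continuous_fst[OF that(1)]]) auto
    thus "(\<lambda>x. F x z) integrable_on {0..X}" "(\<lambda>x. k x * F x z) integrable_on {0..X}"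
      using that(2) by (auto intro!: integrable_continuous_real continuous_intros)
  qed
  have hol: "(\<lambda>z. integral {0..X} (\<lambda>x. h1 x * F x z + h2 x * G x z)) holomorphic_on UNIV"
    if "entire_param F" "entire_param G" for F G
  proof -
    have "integral {0..X} (\<lambda>x. h1 x * F x z + h2 x * G x z) = integral {0..X} (\<lambda>x. h1 x * F x z) + integral {0..X} (\<lambda>x. h2 x * G x z)" for z
      by (intro Henstock_Kurzweil_Integration.integral_add ci that hcX)
    thus ?thesis by (auto intro!: holomorphic_intros entire_param_integral_holomorphic that hcX)
  qed
  define A where "A = (\<lambda>z. integral {0..X} (\<lambda>x. h1 x * \<eta>1 x z + h2 x * \<eta>2 x z))"
  define B where "B = (\<lambda>z. integral {0..X} (\<lambda>x. h1 x * phi1 x z + h2 x * phi2 x z))"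
  have \<eta>c: "continuous_on {0..} (\<lambda>x. \<eta>1 x z)" "continuous_on {0..} (\<lambda>x. \<eta>2 x z)" for z
    using \<eta> by (auto intro: entire_param_continuous_fst)
  have \<theta>c: "continuous_on {0..} (\<lambda>x. \<theta>1 x z)" "continuous_on {0..} (\<lambda>x. \<theta>2 x z)" for z
    using \<theta> by (auto intro: entire_param_continuous_fst)
  have W: "\<eta>1 X z * phi2 X z - \<eta>2 X z * phi1 X z = integral {0..X} (\<lambda>x. cnj (h1 x) * phi1 x z + cnj (h2 x) * phi2 x z)" for z
  proof -
    obtain C where "\<forall>x\<in>{0..1}. norm (\<eta>1 x z) \<le> C * x \<and> norm (\<eta>2 x z) \<le> C * x" using \<eta>(4) by blast
    from bspec[OF this, of 0] have 0: "\<eta>1 0 z = 0" "\<eta>2 0 z = 0" by auto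
    have kc': "continuous_on {0..} (\<lambda>x. cnj (h1 x))" "continuous_on {0..} (\<lambda>x. cnj (h2 x))"
      using kc by (auto elim: continuous_on_subset)
    show ?thesis
      using wronskian_integral[OF \<eta>(3) phi_sol \<eta>c phi_continuous kc' _ _ 0 X0] by (simp add: continuous_intros)
  qed
  have L2h: "(\<lambda>x. (h1 x, h2 x)) \<in> L2"
  proof (rule L2_I)
    have "continuous_on {0<..} (\<lambda>x. (h1 x, h2 x))" using hc by (auto intro!: continuous_intros elim: continuous_on_subset)
    thus "(\<lambda>x. (h1 x, h2 x)) \<in> borel_measurable half_line" by (intro continuous_imp_measurable_on_sets_lebesgue) auto
    let ?q = "\<lambda>x. (norm (h1 x, h2 x))\<^sup>2"
    have "continuous_on {d..X} ?q" using hc by (auto intro!: continuous_intros elim: continuous_on_subset)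
    hence "integrable lebesgue (\<lambda>x. indicator {d..X} x *\<^sub>R ?q x)"
      using absolutely_integrable_continuous_real unfolding set_integrable_def by blast
    also have "(\<lambda>x. indicator {d..X} x *\<^sub>R ?q x) = (\<lambda>x. indicator {0<..} x *\<^sub>R ?q x)"
    proof
      fix x show "indicator {d..X} x *\<^sub>R ?q x = indicator {0<..} x *\<^sub>R ?q x"
        using d h0[of x] by (cases "x \<in> {d..X}") (auto simp: indicator_def zero_prod_def[symmetric])
    qed
    finally show "integrable half_line ?q" by (subst integrable_restrict_space) auto
  qed simp
  have "Phi \<kappa> m v h z = A z - (\<eta>1 X z * psi2 z s X - \<eta>2 X z * psi1 s X) * B z / jost_fn z s"
    if z: "Im z > 0" and s: "s\<^sup>2 = (of_real m)\<^sup>2 - z\<^sup>2" and Re: "Re s > 0" for z s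
  proof -
    have hX: "h1 x = 0 \<and> h2 x = 0" "cnj (h1 x) = 0 \<and> cnj (h2 x) = 0" if "x \<ge> X" for x using h0 that by auto
    define b where "b = - (\<theta>1 X z * psi2 z s X - \<theta>2 X z * psi1 s X) / jost_fn z s"
    define c where "c = - (\<eta>1 X z * psi2 z s X - \<eta>2 X z * psi1 s X) / jost_fn z s"
    note f = corrected_admissible[OF \<theta>(3) \<theta>c \<theta>(4) hX(1) X(2) s z Re, folded b_def]
    note e = corrected_admissible[OF \<eta>(3) \<eta>c \<eta>(4) hX(2) X(2) s z Re, folded c_def]
    from resolvent_relation_of_sol[OF f Re L2h] obtain g where
      g: "H_graph \<kappa> m v (\<lambda>x. (\<theta>1 x z + b * phi1 x z, \<theta>2 x z + b * phi2 x z)) g"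
      "AE x in half_line. (fst (g x) - z * (\<theta>1 x z + b * phi1 x z), snd (g x) - z * (\<theta>2 x z + b * phi2 x z)) = (h1 x, h2 x)"
      by blast
    have "AE x in half_line. (fst (g x) - z * (\<theta>1 x z + b * phi1 x z), snd (g x) - z * (\<theta>2 x z + b * phi2 x z)) = h x"
      using g(2) unfolding AE_half_line_iff by eventually_elim (auto simp: h1_def h2_def cutoff_def prod_eq_iff)
    hence "\<exists>f g. H_graph \<kappa> m v f g \<and> (AE x in half_line. (fst (g x) - z * fst (f x), snd (g x) - z * snd (f x)) = h x)"
      using g(1) by (rule_tac exI[of _ "\<lambda>x. (\<theta>1 x z + b * phi1 x z, \<theta>2 x z + b * phi2 x z)"], rule_tac exI[of _ g]) simp
    from someI_ex[OF this] obtain g' where g': "H_graph \<kappa> m v (resolvent \<kappa> m v z h) g'"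
      "AE x in half_line. (fst (g' x) - z * fst (resolvent \<kappa> m v z h x), snd (g' x) - z * snd (resolvent \<kappa> m v z h x)) = h x"
      unfolding resolvent_def by blast
    have "Phi \<kappa> m v h z = integral {0..X} (\<lambda>x. h1 x * (\<eta>1 x z + c * phi1 x z) + h2 x * (\<eta>2 x z + c * phi2 x z))"
      unfolding Phi_def h1_def h2_def
      by (rule resolvent_pairing[OF g' d X(1,3,2) hc[unfolded h1_def h2_def] e(1)[unfolded h1_def h2_def] e(2) Re])
    also have "\<dots> = integral {0..X} (\<lambda>x. (h1 x * \<eta>1 x z + h2 x * \<eta>2 x z) + c * (h1 x * phi1 x z + h2 x * phi2 x z))"
      by (intro integral_cong) (simp add: algebra_simps)
    also have "\<dots> = A z + integral {0..X} (\<lambda>x. c * (h1 x * phi1 x z + h2 x * phi2 x z))"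
      unfolding A_def
      by (intro Henstock_Kurzweil_Integration.integral_add integrable_add integrable_on_mult_right ci \<eta> phi_entire hcX)
    also have "\<dots> = A z + c * B z" by (simp add: B_def)
    finally have P: "Phi \<kappa> m v h z = A z + c * B z" .
    define w where "w = \<eta>1 X z * psi2 z s X - \<eta>2 X z * psi1 s X"
    have "c = - w / jost_fn z s" by (simp add: c_def w_def)
    thus ?thesis unfolding P w_def[symmetric] by simp
  qed
  moreover have "A holomorphic_on UNIV" "B holomorphic_on UNIV"
    unfolding A_def B_def by (intro hol \<eta> phi_entire)+
  moreover have "\<eta>1 X holomorphic_on UNIV" "\<eta>2 X holomorphic_on UNIV"
    by (intro entire_param_holomorphic \<eta> X0)+
  ultimately show ?thesis
    by (intro exI[of _ X] exI[of _ A] exI[of _ "\<eta>1 X"] exI[of _ "\<eta>2 X"]) (use X W hcX in \<open>auto simp: B_def\<close>)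
qed

end

subsection \<open>Zeros, poles and continuation\<close>

lemma IVT_no_zero_same_sign:
  fixes g :: "real \<Rightarrow> real"
  assumes "continuous_on {a..b} g" "\<And>x. x \<in> {a..b} \<Longrightarrow> g x \<noteq> 0" "a \<le> b"
  shows "g a * g b > 0"
proof (rule ccontr)
  assume "\<not> ?thesis"
  moreover have "g a \<noteq> 0" "g b \<noteq> 0" using assms by auto
  ultimately consider "g a < 0" "g b > 0" | "g a > 0" "g b < 0"
    by (metis linorder_neqE_linordered_idom mult_neg_neg mult_pos_pos)
  hence "\<exists>x\<ge>a. x \<le> b \<and> g x = 0"
    using assms(1,3) IVT'[of g a 0 b] IVT2'[of g b 0 a] by cases auto
  thus False using assms(2) by auto
qed

text \<open>The factor \<open>(w - z) ^ n\<close> is analytic and nonzero away from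
  \<open>z\<close>, so removing it leaves all other orders unchanged. This drives the induction over
  the zeros.\<close>

lemma split_zero:
  assumes f: "f holomorphic_on S" and S: "open S" "connected S" and z: "z \<in> S" "f z = 0" and nz: "w0 \<in> S" "f w0 \<noteq> 0"
  obtains g n where "g holomorphic_on S" "n = nat (zorder f z)" "g z \<noteq> 0" "\<And>w. w \<in> S \<Longrightarrow> f w = (w - z) ^ n * g w"
    "\<And>w. w \<in> S \<Longrightarrow> w \<noteq> z \<Longrightarrow> zorder f w = zorder g w"
proof -
  define n where "n = nat (zorder f z)"
  obtain r h where r: "r > 0" "cball z r \<subseteq> S" "h holomorphic_on cball z r"
    "\<And>w. w \<in> cball z r \<Longrightarrow> f w = h w * (w - z) ^ n \<and> h w \<noteq> 0"
    using zorder_exist_zero[OF f S z(1)] nz unfolding n_def by blast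
  define g where "g = (\<lambda>w. if w = z then h z else f w / (w - z) ^ n)"
  have gh: "g w = h w" if "w \<in> ball z r" for w
    using r(4)[of w] that by (auto simp: g_def)
  have "g holomorphic_on ball z r"
    using holomorphic_transform[OF holomorphic_on_subset[OF r(3) ball_subset_cball]] gh by metis
  moreover have "g holomorphic_on (S - {z})"
  proof (rule holomorphic_transform)
    show "(\<lambda>w. f w / (w - z) ^ n) holomorphic_on (S - {z})"
      by (intro holomorphic_intros holomorphic_on_subset[OF f]) auto
  qed (auto simp: g_def)
  ultimately have "g holomorphic_on (ball z r \<union> (S - {z}))"
    using S by (intro holomorphic_on_Un) auto
  moreover have "ball z r \<union> (S - {z}) = S" using r(1,2) z by auto
  ultimately have g: "g holomorphic_on S" by simp
  have gz: "g z \<noteq> 0" using gh[of z] r(1) r(4)[of z] by auto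
  have fg: "f w = (w - z) ^ n * g w" if "w \<in> S" for w
    using r(1) r(4)[of z] that z by (auto simp: g_def)
  have zo: "zorder f w = zorder g w" if w: "w \<in> S" "w \<noteq> z" for w
  proof -
    have inS: "eventually (\<lambda>w. w \<in> S) (at w)" using S w by (intro eventually_at_in_open') auto
    have fnz: "eventually (\<lambda>w. f w \<noteq> 0 \<and> w \<in> S) (at w)"
      by (rule non_zero_neighbour_alt[OF f S w(1) nz])
    have ev: "eventually (\<lambda>w. (w - z) ^ n * g w \<noteq> 0) (at w)"
      using fnz by eventually_elim (use fg in auto)
    have "zorder f w = zorder (\<lambda>w. (w - z) ^ n * g w) w"
      by (rule zorder_cong) (use inS fg in \<open>auto elim: eventually_mono\<close>)
    also have "\<dots> = zorder (\<lambda>w. (w - z) ^ n) w + zorder g w"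
    proof (intro zorder_times_analytic ev)
      show "(\<lambda>w. (w - z) ^ n) analytic_on {w}" by (intro analytic_intros)
      show "g analytic_on {w}" using g S w by (auto simp: analytic_at)
    qed
    also have "zorder (\<lambda>w. (w - z) ^ n) w = 0"
      using w by (intro zorder_eq_0I) (auto intro!: analytic_intros)
    finally show ?thesis by simp
  qed
  show thesis by (rule that[OF g n_def gz fg zo])
qed

text \<open>Splitting off the zeros one by one: each linear factor \<open>w - x\<close> changes sign between \<open>a\<close> and \<open>b\<close>.\<close>

lemma zeros_parity:
  assumes "f holomorphic_on S" and S: "open S" "connected S" "complex_of_real ` {a..b} \<subseteq> S" and ab: "a \<le> b"
    and "\<And>x. x \<in> {a..b} \<Longrightarrow> f (of_real x) \<in> \<real>" and "f (of_real a) \<noteq> 0" "f (of_real b) \<noteq> 0"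
  shows "finite {x\<in>{a<..<b}. f (of_real x) = 0}"
    and "odd (\<Sum>x | x \<in> {a<..<b} \<and> f (of_real x) = 0. nat (zorder f (of_real x))) \<longleftrightarrow> Re (f (of_real a)) * Re (f (of_real b)) < 0"
proof -
  \<comment> \<open>Stated for every \<open>f\<close>, because the induction applies it to the
    quotients as well.\<close>
  have fin: "finite {x\<in>{a<..<b}. f (of_real x) = 0}" if f: "f holomorphic_on S" "f (of_real a) \<noteq> 0" for f
  proof (cases "f constant_on S")
    case True
    then obtain c where c: "\<And>x. x \<in> S \<Longrightarrow> f x = c" unfolding constant_on_def by blast
    have "complex_of_real x \<in> S" if "x \<in> {a..b}" for x using S(3) that by blast
    hence "f (of_real x) = f (of_real a)" if "x \<in> {a..b}" for x
      using c that ab by (metis atLeastAtMost_iff order_refl)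
    hence "f (of_real x) \<noteq> 0" if "x \<in> {a<..<b}" for x
      using f(2) that by (metis atLeastAtMost_iff greaterThanLessThan_iff less_imp_le)
    hence "{x\<in>{a<..<b}. f (of_real x) = 0} = {}" by blast
    thus ?thesis by (metis finite.emptyI)
  next
    case False
    have "compact (complex_of_real ` {a..b})" by (intro compact_continuous_image continuous_intros) auto
    from holomorphic_compact_finite_zeros[OF f(1) S(1,2) this S(3) False]
    have "finite {z \<in> complex_of_real ` {a..b}. f z = 0}" .
    hence "finite (Re ` {z \<in> complex_of_real ` {a..b}. f z = 0})" by (rule finite_imageI)
    thus ?thesis by (rule finite_subset[rotated]) force
  qed
  show "finite {x\<in>{a<..<b}. f (of_real x) = 0}" using fin assms by blast
  have "odd (\<Sum>x | x \<in> {a<..<b} \<and> f (of_real x) = 0. nat (zorder f (of_real x))) \<longleftrightarrow> Re (f (of_real a)) * Re (f (of_real b)) < 0"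
    if "card {x\<in>{a<..<b}. f (of_real x) = 0} = k" for k
    using that assms(1,6-8)
  proof (induction k arbitrary: f)
    case 0
    have Z: "{x\<in>{a<..<b}. f (of_real x) = 0} = {}" using 0(1) fin[OF 0(2,4)] by simp
    have "Re (f (of_real a)) * Re (f (of_real b)) > 0"
    proof (rule IVT_no_zero_same_sign[of a b "\<lambda>x. Re (f (of_real x))"])
      have "continuous_on S f" by (rule holomorphic_on_imp_continuous_on) fact
      hence "continuous_on {a..b} (\<lambda>x. f (of_real x))"
        by (rule continuous_on_compose2[OF _ _ S(3)]) (intro continuous_intros)
      thus "continuous_on {a..b} (\<lambda>x. Re (f (of_real x)))" by (rule continuous_on_Re)
      fix x assume x: "x \<in> {a..b}"
      have "f (of_real x) \<noteq> 0"
      proof (cases "x = a \<or> x = b")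
        case False
        hence "x \<in> {a<..<b}" using x by auto
        thus ?thesis using Z by blast
      qed (use 0(4,5) in blast)
      thus "Re (f (of_real x)) \<noteq> 0" using 0(3)[OF x] by (auto simp: complex_is_Real_iff complex_eq_iff)
    qed (rule ab)
    moreover have "(\<Sum>x | x \<in> {a<..<b} \<and> f (of_real x) = 0. nat (zorder f (of_real x))) = 0"
      unfolding Z by simp
    ultimately show ?case by simp
  next
    case (Suc k)
    let ?Z = "\<lambda>f. {x \<in> {a<..<b}. f (complex_of_real x) = 0}"
    have "?Z f \<noteq> {}" using Suc.prems(1) by (metis card.empty nat.distinct(1))
    then obtain x0 where x0: "x0 \<in> {a<..<b}" "f (of_real x0) = 0" by blast
    have aS: "complex_of_real x \<in> S" if "x \<in> {a..b}" for x using S(3) that by blast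
    obtain g n where g: "g holomorphic_on S" "n = nat (zorder f (of_real x0))" "g (of_real x0) \<noteq> 0"
      "\<And>w. w \<in> S \<Longrightarrow> f w = (w - of_real x0) ^ n * g w"
      "\<And>w. w \<in> S \<Longrightarrow> w \<noteq> of_real x0 \<Longrightarrow> zorder f w = zorder g w"
      using split_zero[OF Suc.prems(2) S(1,2) aS x0(2) aS Suc.prems(4)] x0 ab by (metis atLeastAtMost_iff greaterThanLessThan_iff less_imp_le order_refl)
    have n: "n > 0"
    proof (rule ccontr)
      assume "\<not> n > 0"
      hence "f (of_real x0) = g (of_real x0)" using g(4)[OF aS[of x0]] x0 by auto
      thus False using x0 g(3) by simp
    qed
    have fg: "f (of_real x) = of_real ((x - x0) ^ n) * g (of_real x)" if "x \<in> {a..b}" for x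
      using g(4)[OF aS[OF that]] by simp
    have Z: "?Z f = insert x0 (?Z g)" "x0 \<notin> ?Z g"
      using x0 g(3) fg n by (auto simp: less_imp_le)
    have fing: "finite (?Z g)" using fin[OF Suc.prems(2,4)] Z(1) by auto
    have "card (?Z g) = k" using Suc.prems(1) Z fing by simp
    have ga: "g (of_real a) \<noteq> 0" "g (of_real b) \<noteq> 0" using fg[of a] fg[of b] Suc.prems ab by auto
    have greal': "g (of_real x) \<in> \<real>" if x: "x \<in> {a..b}" "x \<noteq> x0" for x
    proof -
      have "g (of_real x) = f (of_real x) / of_real ((x - x0) ^ n)" using fg[OF x(1)] x(2) by simp
      thus ?thesis using Suc.prems(3)[OF x(1)] by (metis Reals_divide Reals_of_real)
    qed
    \<comment> \<open>At the removed zero the quotient is real as a limit of real values.\<close>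
    have greal: "g (of_real x) \<in> \<real>" if x: "x \<in> {a..b}" for x
    proof (cases "x = x0")
      case False thus ?thesis using greal' x by blast
    next
      case True
      have "complex_of_real x0 \<in> S" using x0 by (intro aS) auto
      hence "continuous (at (of_real x0)) g"
        using holomorphic_on_imp_continuous_on[OF g(1)] continuous_on_eq_continuous_at[OF S(1)] by blast
      hence "isCont (\<lambda>x. g (of_real x)) x0"
        by (rule isCont_o2[where f = complex_of_real and g = g, rotated]) simp
      hence lim: "((\<lambda>x. g (of_real x)) \<longlongrightarrow> g (of_real x0)) (at x0)" by (simp add: isCont_def)
      have "eventually (\<lambda>x. x \<in> {a<..<b} - {x0}) (at x0)"
        using x0 by (intro eventually_at_in_open) auto
      hence "eventually (\<lambda>x. g (of_real x) \<in> \<real>) (at x0)"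
        by eventually_elim (use greal' in auto)
      from Lim_in_closed_set[OF closed_complex_Reals this _ lim] show ?thesis using True by simp
    qed
    note IH = Suc.IH[OF \<open>card (?Z g) = k\<close> g(1) greal ga]
    have "(\<Sum>x\<in>?Z f. nat (zorder f (of_real x))) = n + (\<Sum>x\<in>?Z g. nat (zorder f (of_real x)))"
      unfolding Z(1) using fing Z(2) g(2) by simp
    also have "(\<Sum>x\<in>?Z g. nat (zorder f (of_real x))) = (\<Sum>x\<in>?Z g. nat (zorder g (of_real x)))"
    proof (rule sum.cong)
      fix x assume x: "x \<in> ?Z g"
      hence "x \<noteq> x0" using Z(2) by auto
      moreover have "complex_of_real x \<in> S" using x by (intro aS) auto
      ultimately show "nat (zorder f (of_real x)) = nat (zorder g (of_real x))" using g(5) by simp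
    qed simp
    finally have sum: "(\<Sum>x\<in>?Z f. nat (zorder f (of_real x))) = n + (\<Sum>x\<in>?Z g. nat (zorder g (of_real x)))" .
    have Rf: "Re (f (of_real a)) = (a - x0) ^ n * Re (g (of_real a))" "Re (f (of_real b)) = (b - x0) ^ n * Re (g (of_real b))"
      using fg[of a] fg[of b] ab by auto
    have pos: "(x0 - a) ^ n * (b - x0) ^ n > 0" using x0 by simp
    have "(a - x0) ^ n = (- 1) ^ n * (x0 - a) ^ n"
      by (metis minus_diff_eq power_minus)
    hence prod: "Re (f (of_real a)) * Re (f (of_real b)) = (x0 - a) ^ n * (b - x0) ^ n * ((- 1) ^ n * (Re (g (of_real a)) * Re (g (of_real b))))"
      unfolding Rf by (simp add: algebra_simps)
    have "Re (g (of_real a)) \<noteq> 0" "Re (g (of_real b)) \<noteq> 0"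
      using ga greal[of a] greal[of b] ab by (auto simp: complex_is_Real_iff complex_eq_iff)
    hence nz: "Re (g (of_real a)) * Re (g (of_real b)) \<noteq> 0" by simp
    have "Re (f (of_real a)) * Re (f (of_real b)) < 0 \<longleftrightarrow> (- 1) ^ n * (Re (g (of_real a)) * Re (g (of_real b))) < 0"
    proof -
      have "p * q < 0 \<longleftrightarrow> q < 0" if "p > 0" for p q :: real
        using that by (simp add: mult_less_0_iff)
      from this[OF pos] show ?thesis unfolding prod .
    qed
    also have "\<dots> \<longleftrightarrow> (odd n \<longleftrightarrow> \<not> Re (g (of_real a)) * Re (g (of_real b)) < 0)"
    proof -
      have "(- 1) ^ n * r < 0 \<longleftrightarrow> (odd n \<longleftrightarrow> \<not> r < 0)" if "r \<noteq> 0" for r :: real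
        using that by (cases "even n") auto
      from this[OF nz] show ?thesis .
    qed
    also have "\<dots> \<longleftrightarrow> odd (n + (\<Sum>x\<in>?Z g. nat (zorder g (of_real x))))"
      using IH by auto
    finally show ?case using sum by simp
  qed
  thus "odd (\<Sum>x | x \<in> {a<..<b} \<and> f (of_real x) = 0. nat (zorder f (of_real x))) \<longleftrightarrow> Re (f (of_real a)) * Re (f (of_real b)) < 0" by blast
qed

text \<open>Near \<open>z\<close> the function is \<open>(A * J - C) / J\<close>. The numerator is
  analytic and so has order at least 0, which bounds the order of the pole by that of the zero of
  \<open>J\<close>.\<close>

lemma quotient_pole_order:
  assumes an: "A analytic_on {z}" "C analytic_on {z}" "J analytic_on {z}" and J: "\<forall>\<^sub>F w in at z. J w \<noteq> 0"
    and p: "pole_of_order_at (\<lambda>w. A w - C w / J w) z n"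
  shows "J z = 0" "n \<le> nat (zorder J z)"
proof -
  let ?Q = "\<lambda>w. A w - C w / J w"
  have pole: "is_pole ?Q z" "int n = - zorder ?Q z" using p by (auto simp: pole_of_order_at_def)
  show "J z = 0"
  proof (rule ccontr)
    assume "J z \<noteq> 0"
    hence "?Q analytic_on {z}" using an by (intro analytic_intros) auto
    thus False using pole(1) analytic_at_imp_no_pole by blast
  qed
  define f where "f = (\<lambda>w. A w * J w - C w)"
  have f: "f analytic_on {z}" unfolding f_def by (intro analytic_intros an)
  have Qf: "\<forall>\<^sub>F w in at z. ?Q w = f w / J w"
    using J by eventually_elim (auto simp: f_def field_simps)
  have fnz: "\<exists>\<^sub>F w in at z. f w \<noteq> 0"
  proof (rule ccontr)
    assume "\<not> ?thesis"
    hence "\<forall>\<^sub>F w in at z. f w = 0" by (simp add: frequently_def)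
    hence "\<forall>\<^sub>F w in at z. ?Q w = 0" using Qf by eventually_elim auto
    hence "is_pole ?Q z \<longleftrightarrow> is_pole (\<lambda>_. 0 :: complex) z" by (intro is_pole_cong) auto
    thus False using pole(1) by simp
  qed
  have "zorder ?Q z = zorder (\<lambda>w. f w / J w) z" by (rule zorder_cong[OF Qf refl])
  also have "\<dots> = zorder f z - zorder J z"
    using J by (intro zorder_divide analytic_on_imp_meromorphic_on f an fnz) (simp add: eventually_frequently)
  finally have "int n = zorder J z - zorder f z" using pole(2) by simp
  moreover have "zorder f z \<ge> 0" by (rule zorder_ge_0[OF f fnz])
  ultimately show "n \<le> nat (zorder J z)" by linarith
qed

text \<open>The numerator \<open>A * J - C\<close> takes the nonzero value \<open>- C z\<close> at
  \<open>z\<close>, so nothing of the zero of \<open>J\<close> is cancelled.\<close>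

lemma quotient_pole_order_attained:
  assumes an: "A analytic_on {z}" "C analytic_on {z}" "J analytic_on {z}" and J: "\<forall>\<^sub>F w in at z. J w \<noteq> 0"
    and z: "J z = 0" "C z \<noteq> 0"
  shows "pole_of_order_at (\<lambda>w. A w - C w / J w) z (nat (zorder J z))" "zorder J z > 0"
proof -
  let ?Q = "\<lambda>w. A w - C w / J w"
  define f where "f = (\<lambda>w. A w * J w - C w)"
  have f: "f analytic_on {z}" unfolding f_def by (intro analytic_intros an)
  have fz: "f z \<noteq> 0" using z by (simp add: f_def)
  have Qf: "\<forall>\<^sub>F w in at z. ?Q w = f w / J w"
    using J by eventually_elim (auto simp: f_def field_simps)
  have fnz: "\<forall>\<^sub>F w in at z. f w \<noteq> 0"
    using analytic_at_imp_isCont[OF f] fz by (auto intro: tendsto_imp_eventually_ne simp: isCont_def)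
  have Jf: "\<exists>\<^sub>F w in at z. J w \<noteq> 0" using J by (intro eventually_frequently) auto
  show pos: "zorder J z > 0" using zorder_pos_iff'[OF an(3) Jf] z by simp
  have "zorder ?Q z = zorder (\<lambda>w. f w / J w) z" by (rule zorder_cong[OF Qf refl])
  also have "\<dots> = zorder f z - zorder J z"
    using fnz by (intro zorder_divide analytic_on_imp_meromorphic_on f an Jf) (simp add: eventually_frequently)
  also have "zorder f z = 0" by (rule zorder_eq_0I[OF f fz])
  finally have zo: "zorder ?Q z = - zorder J z" by simp
  have mer: "?Q meromorphic_on {z}"
    using an by (intro meromorphic_intros analytic_on_imp_meromorphic_on)
  have "\<forall>\<^sub>F w in at z. ?Q w \<noteq> 0" using Qf fnz J by eventually_elim auto
  hence "is_pole ?Q z" using zo pos by (intro zorder_neg_imp_is_pole mer) auto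
  thus "pole_of_order_at ?Q z (nat (zorder J z))"
    using mer zo pos by (simp add: pole_of_order_at_def)
qed

section \<open>Uniqueness of the continuation and of one-sided extensions\<close>

lemma connected_cut_plane: "connected (- complex_of_real ` {-m..m})"
proof (rule connected_complement_bounded_convex)
  show "bounded (complex_of_real ` {-m..m})"
    by (intro compact_imp_bounded compact_continuous_image continuous_intros) auto
  show "convex (complex_of_real ` {-m..m})"
    by (intro convex_linear_image) (auto simp: linear_of_real)
qed simp

lemma open_cut_plane: "open (- complex_of_real ` {-m..m})"
  by (intro open_Compl compact_imp_closed compact_continuous_image continuous_intros) auto

lemma upper_half_plane_subset_cut_plane: "{z. Im z > 0} \<subseteq> - complex_of_real ` {-m..m}"
  by auto

text \<open>Meromorphic functions that agree on the upper half-plane agree off a sparse set in the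
  connected cut plane. Where \<open>G\<close> is analytic, \<open>F\<close> then has no pole and,
  being nicely meromorphic, takes its limit as its value.\<close>

lemma continuation_unique:
  assumes F: "continuation m \<Phi> F" and G: "G meromorphic_on (- complex_of_real ` {-m..m})"
    and eq: "\<And>z. Im z > 0 \<Longrightarrow> G z = \<Phi> z"
    and z: "z \<in> - complex_of_real ` {-m..m}" "G analytic_on {z}"
  shows "F z = G z"
proof -
  let ?L = "- complex_of_real ` {-m..m}"
  have Fm: "F meromorphic_on ?L" and Fn: "F nicely_meromorphic_on ?L" and FP: "\<And>z. Im z > 0 \<Longrightarrow> F z = \<Phi> z"
    using F by (auto simp: continuation_def nicely_meromorphic_on_def)
  have "(\<lambda>z. F z - G z) meromorphic_on ?L" using Fm G by (intro meromorphic_intros)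
  from meromorphic_imp_constant_or_avoid[OF this open_cut_plane connected_cut_plane, of 0]
  have "(\<forall>\<^sub>\<approx>z\<in>?L. F z - G z = 0)"
  proof
    assume "\<forall>\<^sub>\<approx>z\<in>?L. F z - G z \<noteq> 0"
    moreover have "\<i> \<in> ?L" by (rule subsetD[OF upper_half_plane_subset_cut_plane]) simp
    ultimately have "\<forall>\<^sub>F z in at \<i>. F z - G z \<noteq> 0"
      unfolding eventually_cosparse_open_eq[OF open_cut_plane] by blast
    moreover have "\<forall>\<^sub>F z in at \<i>. z \<in> {z. Im z > 0}"
      by (rule eventually_at_in_open') (auto simp: open_halfspace_Im_gt)
    ultimately have "\<forall>\<^sub>F z in at \<i>. False"
      by eventually_elim (use FP eq in auto)
    thus ?thesis by simp
  qed
  hence ev: "\<forall>\<^sub>F w in at z. F w = G w"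
    using open_cut_plane z by (auto simp: eventually_cosparse_open_eq)
  have Gc: "G \<midarrow>z\<rightarrow> G z" using analytic_at_imp_isCont[OF z(2)] by (simp add: isCont_def)
  hence Fl: "F \<midarrow>z\<rightarrow> G z" using tendsto_cong[OF ev] by simp
  hence "\<not> is_pole F z" using not_tendsto_and_filterlim_at_infinity[of "at z" F] by (auto simp: is_pole_def)
  hence "F \<midarrow>z\<rightarrow> F z" using Fn z by (auto simp: nicely_meromorphic_on_def)
  thus ?thesis using Fl LIM_unique by blast
qed

text \<open>A function meromorphic at a point of the cut is determined by its values on one side.\<close>

lemma extension_pole_iff:
  assumes D: "D = {z. Im z > 0} \<or> D = {z. Im z < 0}"
    and G: "G meromorphic_on {complex_of_real x}" and eq: "\<forall>\<^sub>F w in at (of_real x) within D. G w = F w"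
  shows "extension_pole F D (of_real x) n \<longleftrightarrow> pole_of_order_at G (of_real x) n"
proof
  assume "pole_of_order_at G (of_real x) n"
  thus "extension_pole F D (of_real x) n" using eq unfolding extension_pole_def by blast
next
  assume "extension_pole F D (of_real x) n"
  then obtain H where H: "pole_of_order_at H (of_real x) n" "\<forall>\<^sub>F w in at (of_real x) within D. H w = F w"
    unfolding extension_pole_def by blast
  have Hm: "H meromorphic_on {of_real x}" using H by (simp add: pole_of_order_at_def)
  have HG: "\<forall>\<^sub>F w in at (of_real x) within D. H w - G w = 0"
    using H(2) eq by eventually_elim auto
  have lim: "complex_of_real x islimpt D"
  proof -
    have "complex_of_real x \<in> closure D - D"
      using D closure_halfspace_gt[of \<i> 0] closure_halfspace_lt[of \<i> 0] by (auto simp: inner_complex_def)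
    thus ?thesis by (auto simp: closure_def)
  qed
  have "\<exists>\<^sub>F w in at (of_real x). H w - G w = 0"
  proof -
    have "at (complex_of_real x) within D \<noteq> bot" using lim trivial_limit_within by blast
    moreover have "\<forall>\<^sub>F w in at (of_real x) within D. False" if "\<not> (\<exists>\<^sub>F w in at (of_real x). H w - G w = 0)"
    proof -
      have "\<forall>\<^sub>F w in at (of_real x). H w - G w \<noteq> 0" using that by (simp add: frequently_def)
      hence "\<forall>\<^sub>F w in at (of_real x) within D. H w - G w \<noteq> 0"
        by (rule filter_leD[OF at_le[OF subset_UNIV]])
      with HG show ?thesis by eventually_elim auto
    qed
    ultimately show ?thesis by (auto simp: eventually_False)
  qed
  moreover have "(\<lambda>w. H w - G w) meromorphic_on {of_real x}" using Hm G by (intro meromorphic_intros)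
  ultimately have "\<forall>\<^sub>F w in at (of_real x). H w - G w = 0"
    using not_essential_frequently_0_imp_eventually_0 meromorphic_at_iff by blast
  hence ev: "\<forall>\<^sub>F w in at (of_real x). G w = H w" by eventually_elim auto
  have "is_pole G (of_real x) \<longleftrightarrow> is_pole H (of_real x)" by (rule is_pole_cong[OF ev refl])
  moreover have "zorder G (of_real x) = zorder H (of_real x)" by (rule zorder_cong[OF ev refl])
  ultimately show "pole_of_order_at G (of_real x) n"
    using H(1) G by (simp add: pole_of_order_at_def)
qed

subsection \<open>The Jost function on the rims\<close>

text \<open>The branch of \<open>sqrt (m\<^sup>2 - z\<^sup>2)\<close> on the cut plane with positive real part on the physical sheet.\<close>

definition outer_root :: "real \<Rightarrow> complex \<Rightarrow> complex" where
  "outer_root m z = - \<i> * z * csqrt (1 - (of_real m / z)\<^sup>2)"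

text \<open>On \<open>ball 0 m\<close> the radicand stays in the right half-plane, so this branch is
  holomorphic across the segment between \<open>- m\<close> and \<open>m\<close>, where
  \<open>outer_root\<close> is cut.\<close>

definition rim_root :: "real \<Rightarrow> complex \<Rightarrow> complex" where
  "rim_root m z = csqrt ((of_real m)\<^sup>2 - z\<^sup>2)"

lemma rim_root_square: "(rim_root m z)\<^sup>2 = (of_real m)\<^sup>2 - z\<^sup>2"
  by (simp add: rim_root_def)

lemma Re_radicand_pos:
  fixes z :: complex
  assumes "z \<in> ball 0 m"
  shows "Re ((of_real m)\<^sup>2 - z\<^sup>2) > 0"
proof -
  have "norm z < m" using assms by simp
  hence "norm (z\<^sup>2) < m\<^sup>2" by (simp add: norm_power power_strict_mono)
  hence "Re (z\<^sup>2) < m\<^sup>2" using complex_Re_le_cmod[of "z\<^sup>2"] by linarith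
  thus ?thesis by simp
qed

lemma rim_root_holomorphic: "rim_root m holomorphic_on ball 0 m"
  unfolding rim_root_def
proof (intro holomorphic_intros)
  fix z :: complex assume "z \<in> ball 0 m"
  thus "(of_real m)\<^sup>2 - z\<^sup>2 \<notin> \<real>\<^sub>\<le>\<^sub>0"
    using Re_radicand_pos[of z m] by (auto simp: complex_nonpos_Reals_iff)
qed

lemma Re_rim_root_pos:
  assumes "z \<in> ball 0 m"
  shows "Re (rim_root m z) > 0"
proof -
  have "Re (csqrt ((of_real m)\<^sup>2 - z\<^sup>2)) \<ge> 0" by (rule Re_csqrt)
  moreover have "Re (csqrt ((of_real m)\<^sup>2 - z\<^sup>2)) \<noteq> 0"
  proof
    assume 0: "Re (csqrt ((of_real m)\<^sup>2 - z\<^sup>2)) = 0"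
    have "Re ((csqrt ((of_real m)\<^sup>2 - z\<^sup>2))\<^sup>2) \<le> 0" using 0 by (simp add: power2_eq_square)
    thus False using Re_radicand_pos[OF assms] by simp
  qed
  ultimately show ?thesis unfolding rim_root_def by linarith
qed

lemma rim_root_of_real:
  assumes "x \<in> {-m<..<m}"
  shows "rim_root m (of_real x) = of_real (sqrt (m\<^sup>2 - x\<^sup>2))" "sqrt (m\<^sup>2 - x\<^sup>2) > 0"
proof -
  have "x\<^sup>2 < m\<^sup>2" using assms by (intro power2_strict_mono) auto
  thus "sqrt (m\<^sup>2 - x\<^sup>2) > 0" by simp
  have "rim_root m (of_real x) = csqrt (of_real (m\<^sup>2 - x\<^sup>2))" by (simp add: rim_root_def)
  also have "\<dots> = of_real (sqrt (m\<^sup>2 - x\<^sup>2))"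
    by (rule csqrt_of_real) (use \<open>x\<^sup>2 < m\<^sup>2\<close> in simp)
  finally show "rim_root m (of_real x) = of_real (sqrt (m\<^sup>2 - x\<^sup>2))" .
qed

lemma of_real_in_ball: "x \<in> {-m<..<m} \<Longrightarrow> complex_of_real x \<in> ball 0 m"
  by auto

lemma outer_root_square:
  assumes "z \<noteq> 0"
  shows "(outer_root m z)\<^sup>2 = (of_real m)\<^sup>2 - z\<^sup>2"
  using assms by (simp add: outer_root_def power_mult_distrib field_simps)

lemma real_of_square_real_pos:
  assumes "z\<^sup>2 = complex_of_real r" "r > 0"
  shows "Im z = 0"
proof -
  have "Re (z\<^sup>2) = r" "Im (z\<^sup>2) = 0" using assms by auto
  hence "Re z * Im z = 0" "(Re z)\<^sup>2 - (Im z)\<^sup>2 = r" by (auto simp: power2_eq_square)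
  thus ?thesis using assms(2) by (auto simp: power2_eq_square)
qed

text \<open>Pulling \<open>z\<close> out of the root moves the cut from the real rays
  \<open>\<bar>x\<bar> \<ge> m\<close> to the segment \<open>[-m, m]\<close>: a radicand
  \<open>t \<le> 0\<close> means \<open>z\<^sup>2 = m\<^sup>2 / (1 - t)\<close>, which forces
  \<open>z\<close> to be real with modulus at most \<open>m\<close>.\<close>

lemma outer_root_holomorphic:
  assumes "m > 0"
  shows "outer_root m holomorphic_on (- complex_of_real ` {-m..m})"
  unfolding outer_root_def
proof (intro holomorphic_intros)
  fix z assume z: "z \<in> - complex_of_real ` {-m..m}"
  have "0 \<in> complex_of_real ` {-m..m}" using assms by (intro image_eqI[of _ _ 0]) auto
  thus z0: "z \<noteq> 0" using z by auto
  show "1 - (of_real m / z)\<^sup>2 \<notin> \<real>\<^sub>\<le>\<^sub>0"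
  proof
    assume "1 - (of_real m / z)\<^sup>2 \<in> \<real>\<^sub>\<le>\<^sub>0"
    then obtain t where t: "1 - (of_real m / z)\<^sup>2 = of_real t" "t \<le> 0"
      by (auto elim: nonpos_Reals_cases)
    have "(of_real m / z)\<^sup>2 = complex_of_real (1 - t)" using t(1) by (simp add: algebra_simps)
    hence "(of_real m)\<^sup>2 = complex_of_real (1 - t) * z\<^sup>2" using z0 by (simp add: field_simps)
    hence "z\<^sup>2 = complex_of_real (m\<^sup>2 / (1 - t))" using t(2) by (simp add: field_simps)
    moreover have pos: "m\<^sup>2 / (1 - t) > 0" using t assms by simp
    ultimately have Im: "Im z = 0" by (rule real_of_square_real_pos)
    hence zr: "z = of_real (Re z)" by (simp add: complex_eq_iff)
    have "complex_of_real ((Re z)\<^sup>2) = of_real (m\<^sup>2 / (1 - t))"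
      using \<open>z\<^sup>2 = _\<close> zr by (metis of_real_power)
    hence "(Re z)\<^sup>2 = m\<^sup>2 / (1 - t)" by (simp only: of_real_eq_iff)
    also have "\<dots> \<le> m\<^sup>2" using t assms by (simp add: divide_le_eq mult_le_cancel_left1)
    finally have "\<bar>Re z\<bar> \<le> \<bar>m\<bar>" by (simp add: abs_le_square_iff)
    hence "Re z \<in> {-m..m}" using assms by auto
    thus False using z zr by (metis ComplD imageI)
  qed
qed

text \<open>A vanishing real part would make \<open>z\<^sup>2\<close> real and positive, hence
  \<open>z\<close> real. So the sign is constant along the segment from \<open>\<i>\<close> to
  \<open>z\<close>, and at \<open>\<i>\<close> the value is
  \<open>sqrt (1 + m\<^sup>2)\<close>.\<close>

lemma Re_outer_root_upper:
  assumes m: "m > 0" and z: "Im z > 0"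
  shows "Re (outer_root m z) > 0"
proof -
  let ?L = "- complex_of_real ` {-m..m}"
  have nz: "Re (outer_root m w) \<noteq> 0" if "Im w > 0" for w
  proof
    assume "Re (outer_root m w) = 0"
    hence "(outer_root m w)\<^sup>2 = of_real (- ((Im (outer_root m w))\<^sup>2))"
      by (auto simp: complex_eq_iff power2_eq_square)
    moreover have "w \<noteq> 0" using that by auto
    ultimately have "w\<^sup>2 = of_real (m\<^sup>2 + (Im (outer_root m w))\<^sup>2)"
      using outer_root_square[of w m] by (simp add: algebra_simps)
    moreover have "m\<^sup>2 + (Im (outer_root m w))\<^sup>2 > 0" using m by (simp add: add_pos_nonneg)
    ultimately show False using real_of_square_real_pos that by (metis less_irrefl)
  qed
  define p where "p = (\<lambda>t. of_real (1 - t) * \<i> + of_real t * z)"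
  have p: "Im (p t) > 0" if "t \<in> {0..1}" for t
  proof -
    have "(1 - t) + t * Im z > 0"
      using that z by (cases "t = 0") (auto intro: add_nonneg_pos)
    thus ?thesis by (simp add: p_def)
  qed
  have "continuous_on {0..1} (\<lambda>t. outer_root m (p t))"
  proof (rule continuous_on_compose2[OF holomorphic_on_imp_continuous_on[OF outer_root_holomorphic[OF m]]])
    show "continuous_on {0..1} p" unfolding p_def by (intro continuous_intros)
    show "p ` {0..1} \<subseteq> ?L"
      by (rule image_subsetI, rule subsetD[OF upper_half_plane_subset_cut_plane]) (simp add: p)
  qed
  hence "continuous_on {0..1} (\<lambda>t. Re (outer_root m (p t)))" by (rule continuous_on_Re)
  hence "Re (outer_root m (p 0)) * Re (outer_root m (p 1)) > 0"
    by (rule IVT_no_zero_same_sign) (use nz p in auto)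
  moreover have "outer_root m (p 0) = csqrt (of_real (1 + m\<^sup>2))"
    by (simp add: outer_root_def p_def power_mult_distrib del: csqrt_of_real_nonneg)
  hence "Re (outer_root m (p 0)) > 0"
    using add_pos_nonneg[OF zero_less_one zero_le_power2[of m]] by (simp only: csqrt_of_real less_imp_le Re_complex_of_real real_sqrt_gt_zero)
  ultimately show ?thesis by (simp add: p_def zero_less_mult_iff)
qed

lemma Re_outer_root_lower:
  assumes m: "m > 0" and z: "Im z < 0"
  shows "Re (outer_root m z) < 0"
proof -
  have "outer_root m (- z) = - outer_root m z" by (simp add: outer_root_def)
  thus ?thesis using Re_outer_root_upper[OF m, of "- z"] z by simp
qed

text \<open>Both are square roots of \<open>m\<^sup>2 - z\<^sup>2\<close>, and their real parts
  decide the sign. The change of sign between the half-planes is what puts the lower rim on the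
  non-physical sheet.\<close>

lemma outer_root_eq_rim_root:
  assumes m: "m > 0" and z: "z \<in> ball 0 m"
  shows "Im z > 0 \<Longrightarrow> outer_root m z = 1 * rim_root m z" "Im z < 0 \<Longrightarrow> outer_root m z = - 1 * rim_root m z"
proof -
  have *: "outer_root m z = rim_root m z \<or> outer_root m z = - rim_root m z" if "Im z \<noteq> 0"
  proof -
    have "z \<noteq> 0" using that zero_complex.simps(2) by metis
    hence "(outer_root m z)\<^sup>2 = (rim_root m z)\<^sup>2" by (simp add: outer_root_square rim_root_square)
    thus ?thesis by (simp add: power2_eq_iff)
  qed
  show "outer_root m z = 1 * rim_root m z" if "Im z > 0"
    using * Re_outer_root_upper[OF m that] Re_rim_root_pos[OF z] that by (auto simp: complex_eq_iff)
  show "outer_root m z = - 1 * rim_root m z" if "Im z < 0"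
    using * Re_outer_root_lower[OF m that] Re_rim_root_pos[OF z] that by (auto simp: complex_eq_iff)
qed

section \<open>Zeros of the Jost function on the two rims\<close>

context dirac_regular
begin

lemma phi_holomorphic: "x \<ge> 0 \<Longrightarrow> phi1 x holomorphic_on A" "x \<ge> 0 \<Longrightarrow> phi2 x holomorphic_on A"
  using entire_param_holomorphic[OF phi_entire(1)] entire_param_holomorphic[OF phi_entire(2)]
  by (auto intro: holomorphic_on_subset)

lemma psi_holomorphic:
  assumes "g holomorphic_on A"
  shows "(\<lambda>z. psi1 (g z) x) holomorphic_on A" "(\<lambda>z. psi2 z (g z) x) holomorphic_on A"
  unfolding psi1_def psi2_def by (intro holomorphic_intros jost_holomorphic assms)+

lemma jost_fn_holomorphic:
  assumes "f holomorphic_on A" "g holomorphic_on A"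
  shows "(\<lambda>z. jost_fn (f z) (g z)) holomorphic_on A"
proof -
  have "(\<lambda>z. phi1 \<gamma> (f z)) holomorphic_on A" "(\<lambda>z. phi2 \<gamma> (f z)) holomorphic_on A"
    using holomorphic_on_compose[OF assms(1) phi_holomorphic(1), of \<gamma>]
      holomorphic_on_compose[OF assms(1) phi_holomorphic(2), of \<gamma>] gamma_pos by (auto simp: o_def)
  thus ?thesis unfolding jost_fn_def psi1_def psi2_def
    by (intro holomorphic_intros jost_holomorphic assms)
qed

lemma phi_pairing_holomorphic:
  "(\<lambda>w. integral {0..x} (\<lambda>x. phi1 x z * phi1 x w + phi2 x z * phi2 x w)) holomorphic_on UNIV"
proof -
  have c: "continuous_on {0..x} (\<lambda>x. phi1 x z)" "continuous_on {0..x} (\<lambda>x. phi2 x z)" for z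
    by (rule continuous_on_subset[OF phi_continuous(1)] continuous_on_subset[OF phi_continuous(2)], force)+
  have "integral {0..x} (\<lambda>x. phi1 x z * phi1 x w + phi2 x z * phi2 x w)
     = integral {0..x} (\<lambda>x. phi1 x z * phi1 x w) + integral {0..x} (\<lambda>x. phi2 x z * phi2 x w)" for w
    by (intro Henstock_Kurzweil_Integration.integral_add integrable_continuous_real continuous_intros c)
  thus ?thesis
    by (auto intro!: holomorphic_intros entire_param_integral_holomorphic phi_entire c)
qed

lemma phi_pairing_pos:
  assumes "z \<in> \<real>" "x \<ge> \<gamma>"
  shows "Re (integral {0..x} (\<lambda>x. phi1 x z * phi1 x z + phi2 x z * phi2 x z)) > 0"
proof -
  have "integral {0..x} (\<lambda>x. phi1 x z * phi1 x z + phi2 x z * phi2 x z)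
     = integral {0..x} (\<lambda>x. phi1 x z * cnj (phi1 x z) + phi2 x z * cnj (phi2 x z))"
    by (intro integral_cong) (use phi_real[OF _ assms(1)] in \<open>auto simp: Reals_cnj_iff\<close>)
  thus ?thesis using phi_norm_pos(1)[OF assms(2), of z] by simp
qed

text \<open>If \<open>phi\<close> vanished at \<open>x\<close>, the Wronskian of \<open>phi(z)\<close> and \<open>phi(w)\<close> would vanish for all \<open>w\<close>.\<close>

lemma phi_nz_real:
  assumes z: "z \<in> \<real>" and x: "x \<ge> \<gamma>"
  shows "phi1 x z \<noteq> 0 \<or> phi2 x z \<noteq> 0"
proof (rule ccontr)
  assume "\<not> ?thesis"
  hence 0: "phi1 x z = 0" "phi2 x z = 0" by auto
  let ?I = "\<lambda>w. integral {0..x} (\<lambda>x. phi1 x z * phi1 x w + phi2 x z * phi2 x w)"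
  have "?I w = 0" if "w \<noteq> z" for w
    using phi_wronskian[of x z w] 0 that x gamma_pos by auto
  hence "(?I \<longlongrightarrow> 0) (at z)"
    by (intro tendsto_eventually) (auto simp: eventually_at_filter)
  moreover have "isCont ?I z"
    using holomorphic_on_imp_continuous_on[OF phi_pairing_holomorphic] by (simp add: continuous_on_eq_continuous_at)
  hence "(?I \<longlongrightarrow> ?I z) (at z)" by (simp add: isCont_def)
  ultimately have "?I z = 0" using LIM_unique by blast
  thus False using phi_pairing_pos[OF z x] by simp
qed

text \<open>\<open>\<sigma> = 1\<close> belongs to the upper rim and \<open>\<sigma> = - 1\<close>
  to the lower one. Both functions are holomorphic across the segment, so a rim point is an interior
  point and orders of zeros make sense there.\<close>

definition rim_jost :: "complex \<Rightarrow> complex \<Rightarrow> complex" where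
  "rim_jost \<sigma> z = jost_fn z (\<sigma> * rim_root m z)"

lemma rim_jost_holomorphic: "rim_jost \<sigma> holomorphic_on ball 0 m"
  unfolding rim_jost_def[abs_def] by (intro jost_fn_holomorphic holomorphic_intros rim_root_holomorphic)

lemma rim_facts:
  assumes "x \<in> {-m<..<m}" "\<sigma> \<in> {1, -1}"
  shows "(\<sigma> * rim_root m (of_real x))\<^sup>2 = (of_real m)\<^sup>2 - (of_real x)\<^sup>2" "\<sigma> * rim_root m (of_real x) \<noteq> 0"
    "complex_of_real x \<noteq> of_real m"
  using assms rim_root_of_real[OF assms(1)] rim_root_square[of m "of_real x"] by (auto simp: power_mult_distrib)

lemma rim_jost_parallel:
  assumes "x \<in> {-m<..<m}" "\<sigma> \<in> {1, -1}" "rim_jost \<sigma> (of_real x) = 0" "y \<ge> \<gamma>"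
  obtains c where "c \<noteq> 0" "psi1 (\<sigma> * rim_root m (of_real x)) y = c * phi1 y (of_real x)"
    "psi2 (of_real x) (\<sigma> * rim_root m (of_real x)) y = c * phi2 y (of_real x)"
  using phi_parallel_psi[OF rim_facts[OF assms(1,2)] _ assms(4) phi_nz_real[OF _ assms(4)]] assms(3)
  unfolding rim_jost_def by (metis Reals_of_real)

lemma rim_jost_not_both_zero:
  assumes x: "x \<in> {-m<..<m}" and J: "rim_jost 1 (of_real x) = 0"
  shows "rim_jost (- 1) (of_real x) \<noteq> 0"
proof
  assume J': "rim_jost (- 1) (of_real x) = 0"
  let ?s = "rim_root m (of_real x)"
  obtain c where c: "psi1 (1 * ?s) \<gamma> = c * phi1 \<gamma> (of_real x)" "psi2 (of_real x) (1 * ?s) \<gamma> = c * phi2 \<gamma> (of_real x)"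
    using rim_jost_parallel[OF x _ J order_refl] by auto
  obtain d where d: "psi1 (- 1 * ?s) \<gamma> = d * phi1 \<gamma> (of_real x)" "psi2 (of_real x) (- 1 * ?s) \<gamma> = d * phi2 \<gamma> (of_real x)"
    using rim_jost_parallel[OF x _ J' order_refl] by auto
  have "psi1 ?s \<gamma> * psi2 (of_real x) (- ?s) \<gamma> - psi2 (of_real x) ?s \<gamma> * psi1 (- ?s) \<gamma> = 0"
    using c d by simp
  thus False using psi_wronskian[OF gamma_pos, of ?s "of_real x"] rim_facts[OF x, of 1] by simp
qed

text \<open>The substitution \<open>z = m cos t\<close>, \<open>s = m sin t\<close> uniformizes both rims, including the branch points.\<close>

lemma uniformized_jost:
  "(\<lambda>t. jost_fn (of_real m * cos t) (of_real m * sin t)) holomorphic_on UNIV"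
  "x \<in> {-m<..<m} \<Longrightarrow> \<exists>t\<in>{0..pi}. x = m * cos t \<and> rim_jost 1 (of_real x) = jost_fn (of_real m * cos (of_real t)) (of_real m * sin (of_real t))
      \<and> rim_jost (- 1) (of_real x) = jost_fn (of_real m * cos (of_real (- t))) (of_real m * sin (of_real (- t)))"
proof -
  show "(\<lambda>t. jost_fn (of_real m * cos t) (of_real m * sin t)) holomorphic_on UNIV"
    by (intro jost_fn_holomorphic holomorphic_intros)
  assume x: "x \<in> {-m<..<m}"
  define t where "t = arccos (x / m)"
  have b: "-1 \<le> x / m" "x / m \<le> 1" using x m_pos by (auto simp: field_simps)
  have t: "t \<in> {0..pi}" using arccos_lbound[OF b] arccos_ubound[OF b] by (simp add: t_def)
  have c: "m * cos t = x" using cos_arccos[OF b] m_pos by (simp add: t_def)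
  have "sin t \<ge> 0" using t by (intro sin_ge_zero) auto
  have "m\<^sup>2 - x\<^sup>2 = (m * sin t)\<^sup>2"
    unfolding c[symmetric] power_mult_distrib sin_squared_eq by (simp add: algebra_simps)
  hence s: "sqrt (m\<^sup>2 - x\<^sup>2) = m * sin t" using m_pos \<open>sin t \<ge> 0\<close> by simp
  have "complex_of_real m * cos (of_real t) = of_real x" "complex_of_real m * sin (of_real t) = rim_root m (of_real x)"
    by (simp_all only: rim_root_of_real(1)[OF x] s cos_of_real sin_of_real of_real_mult[symmetric] c)
  thus "\<exists>t\<in>{0..pi}. x = m * cos t \<and> rim_jost 1 (of_real x) = jost_fn (of_real m * cos (of_real t)) (of_real m * sin (of_real t))
      \<and> rim_jost (- 1) (of_real x) = jost_fn (of_real m * cos (of_real (- t))) (of_real m * sin (of_real (- t)))"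
    using t c by (intro bexI[of _ t]) (auto simp: rim_jost_def)
qed

text \<open>Two parameters lie over \<open>x = 0\<close>, one for each rim. A constant function
  would take the same value at both, and \<open>rim_jost_not_both_zero\<close> makes that constant
  nonzero.\<close>

lemma uniformized_jost_zeros_finite:
  assumes "compact K"
  shows "finite {t\<in>K. jost_fn (of_real m * cos t) (of_real m * sin t) = 0}"
proof (cases "(\<lambda>t. jost_fn (of_real m * cos t) (of_real m * sin t)) constant_on UNIV")
  case False
  show ?thesis by (rule holomorphic_compact_finite_zeros[OF uniformized_jost(1) _ _ assms _ False]) auto
next
  case True
  then obtain c where c: "\<And>t. jost_fn (of_real m * cos t) (of_real m * sin t) = c"
    unfolding constant_on_def by blast
  have 0: "0 \<in> {-m<..<m}" using m_pos by auto
  have "rim_jost 1 (of_real 0) = c" "rim_jost (- 1) (of_real 0) = c" using uniformized_jost(2)[OF 0] c by metis+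
  hence "c \<noteq> 0" using rim_jost_not_both_zero[OF 0] by metis
  thus ?thesis using c by simp
qed

text \<open>The parameter interval \<open>{0..pi}\<close> is compact and its end points are the
  branch points, so zeros cannot accumulate at the ends of the rim.\<close>

lemma rim_jost_zeros_finite: "finite {x\<in>{-m<..<m}. rim_jost 1 (of_real x) = 0}"
proof -
  let ?j = "\<lambda>t. jost_fn (of_real m * cos t) (of_real m * sin t)"
  have "compact (complex_of_real ` {0..pi})" by (intro compact_continuous_image continuous_intros) auto
  from uniformized_jost_zeros_finite[OF this]
  have "finite {t\<in>complex_of_real ` {0..pi}. ?j t = 0}" .
  hence "finite ((\<lambda>t. m * cos (Re t)) ` {t\<in>complex_of_real ` {0..pi}. ?j t = 0})" by (rule finite_imageI)
  moreover have "{x\<in>{-m<..<m}. rim_jost 1 (of_real x) = 0} \<subseteq> (\<lambda>t. m * cos (Re t)) ` {t\<in>complex_of_real ` {0..pi}. ?j t = 0}"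
  proof
    fix x assume x: "x \<in> {x\<in>{-m<..<m}. rim_jost 1 (of_real x) = 0}"
    then obtain t where t: "t \<in> {0..pi}" "x = m * cos t" "rim_jost 1 (of_real x) = ?j (of_real t)"
      using uniformized_jost(2)[of x] by blast
    show "x \<in> (\<lambda>t. m * cos (Re t)) ` {t\<in>complex_of_real ` {0..pi}. ?j t = 0}"
      by (rule image_eqI[of _ _ "complex_of_real t"]) (use t x in auto)
  qed
  ultimately show ?thesis by (rule finite_subset[rotated])
qed

text \<open>Identical vanishing would place the infinite set \<open>{-m<..<m}\<close> in the image
  of a finite zero set. The parameter interval is \<open>{-pi..pi}\<close> so that negative
  parameters cover the lower rim.\<close>

lemma rim_jost_nz_somewhere:
  assumes "\<sigma> \<in> {1, -1}"
  shows "\<exists>z\<in>ball 0 m. rim_jost \<sigma> z \<noteq> 0"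
proof (rule ccontr)
  assume A: "\<not> ?thesis"
  have x0: "rim_jost \<sigma> (of_real x) = 0" if "x \<in> {-m<..<m}" for x
    using A of_real_in_ball[OF that] by blast
  let ?j = "\<lambda>t. jost_fn (of_real m * cos t) (of_real m * sin t)"
  have "compact (complex_of_real ` {-pi..pi})" by (intro compact_continuous_image continuous_intros) auto
  from uniformized_jost_zeros_finite[OF this]
  have fin: "finite {t\<in>complex_of_real ` {-pi..pi}. ?j t = 0}" .
  have "{-m<..<m} \<subseteq> (\<lambda>t. m * cos (Re t)) ` {t\<in>complex_of_real ` {-pi..pi}. ?j t = 0}"
  proof
    fix x assume x: "x \<in> {-m<..<m}"
    then obtain t where t: "t \<in> {0..pi}" "x = m * cos t" "rim_jost 1 (of_real x) = ?j (of_real t)"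
      "rim_jost (- 1) (of_real x) = ?j (of_real (- t))"
      using uniformized_jost(2)[of x] by blast
    have "\<exists>u\<in>{t, - t}. ?j (of_real u) = 0" using assms t x0[OF x] by auto
    then obtain u where u: "u = t \<or> u = - t" "?j (of_real u) = 0" by blast
    have "u \<in> {-pi..pi}" "m * cos u = x" using u(1) t pi_ge_zero by auto
    thus "x \<in> (\<lambda>t. m * cos (Re t)) ` {t\<in>complex_of_real ` {-pi..pi}. ?j t = 0}"
      using u(2) by (intro image_eqI[of _ _ "complex_of_real u"]) auto
  qed
  hence "finite {-m<..<m}" by (rule finite_subset) (intro finite_imageI fin)
  thus False using m_pos infinite_Ioo[of "-m" m] by simp
qed

lemma rim_jost_eventually_nz:
  assumes "\<sigma> \<in> {1, -1}" "x \<in> {-m<..<m}"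
  shows "\<forall>\<^sub>F w in at (of_real x). rim_jost \<sigma> w \<noteq> 0 \<and> w \<in> ball 0 m"
proof -
  obtain z where "z \<in> ball 0 m" "rim_jost \<sigma> z \<noteq> 0" using rim_jost_nz_somewhere[OF assms(1)] by blast
  thus ?thesis
    by (intro non_zero_neighbour_alt[OF rim_jost_holomorphic _ _ of_real_in_ball[OF assms(2)]]) auto
qed

definition rim_side :: "complex \<Rightarrow> complex set" where
  "rim_side \<sigma> = (if \<sigma> = 1 then {z. Im z > 0} else {z. Im z < 0})"

text \<open>The continuation is \<open>A - C / J\<close>; at a zero of \<open>J\<close> the numerator \<open>C\<close> is, up to a nonzero
  factor, the product of the pairings of \<open>h\<close> and \<open>cnj h\<close> with the eigensolution \<open>phi\<close>.\<close>

lemma Phi_pole_iff: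
  assumes h: "h \<in> test_functions"
  defines "h1 \<equiv> cutoff (\<lambda>x. fst (h x))" and "h2 \<equiv> cutoff (\<lambda>x. snd (h x))"
  shows "\<exists>X A C. X \<ge> \<gamma> \<and> continuous_on {0..X} h1 \<and> continuous_on {0..X} h2 \<and>
    (\<forall>\<sigma>\<in>{1,-1}. A holomorphic_on ball 0 m \<and> C \<sigma> holomorphic_on ball 0 m \<and>
      (\<forall>x\<in>{-m<..<m}. \<forall>n. (\<exists>F. continuation m (Phi \<kappa> m v h) F \<and> extension_pole F (rim_side \<sigma>) (of_real x) n) \<longleftrightarrow>
          pole_of_order_at (\<lambda>z. A z - C \<sigma> z / rim_jost \<sigma> z) (of_real x) n) \<and>
      (\<forall>x\<in>{-m<..<m}. rim_jost \<sigma> (of_real x) = 0 \<longrightarrow> (\<exists>c. c \<noteq> 0 \<and> C \<sigma> (of_real x) =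
          c * integral {0..X} (\<lambda>y. cnj (h1 y) * phi1 y (of_real x) + cnj (h2 y) * phi2 y (of_real x)) *
            integral {0..X} (\<lambda>y. h1 y * phi1 y (of_real x) + h2 y * phi2 y (of_real x)))))"
proof -
  obtain X A E1 E2 where X: "X \<ge> \<gamma>" and hol: "A holomorphic_on UNIV" "E1 holomorphic_on UNIV" "E2 holomorphic_on UNIV"
    and Bhol: "(\<lambda>z. integral {0..X} (\<lambda>x. h1 x * phi1 x z + h2 x * phi2 x z)) holomorphic_on UNIV"
    and hc: "continuous_on {0..X} h1" "continuous_on {0..X} h2"
    and W: "\<And>z. E1 z * phi2 X z - E2 z * phi1 X z = integral {0..X} (\<lambda>x. cnj (h1 x) * phi1 x z + cnj (h2 x) * phi2 x z)"
    and Phi: "\<And>z s. Im z > 0 \<Longrightarrow> s\<^sup>2 = (of_real m)\<^sup>2 - z\<^sup>2 \<Longrightarrow> Re s > 0 \<Longrightarrow>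
       Phi \<kappa> m v h z = A z - (E1 z * psi2 z s X - E2 z * psi1 s X) *
          integral {0..X} (\<lambda>x. h1 x * phi1 x z + h2 x * phi2 x z) / jost_fn z s"
    using Phi_formula[OF h] unfolding h1_def h2_def by blast
  define B where "B = (\<lambda>z. integral {0..X} (\<lambda>x. h1 x * phi1 x z + h2 x * phi2 x z))"
  define N where "N = (\<lambda>z s. (E1 z * psi2 z s X - E2 z * psi1 s X) * B z)"
  let ?L = "- complex_of_real ` {-m..m}"
  have Nhol: "(\<lambda>z. N z (g z)) holomorphic_on S" if "g holomorphic_on S" for g S
    unfolding N_def B_def
    by (intro holomorphic_intros psi_holomorphic that holomorphic_on_subset[OF hol(2)]
        holomorphic_on_subset[OF hol(3)] holomorphic_on_subset[OF Bhol]) auto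
  \<comment> \<open>The explicit candidate on the cut plane; it can be singular only at zeros of the
    Jost function, since \<open>outer_root\<close> is holomorphic there.\<close>
  define F0 where "F0 = (\<lambda>z. A z - N z (outer_root m z) / jost_fn z (outer_root m z))"
  have an: "A analytic_on {z}" "(\<lambda>z. N z (outer_root m z)) analytic_on {z}" "(\<lambda>z. jost_fn z (outer_root m z)) analytic_on {z}" if "z \<in> ?L" for z
  proof -
    have "(\<lambda>z. N z (outer_root m z)) holomorphic_on ?L" "(\<lambda>z. jost_fn z (outer_root m z)) holomorphic_on ?L"
      by (intro Nhol jost_fn_holomorphic holomorphic_intros outer_root_holomorphic m_pos)+
    thus "A analytic_on {z}" "(\<lambda>z. N z (outer_root m z)) analytic_on {z}" "(\<lambda>z. jost_fn z (outer_root m z)) analytic_on {z}"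
      using open_cut_plane[of m] hol(1) that by (auto simp: analytic_at)
  qed
  have "F0 meromorphic_on {z}" if "z \<in> ?L" for z
    unfolding F0_def by (intro meromorphic_intros analytic_on_imp_meromorphic_on an that)
  hence F0m: "F0 meromorphic_on ?L"
    by (subst meromorphic_on_meromorphic_at) blast
  have F0an: "F0 analytic_on {z}" if "z \<in> ?L" "jost_fn z (outer_root m z) \<noteq> 0" for z
    unfolding F0_def by (intro analytic_intros an that) (use that in auto)
  have root: "(outer_root m z)\<^sup>2 = (of_real m)\<^sup>2 - z\<^sup>2" "Re (outer_root m z) > 0" "jost_fn z (outer_root m z) \<noteq> 0" if "Im z > 0" for z
  proof -
    have "z \<noteq> 0" using that by auto
    thus 1: "(outer_root m z)\<^sup>2 = (of_real m)\<^sup>2 - z\<^sup>2" by (rule outer_root_square)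
    show 2: "Re (outer_root m z) > 0" by (rule Re_outer_root_upper[OF m_pos that])
    show "jost_fn z (outer_root m z) \<noteq> 0" by (rule jost_fn_nz_upper[OF 1 that 2])
  qed
  have F0Phi: "F0 z = Phi \<kappa> m v h z" if "Im z > 0" for z
    using Phi[OF that root(1,2)[OF that]] by (simp add: F0_def N_def B_def)
  have upL: "z \<in> ?L" if "Im z \<noteq> 0" for z using that by auto
  \<comment> \<open>\<open>remove_sings\<close> adjusts the values at exceptional points as
    \<open>nicely_meromorphic_on\<close> requires; on the upper half-plane it changes nothing
    because the Jost function has no zero there.\<close>
  have cont: "continuation m (Phi \<kappa> m v h) (remove_sings F0)"
    unfolding continuation_def
  proof (intro conjI allI impI)
    show "remove_sings F0 nicely_meromorphic_on ?L" by (rule remove_sings_nicely_meromorphic[OF F0m])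
    fix z assume z: "Im z > 0"
    thus "remove_sings F0 z = Phi \<kappa> m v h z"
      using F0an[OF upL] root(3) F0Phi by (simp add: remove_sings_at_analytic)
  qed
  define C where "C = (\<lambda>\<sigma> z. N z (\<sigma> * rim_root m z))"
  have Chol: "C \<sigma> holomorphic_on ball 0 m" for \<sigma>
    unfolding C_def by (intro Nhol holomorphic_intros rim_root_holomorphic)
  have pole: "(\<exists>F. continuation m (Phi \<kappa> m v h) F \<and> extension_pole F (rim_side \<sigma>) (of_real x) n) \<longleftrightarrow>
          pole_of_order_at (\<lambda>z. A z - C \<sigma> z / rim_jost \<sigma> z) (of_real x) n"
    if \<sigma>: "\<sigma> \<in> {1, -1}" and x: "x \<in> {-m<..<m}" for \<sigma> x n
  proof -
    let ?G = "\<lambda>z. A z - C \<sigma> z / rim_jost \<sigma> z"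
    have side: "rim_side \<sigma> = {z. Im z > 0} \<or> rim_side \<sigma> = {z. Im z < 0}" by (simp add: rim_side_def)
    have rr: "outer_root m z = \<sigma> * rim_root m z" if "z \<in> ball 0 m" "z \<in> rim_side \<sigma>" for z
      using \<sigma> outer_root_eq_rim_root[OF m_pos that(1)] that(2) by (auto simp: rim_side_def split: if_splits)
    have "A analytic_on {of_real x}" "C \<sigma> analytic_on {of_real x}" "rim_jost \<sigma> analytic_on {of_real x}"
      using of_real_in_ball[OF x] Chol[of \<sigma>] rim_jost_holomorphic[of \<sigma>] hol(1) open_ball[of 0 m] open_UNIV
      unfolding analytic_at by blast+
    hence Gm: "?G meromorphic_on {of_real x}"
      by (intro meromorphic_intros analytic_on_imp_meromorphic_on)
    have "extension_pole F (rim_side \<sigma>) (of_real x) n \<longleftrightarrow> pole_of_order_at ?G (of_real x) n"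
      if F: "continuation m (Phi \<kappa> m v h) F" for F
    proof (rule extension_pole_iff[OF side Gm])
      \<comment> \<open>Close to the rim point the Jost function has no further zero, so every
        continuation agrees there with \<open>F0\<close>, and on the chosen side
        \<open>outer_root\<close> is \<open>\<sigma>\<close> times \<open>rim_root\<close>.\<close>
      have "\<forall>\<^sub>F w in at (of_real x) within rim_side \<sigma>. rim_jost \<sigma> w \<noteq> 0 \<and> w \<in> ball 0 m"
        using rim_jost_eventually_nz[OF \<sigma> x] by (rule filter_leD[OF at_le[OF subset_UNIV]])
      moreover have "\<forall>\<^sub>F w in at (of_real x) within rim_side \<sigma>. w \<in> rim_side \<sigma>"
        by (auto simp: eventually_at_filter)
      ultimately show "\<forall>\<^sub>F w in at (of_real x) within rim_side \<sigma>. ?G w = F w"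
      proof eventually_elim
        case (elim w)
        have Lw: "w \<in> ?L" using elim(2) by (intro upL) (auto simp: rim_side_def split: if_splits)
        have r: "outer_root m w = \<sigma> * rim_root m w" using rr elim by blast
        have "jost_fn w (outer_root m w) \<noteq> 0" using elim r by (simp add: rim_jost_def)
        from F0an[OF Lw this] have "F w = F0 w"
          by (intro continuation_unique[OF F F0m F0Phi Lw])
        thus ?case by (simp add: F0_def C_def rim_jost_def r)
      qed
    qed
    thus ?thesis using cont by blast
  qed
  have val: "\<exists>c. c \<noteq> 0 \<and> C \<sigma> (of_real x) =
          c * integral {0..X} (\<lambda>y. cnj (h1 y) * phi1 y (of_real x) + cnj (h2 y) * phi2 y (of_real x)) *
            integral {0..X} (\<lambda>y. h1 y * phi1 y (of_real x) + h2 y * phi2 y (of_real x))"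
    if \<sigma>: "\<sigma> \<in> {1, -1}" and x: "x \<in> {-m<..<m}" and J: "rim_jost \<sigma> (of_real x) = 0" for \<sigma> x
  proof -
    obtain c where c: "c \<noteq> 0" "psi1 (\<sigma> * rim_root m (of_real x)) X = c * phi1 X (of_real x)"
      "psi2 (of_real x) (\<sigma> * rim_root m (of_real x)) X = c * phi2 X (of_real x)"
      using rim_jost_parallel[OF x \<sigma> J X] by blast
    have "E1 (of_real x) * psi2 (of_real x) (\<sigma> * rim_root m (of_real x)) X - E2 (of_real x) * psi1 (\<sigma> * rim_root m (of_real x)) X
      = c * (E1 (of_real x) * phi2 X (of_real x) - E2 (of_real x) * phi1 X (of_real x))"
      unfolding c by (simp add: algebra_simps)
    thus ?thesis using c(1) unfolding W by (intro exI[of _ c]) (simp add: C_def N_def B_def)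
  qed
  have "A holomorphic_on ball 0 m" using hol(1) by (rule holomorphic_on_subset) auto
  thus ?thesis using X hc Chol pole val by blast
qed

end

subsection \<open>Eigenvalues and anti-bound states\<close>

lemma DERIV_Re_of_real:
  assumes "(f has_field_derivative D) (at (complex_of_real x))"
  shows "((\<lambda>x. Re (f (of_real x))) has_real_derivative Re D) (at x)"
proof -
  have "((\<lambda>x. f (of_real x)) has_vector_derivative D) (at x)"
    by (rule has_vector_derivative_real_field[OF assms])
  from bounded_linear.has_vector_derivative[OF bounded_linear_Re this]
  show ?thesis by (simp add: has_real_derivative_iff_has_vector_derivative)
qed

text \<open>With derivatives of the same strict sign the function would have opposite signs just
  right of \<open>a\<close> and just left of \<open>b\<close>, hence a zero in between. The factor
  \<open>1 / 3\<close> in the step \<open>h\<close> ensures \<open>a + h < b - h\<close>.\<close>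

lemma DERIV_opposite_signs:
  fixes f :: "real \<Rightarrow> real"
  assumes ab: "a < b" and f: "f a = 0" "f b = 0" "\<And>x. x \<in> {a<..<b} \<Longrightarrow> f x \<noteq> 0"
    and c: "continuous_on {a..b} f"
    and D: "(f has_real_derivative D) (at a)" "(f has_real_derivative E) (at b)"
  shows "D * E \<le> 0"
proof -
  have *: False if DE: "D > 0" "E > 0" and f: "f a = 0" "f b = 0" "\<And>x. x \<in> {a<..<b} \<Longrightarrow> f x \<noteq> 0" "continuous_on {a..b} f"
    "(f has_real_derivative D) (at a)" "(f has_real_derivative E) (at b)" for f D E
  proof -
    obtain d where d: "d > 0" "\<And>h. 0 < h \<Longrightarrow> h < d \<Longrightarrow> f a < f (a + h)"
      using DERIV_pos_inc_right[OF f(5) DE(1)] by blast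
    obtain e where e: "e > 0" "\<And>h. 0 < h \<Longrightarrow> h < e \<Longrightarrow> f (b - h) < f b"
      using DERIV_pos_inc_left[OF f(6) DE(2)] by blast
    define h where "h = min (min d e) (b - a) / 3"
    have h: "0 < h" "h < d" "h < e" "a + h < b - h" using d e ab by (auto simp: h_def min_def field_simps)
    have "f (a + h) > 0" "f (b - h) < 0" using d(2)[OF h(1,2)] e(2)[OF h(1,3)] f(1,2) by auto
    moreover have "continuous_on {a + h..b - h} f" using f(4) by (rule continuous_on_subset) (use h in auto)
    ultimately obtain x where "a + h \<le> x" "x \<le> b - h" "f x = 0"
      using IVT2'[of f "b - h" 0 "a + h"] h by auto
    thus False using f(3)[of x] h by auto
  qed
  show ?thesis
  proof (rule ccontr)
    assume "\<not> D * E \<le> 0"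
    hence "D > 0 \<and> E > 0 \<or> - D > 0 \<and> - E > 0" by (auto simp: not_le zero_less_mult_iff)
    thus False
    proof
      assume "D > 0 \<and> E > 0"
      thus False using *[of D E f] f c D by blast
    next
      assume "- D > 0 \<and> - E > 0"
      moreover have "((\<lambda>x. - f x) has_real_derivative - D) (at a)" "((\<lambda>x. - f x) has_real_derivative - E) (at b)"
        by (intro DERIV_minus D)+
      moreover have "continuous_on {a..b} (\<lambda>x. - f x)" by (intro continuous_intros c)
      ultimately show False using *[of "- D" "- E" "\<lambda>x. - f x"] f by simp
    qed
  qed
qed

context dirac_regular
begin

lemma psi_real:
  "psi1 (of_real s) y \<in> \<real>" "z \<in> \<real> \<Longrightarrow> psi2 z (of_real s) y \<in> \<real>"
  unfolding psi1_def psi2_def by (auto intro!: jost_real Reals_mult Reals_diff)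

lemma rim_jost_real:
  assumes "x \<in> {-m<..<m}" "\<sigma> \<in> {1, -1}"
  shows "rim_jost \<sigma> (of_real x) \<in> \<real>"
proof -
  obtain r where r: "\<sigma> * rim_root m (of_real x) = of_real r"
    using assms rim_root_of_real(1)[OF assms(1)] by (metis Reals_cases Reals_mult Reals_of_real Reals_1 Reals_minus insertE singletonD)
  show ?thesis
    unfolding rim_jost_def jost_fn_def r
    using phi_real[of \<gamma> "of_real x"] gamma_pos
    by (intro Reals_diff Reals_mult) (auto intro!: psi_real)
qed

text \<open>The Wronskian of the decaying solutions at two energies is monotone in \<open>x\<close> and vanishes at
  infinity, which determines its sign.\<close>

lemma psi_wronskian_sign:
  assumes x: "x \<in> {-m<..<m}" "y \<in> {-m<..<m}" "x < y"
  defines "s \<equiv> \<lambda>x. rim_root m (complex_of_real x)"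
  shows "Re (psi1 (s x) \<gamma> * psi2 (of_real y) (s y) \<gamma> - psi2 (of_real x) (s x) \<gamma> * psi1 (s y) \<gamma>) \<ge> 0"
proof -
  define a where "a = sqrt (m\<^sup>2 - x\<^sup>2)"
  define b where "b = sqrt (m\<^sup>2 - y\<^sup>2)"
  have ab: "s x = of_real a" "s y = of_real b" "a > 0" "b > 0"
    using rim_root_of_real[OF x(1)] rim_root_of_real[OF x(2)] by (auto simp: s_def a_def b_def)
  have sq: "(s w)\<^sup>2 = (of_real m)\<^sup>2 - (of_real w)\<^sup>2" for w unfolding s_def by (rule rim_root_square)
  let ?W = "\<lambda>t. psi1 (s x) t * psi2 (of_real y) (s y) t - psi2 (of_real x) (s x) t * psi1 (s y) t"
  let ?D = "\<lambda>t. (of_real x - of_real y) * (psi1 (s x) t * psi1 (s y) t + psi2 (of_real x) (s x) t * psi2 (of_real y) (s y) t)"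
  have W: "ac_on {\<gamma>..} ?W ?D"
    using sol_wronskian[OF psi_sol[OF sq[of x]] psi_sol[OF sq[of y]] ray_intervals(2)] by simp
  have neg: "ac_on {\<gamma>..} (\<lambda>t. (- 1) * ?W t) (\<lambda>t. (- 1) * ?D t)" by (rule ac_on_cmult[OF W])
  have mono: "Re ((- 1) * ?W \<gamma>) \<le> Re ((- 1) * ?W t)" if "t \<ge> \<gamma>" for t
  proof (rule ac_on_mono[OF neg ray_intervals(2)])
    fix u assume "u \<in> {\<gamma>..}"
    hence u: "u > 0" using gamma_pos by simp
    obtain p1 q1 where 1: "jost \<kappa> (s x) u = of_real p1" "jost (\<kappa> - 1) (s x) u = of_real q1" "p1 > 0" "q1 > 0"
      using jost_real[of \<kappa> a u] jost_real[of "\<kappa> - 1" a u] jost_pos[OF ab(3) u, of \<kappa>] jost_pos[OF ab(3) u, of "\<kappa> - 1"]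
      unfolding ab by (metis Re_complex_of_real Reals_cases)
    obtain p2 q2 where 2: "jost \<kappa> (s y) u = of_real p2" "jost (\<kappa> - 1) (s y) u = of_real q2" "p2 > 0" "q2 > 0"
      using jost_real[of \<kappa> b u] jost_real[of "\<kappa> - 1" b u] jost_pos[OF ab(4) u, of \<kappa>] jost_pos[OF ab(4) u, of "\<kappa> - 1"]
      unfolding ab by (metis Re_complex_of_real Reals_cases)
    \<comment> \<open>Here \<open>x, y < m\<close> enters: the factors \<open>x - m\<close> and
      \<open>y - m\<close> of the second components are both negative, so their product is
      positive.\<close>
    have "(- 1) * ?D u = of_real ((y - x) * (p1 * p2 + (m - x) * (m - y) * (q1 * q2)))"
      unfolding psi1_def psi2_def 1 2 by (simp add: algebra_simps)
    moreover have "(y - x) * (p1 * p2 + (m - x) * (m - y) * (q1 * q2)) \<ge> 0"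
      using x 1 2 by (intro mult_nonneg_nonneg add_nonneg_nonneg) auto
    ultimately show "(- 1) * ?D u \<in> \<real> \<and> 0 \<le> Re ((- 1) * ?D u)"
      by (metis Re_complex_of_real Reals_of_real)
  qed (use that in auto)
  have pos: "Re (s x) > 0" "Re (s y) > 0" using ab by auto
  have "((\<lambda>t. Re ((- 1) * ?W t)) \<longlongrightarrow> Re ((- 1) * (0 * 0 - 0 * 0))) at_top"
    by (intro tendsto_intros psi_tendsto_0 pos)
  hence "((\<lambda>t. Re ((- 1) * ?W t)) \<longlongrightarrow> 0) at_top" by simp
  moreover have "\<forall>\<^sub>F t in at_top. Re ((- 1) * ?W \<gamma>) \<le> Re ((- 1) * ?W t)"
    using eventually_ge_at_top[of \<gamma>] by eventually_elim (rule mono)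
  ultimately have "Re ((- 1) * ?W \<gamma>) \<le> 0" by (intro tendsto_lowerbound) auto
  thus ?thesis by simp
qed

text \<open>The real part of the Wronskian vanishes at \<open>w = x\<close> and is nonnegative at
  real \<open>w\<close> to the right, so its derivative is nonnegative. The derivative stands for
  the integral of \<open>psi\<^sup>2\<close> over \<open>{\<gamma>..}\<close>, with no improper
  integral being formed.\<close>

lemma psi_wronskian_deriv_nonneg:
  assumes x: "x \<in> {-m<..<m}"
    and d: "((\<lambda>w. psi1 (rim_root m w) \<gamma>) has_field_derivative D1) (at (of_real x))"
      "((\<lambda>w. psi2 w (rim_root m w) \<gamma>) has_field_derivative D2) (at (of_real x))"
  shows "Re (psi1 (rim_root m (of_real x)) \<gamma> * D2 - psi2 (of_real x) (rim_root m (of_real x)) \<gamma> * D1) \<ge> 0"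
proof (rule ccontr)
  let ?s = "rim_root m (complex_of_real x)"
  let ?w = "\<lambda>w. psi1 ?s \<gamma> * psi2 w (rim_root m w) \<gamma> - psi2 (of_real x) ?s \<gamma> * psi1 (rim_root m w) \<gamma>"
  let ?E = "psi1 ?s \<gamma> * D2 - psi2 (of_real x) ?s \<gamma> * D1"
  assume "\<not> Re ?E \<ge> 0"
  hence E: "Re ?E < 0" by simp
  have "(?w has_field_derivative ?E) (at (of_real x))"
    by (intro DERIV_diff DERIV_cmult d)
  from DERIV_neg_dec_right[OF DERIV_Re_of_real[OF this] E]
  obtain e where e: "e > 0" "\<And>h. 0 < h \<Longrightarrow> h < e \<Longrightarrow> Re (?w (of_real (x + h))) < Re (?w (of_real x))" by blast
  define h where "h = min e (m - x) / 2"
  have h: "0 < h" "h < e" "x + h < m" using e x by (auto simp: h_def min_def field_simps)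
  have "Re (?w (of_real (x + h))) \<ge> 0"
    using psi_wronskian_sign[OF x, of "x + h"] h x by auto
  moreover have "Re (?w (of_real x)) = 0" by (simp add: mult.commute)
  ultimately show False using e(2)[OF h(1,2)] by linarith
qed

text \<open>The Wronskian of \<open>phi\<close> at \<open>w\<close> and at \<open>z\<close> is
  \<open>w - z\<close> times their pairing over \<open>{0..\<gamma>}\<close>, so its derivative at
  \<open>w = z\<close> is the squared norm of \<open>phi\<close>.\<close>

lemma phi_wronskian_deriv:
  assumes z: "z \<in> \<real>" and d: "(phi1 \<gamma> has_field_derivative D1) (at z)" "(phi2 \<gamma> has_field_derivative D2) (at z)"
  shows "Re (D1 * phi2 \<gamma> z - D2 * phi1 \<gamma> z) > 0"
proof -
  let ?I = "\<lambda>w. integral {0..\<gamma>} (\<lambda>x. phi1 x z * phi1 x w + phi2 x z * phi2 x w)"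
  have g: "\<gamma> \<ge> 0" using gamma_pos by simp
  have 1: "((\<lambda>w. phi1 \<gamma> w * phi2 \<gamma> z - phi2 \<gamma> w * phi1 \<gamma> z) has_field_derivative (D1 * phi2 \<gamma> z - D2 * phi1 \<gamma> z)) (at z)"
    by (intro DERIV_diff DERIV_cmult_right d)
  have "(\<lambda>w. phi1 \<gamma> w * phi2 \<gamma> z - phi2 \<gamma> w * phi1 \<gamma> z) = (\<lambda>w. (w - z) * ?I w)"
  proof
    fix w show "phi1 \<gamma> w * phi2 \<gamma> z - phi2 \<gamma> w * phi1 \<gamma> z = (w - z) * ?I w"
      unfolding phi_wronskian[OF g, of w z] by (simp add: mult.commute)
  qed
  moreover obtain I' where "(?I has_field_derivative I') (at z)"
    using phi_pairing_holomorphic[of \<gamma> z] by (auto simp: holomorphic_on_def field_differentiable_def)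
  hence "((\<lambda>w. (w - z) * ?I w) has_field_derivative (1 - 0) * ?I z + I' * (z - z)) (at z)"
    by (intro DERIV_mult DERIV_diff DERIV_ident DERIV_const)
  ultimately have "D1 * phi2 \<gamma> z - D2 * phi1 \<gamma> z = ?I z"
    using DERIV_unique[OF 1] by simp
  thus ?thesis using phi_pairing_pos[OF z order_refl] by simp
qed

text \<open>At the zero psi(s) is \<open>c * phi\<close> with real nonzero \<open>c\<close>.
  Multiplication by \<open>c\<close> splits the derivative into \<open>c\<^sup>2\<close> times the
  positive \<open>phi\<close> term and the nonnegative psi term. On the other rim \<open>c\<close>
  times the Jost function is the Wronskian of psi(s) and psi(- s), of sign
  \<open>(- 1) ^ \<kappa>\<close> because \<open>x < m\<close>. The unknown sign of \<open>c\<close>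
  drops out of the product.\<close>

lemma rim_jost_deriv_sign:
  assumes x: "x \<in> {-m<..<m}" and J: "rim_jost 1 (of_real x) = 0"
  obtains D where "(rim_jost 1 has_field_derivative D) (at (of_real x))"
    "(- 1) ^ \<kappa> * (Re D * Re (rim_jost (- 1) (of_real x))) > 0"
proof -
  let ?z = "complex_of_real x"
  let ?s = "rim_root m ?z"
  have zb: "?z \<in> ball 0 m" by (rule of_real_in_ball[OF x])
  have zr: "?z \<in> \<real>" by simp
  have g: "\<gamma> \<ge> 0" using gamma_pos by simp
  have der: "\<exists>D. (f has_field_derivative D) (at ?z)" if "f holomorphic_on ball 0 m" for f
    using that zb by (metis holomorphic_derivI open_ball)
  obtain P1 P2 where P: "(phi1 \<gamma> has_field_derivative P1) (at ?z)" "(phi2 \<gamma> has_field_derivative P2) (at ?z)"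
    using der[OF phi_holomorphic(1)[OF g]] der[OF phi_holomorphic(2)[OF g]] by blast
  obtain S1 S2 where S: "((\<lambda>w. psi1 (rim_root m w) \<gamma>) has_field_derivative S1) (at ?z)"
      "((\<lambda>w. psi2 w (rim_root m w) \<gamma>) has_field_derivative S2) (at ?z)"
    using der[OF psi_holomorphic(1)[OF rim_root_holomorphic]] der[OF psi_holomorphic(2)[OF rim_root_holomorphic]] by blast
  let ?D = "(P1 * psi2 ?z ?s \<gamma> + S2 * phi1 \<gamma> ?z) - (P2 * psi1 ?s \<gamma> + S1 * phi2 \<gamma> ?z)"
  have "((\<lambda>w. phi1 \<gamma> w * psi2 w (rim_root m w) \<gamma> - phi2 \<gamma> w * psi1 (rim_root m w) \<gamma>) has_field_derivative ?D) (at ?z)"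
    by (intro DERIV_diff DERIV_mult P S)
  hence D: "(rim_jost 1 has_field_derivative ?D) (at ?z)" by (simp add: rim_jost_def[abs_def] jost_fn_def)
  have one: "(1::complex) \<in> {1, -1}" by simp
  obtain c where c: "c \<noteq> 0" "psi1 ?s \<gamma> = c * phi1 \<gamma> ?z" "psi2 ?z ?s \<gamma> = c * phi2 \<gamma> ?z"
    using rim_jost_parallel[OF x one J order_refl] by auto
  note sr = rim_root_of_real[OF x]
  define s where "s = sqrt (m\<^sup>2 - x\<^sup>2)"
  have s: "?s = of_real s" "s > 0" using sr by (auto simp: s_def)
  have pr: "phi1 \<gamma> ?z \<in> \<real>" "phi2 \<gamma> ?z \<in> \<real>" using phi_real[OF g zr] by auto
  have "c \<in> \<real>"
  proof (cases "phi1 \<gamma> ?z = 0")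
    case False
    hence "c = psi1 ?s \<gamma> / phi1 \<gamma> ?z" using c by simp
    thus ?thesis using pr psi_real(1) unfolding s by (metis Reals_divide)
  next
    case True
    hence "phi2 \<gamma> ?z \<noteq> 0" using phi_nz_real[OF zr order_refl] by auto
    hence "c = psi2 ?z ?s \<gamma> / phi2 \<gamma> ?z" using c by simp
    thus ?thesis using pr psi_real(2)[OF zr] unfolding s by (metis Reals_divide)
  qed
  then obtain r where r: "c = of_real r" by (auto elim: Reals_cases)
  have r0: "r \<noteq> 0" using c r by auto
  let ?E = "psi1 ?s \<gamma> * S2 - psi2 ?z ?s \<gamma> * S1"
  let ?P = "P1 * phi2 \<gamma> ?z - P2 * phi1 \<gamma> ?z"
  \<comment> \<open>In the terms with \<open>P1\<close>, \<open>P2\<close> psi is replaced by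
    \<open>c * phi\<close>; in those with \<open>S1\<close>, \<open>S2\<close> the product
    \<open>c * phi\<close> is read as psi.\<close>
  have "c * ?D = c * c * ?P + ?E"
    unfolding c(2,3) by (simp add: algebra_simps)
  hence "Re (c * ?D) = Re (c * c * ?P + ?E)" by (rule arg_cong)
  hence "r * Re ?D = r * r * Re ?P + Re ?E" unfolding r by (simp flip: of_real_mult)
  moreover have "r * r * Re ?P > 0" using r0 phi_wronskian_deriv[OF zr P] by (simp add: zero_less_mult_iff) (metis linorder_neqE_linordered_idom)
  ultimately have rD: "r * Re ?D > 0" using psi_wronskian_deriv_nonneg[OF x S] by linarith
  let ?w = "(x - m) * (2 * (- 1) ^ (\<kappa> - 1) * s ^ (2 * \<kappa> - 1))"
  have "c * rim_jost (- 1) ?z = psi1 ?s \<gamma> * psi2 ?z (- ?s) \<gamma> - psi2 ?z ?s \<gamma> * psi1 (- ?s) \<gamma>"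
    unfolding c(2,3) rim_jost_def jost_fn_def by (simp add: algebra_simps)
  also have "\<dots> = of_real ?w"
    unfolding psi_wronskian[OF gamma_pos] s by simp
  finally have "Re (c * rim_jost (- 1) ?z) = ?w" by (simp only: Re_complex_of_real)
  hence rJ: "r * Re (rim_jost (- 1) ?z) = ?w" unfolding r by simp
  have k: "\<kappa> = Suc (\<kappa> - 1)" using kappa by simp
  have "(- 1) ^ \<kappa> * ?w = (m - x) * 2 * s ^ (2 * \<kappa> - 1)"
    by (subst k, simp only: power_Suc) (simp add: algebra_simps flip: power_mult_distrib)
  also have "\<dots> > 0" using x s by simp
  finally have "(- 1) ^ \<kappa> * (r * Re (rim_jost (- 1) ?z)) > 0" unfolding rJ .
  hence "(r * Re ?D) * ((- 1) ^ \<kappa> * (r * Re (rim_jost (- 1) ?z))) > 0" by (rule mult_pos_pos[OF rD])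
  hence "(r * r) * ((- 1) ^ \<kappa> * (Re ?D * Re (rim_jost (- 1) ?z))) > 0" by (simp add: mult_ac)
  hence "(- 1) ^ \<kappa> * (Re ?D * Re (rim_jost (- 1) ?z)) > 0"
    using r0 by (metis not_square_less_zero zero_less_mult_iff)
  with D show thesis by (rule that)
qed

text \<open>The product of the derivative and the value on the other rim has the same sign at both
  zeros, while the derivatives have opposite signs. That product is nonzero, so both derivatives
  are, and the weak inequality of \<open>DERIV_opposite_signs\<close> is strict.\<close>

lemma rim_jost_consecutive_zeros:
  assumes x: "x1 \<in> {-m<..<m}" "x2 \<in> {-m<..<m}" "x1 < x2"
    and J: "rim_jost 1 (of_real x1) = 0" "rim_jost 1 (of_real x2) = 0"
    and nz: "\<And>x. x \<in> {x1<..<x2} \<Longrightarrow> rim_jost 1 (of_real x) \<noteq> 0"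
  shows "Re (rim_jost (- 1) (of_real x1)) * Re (rim_jost (- 1) (of_real x2)) < 0"
proof -
  obtain D where D: "(rim_jost 1 has_field_derivative D) (at (of_real x1))"
    "(- 1) ^ \<kappa> * (Re D * Re (rim_jost (- 1) (of_real x1))) > 0" using rim_jost_deriv_sign[OF x(1) J(1)] by blast
  obtain E where E: "(rim_jost 1 has_field_derivative E) (at (of_real x2))"
    "(- 1) ^ \<kappa> * (Re E * Re (rim_jost (- 1) (of_real x2))) > 0" using rim_jost_deriv_sign[OF x(2) J(2)] by blast
  have sub: "x \<in> {-m<..<m}" if "x \<in> {x1..x2}" for x using x that by auto
  have "continuous_on {x1..x2} (\<lambda>x. rim_jost 1 (of_real x))"
  proof (rule continuous_on_compose2[OF holomorphic_on_imp_continuous_on[OF rim_jost_holomorphic]])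
    show "complex_of_real ` {x1..x2} \<subseteq> ball 0 m" using sub of_real_in_ball by blast
  qed (intro continuous_intros)
  hence c: "continuous_on {x1..x2} (\<lambda>x. Re (rim_jost 1 (of_real x)))" by (rule continuous_on_Re)
  have "Re D * Re E \<le> 0"
  proof (rule DERIV_opposite_signs[OF x(3) _ _ _ c DERIV_Re_of_real[OF D(1)] DERIV_Re_of_real[OF E(1)]])
    fix y assume y: "y \<in> {x1<..<x2}"
    have "rim_jost 1 (of_real y) \<in> \<real>" using y by (intro rim_jost_real sub) auto
    thus "Re (rim_jost 1 (of_real y)) \<noteq> 0" using nz[OF y] by (auto simp: complex_is_Real_iff complex_eq_iff)
  qed (use J in auto)
  moreover have "Re D \<noteq> 0" "Re E \<noteq> 0" using D(2) E(2) by auto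
  ultimately have DE: "Re D * Re E < 0" by (metis mult_eq_0_iff order_le_less)
  define a where "a = Re (rim_jost (- 1) (of_real x1))"
  define b where "b = Re (rim_jost (- 1) (of_real x2))"
  have "((- 1) ^ \<kappa> * (Re D * a)) * ((- 1) ^ \<kappa> * (Re E * b)) > 0" using D(2) E(2) unfolding a_def b_def by (rule mult_pos_pos)
  moreover have "((- 1) ^ \<kappa> * (Re D * a)) * ((- 1) ^ \<kappa> * (Re E * b)) = ((- 1) ^ \<kappa> * (- 1) ^ \<kappa>) * ((Re D * Re E) * (a * b))"
    by (simp only: mult_ac)
  moreover have "(- 1) ^ \<kappa> * (- 1) ^ \<kappa> = (1::real)" by (simp flip: power_mult_distrib)
  ultimately have "(Re D * Re E) * (a * b) > 0" by simp
  moreover have "q < 0" if "p * q > 0" "p < 0" for p q :: real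
    using that by (auto simp: zero_less_mult_iff)
  ultimately have "a * b < 0" using DE by blast
  thus ?thesis by (simp add: a_def b_def)
qed

text \<open>The test function \<open>phi\<close> times a bump makes both pairings in the numerator equal to a
  positive number.\<close>

lemma bump_pairing:
  assumes z: "z \<in> \<real>"
  obtains h where "h \<in> test_functions"
    "\<And>X. X \<ge> \<gamma> \<Longrightarrow> integral {0..X} (\<lambda>y. cnj (cutoff (\<lambda>x. fst (h x)) y) * phi1 y z + cnj (cutoff (\<lambda>x. snd (h x)) y) * phi2 y z) \<noteq> 0"
    "\<And>X. X \<ge> \<gamma> \<Longrightarrow> integral {0..X} (\<lambda>y. cutoff (\<lambda>x. fst (h x)) y * phi1 y z + cutoff (\<lambda>x. snd (h x)) y * phi2 y z) \<noteq> 0"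
proof -
  obtain x0 where x0: "x0 \<in> {0<..<\<gamma>}" "phi2 x0 z \<noteq> 0" using phi_nz by blast
  \<comment> \<open>A tent with peak 1 at \<open>x0\<close> and half-width \<open>x0 / 2\<close>,
    which keeps its support away from 0.\<close>
  define \<beta> where "\<beta> = (\<lambda>x. max 0 (1 - \<bar>x - x0\<bar> / (x0 / 2)))"
  define h where "h = (\<lambda>x. (complex_of_real (\<beta> x) * phi1 x z, complex_of_real (\<beta> x) * phi2 x z))"
  have \<beta>c: "continuous_on A \<beta>" for A unfolding \<beta>_def using x0 by (intro continuous_intros) auto
  have \<beta>0: "\<beta> x = 0" if "x \<notin> {x0/2..3*x0/2}" for x using that x0 by (auto simp: \<beta>_def field_simps abs_if max_def)
  have \<beta>x0: "\<beta> x0 = 1" by (simp add: \<beta>_def)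
  have \<beta>pos: "\<beta> x \<ge> 0" for x by (simp add: \<beta>_def)
  have "h \<in> test_functions"
    unfolding test_functions_def
  proof (intro CollectI conjI)
    show "continuous_on {0<..} h" unfolding h_def
      by (intro continuous_intros \<beta>c continuous_on_subset[OF phi_continuous(1)] continuous_on_subset[OF phi_continuous(2)]) auto
    show "\<exists>K. compact K \<and> K \<subseteq> {0<..} \<and> (\<forall>x\<in>{0<..} - K. h x = 0)"
      by (rule exI[of _ "{x0/2..3*x0/2}"]) (use x0 \<beta>0 in \<open>auto simp: h_def zero_prod_def\<close>)
    show "\<exists>x>0. h x \<noteq> 0" using x0 \<beta>x0 by (intro exI[of _ x0]) (auto simp: h_def zero_prod_def)
  qed
  moreover
  have pairing: "integral {0..X} (\<lambda>y. cutoff (\<lambda>x. fst (h x)) y * phi1 y z + cutoff (\<lambda>x. snd (h x)) y * phi2 y z) \<noteq> 0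
     \<and> integral {0..X} (\<lambda>y. cnj (cutoff (\<lambda>x. fst (h x)) y) * phi1 y z + cnj (cutoff (\<lambda>x. snd (h x)) y) * phi2 y z) \<noteq> 0"
    if X: "X \<ge> \<gamma>" for X
  proof -
    \<comment> \<open>The square root distributes the nonnegative weight over both factors, so that
      the pairing becomes an integral of squared moduli. Since \<open>phi\<close> is real at real
      \<open>z\<close>, conjugating \<open>h\<close> gives the same integrand.\<close>
    define f where "f = (\<lambda>y. complex_of_real (sqrt (\<beta> y)) * phi1 y z)"
    define g where "g = (\<lambda>y. complex_of_real (sqrt (\<beta> y)) * phi2 y z)"
    have fc: "continuous_on {0..X} f" "continuous_on {0..X} g"
      unfolding f_def g_def
      by (intro continuous_intros \<beta>c continuous_on_subset[OF phi_continuous(1)] continuous_on_subset[OF phi_continuous(2)]; auto)+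
    have sq: "complex_of_real (sqrt (\<beta> y)) * of_real (sqrt (\<beta> y)) = of_real (\<beta> y)" for y
      using \<beta>pos[of y] by (simp flip: of_real_mult)
    have eq: "cutoff (\<lambda>x. fst (h x)) y * phi1 y z + cutoff (\<lambda>x. snd (h x)) y * phi2 y z = f y * cnj (f y) + g y * cnj (g y)"
      "cnj (cutoff (\<lambda>x. fst (h x)) y) * phi1 y z + cnj (cutoff (\<lambda>x. snd (h x)) y) * phi2 y z = f y * cnj (f y) + g y * cnj (g y)"
      if "y \<in> {0..X}" for y
    proof -
      have r: "cnj (phi1 y z) = phi1 y z" "cnj (phi2 y z) = phi2 y z" using phi_real[of y z] z that by (auto simp: Reals_cnj_iff)
      have fg: "f y * cnj (f y) + g y * cnj (g y) = of_real (\<beta> y) * phi1 y z * phi1 y z + of_real (\<beta> y) * phi2 y z * phi2 y z"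
        unfolding f_def g_def sq[symmetric] by (simp add: r mult_ac)
      show "cutoff (\<lambda>x. fst (h x)) y * phi1 y z + cutoff (\<lambda>x. snd (h x)) y * phi2 y z = f y * cnj (f y) + g y * cnj (g y)"
        "cnj (cutoff (\<lambda>x. fst (h x)) y) * phi1 y z + cnj (cutoff (\<lambda>x. snd (h x)) y) * phi2 y z = f y * cnj (f y) + g y * cnj (g y)"
        unfolding fg using that by (auto simp: cutoff_def h_def r phi_0)
    qed
    have gx0: "g x0 \<noteq> 0" using x0 \<beta>x0 by (simp add: g_def)
    have x0X: "x0 \<in> {0<..<X}" using x0 X by auto
    have "Re (integral {0..X} (\<lambda>y. f y * cnj (f y) + g y * cnj (g y))) > 0"
      by (rule integral_cmod_square_pos(1)[OF fc x0X gx0])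
    hence "integral {0..X} (\<lambda>y. f y * cnj (f y) + g y * cnj (g y)) \<noteq> 0" by auto
    moreover have "integral {0..X} (\<lambda>y. cutoff (\<lambda>x. fst (h x)) y * phi1 y z + cutoff (\<lambda>x. snd (h x)) y * phi2 y z)
        = integral {0..X} (\<lambda>y. f y * cnj (f y) + g y * cnj (g y))"
      by (rule integral_cong) (rule eq(1))
    moreover have "integral {0..X} (\<lambda>y. cnj (cutoff (\<lambda>x. fst (h x)) y) * phi1 y z + cnj (cutoff (\<lambda>x. snd (h x)) y) * phi2 y z)
        = integral {0..X} (\<lambda>y. f y * cnj (f y) + g y * cnj (g y))"
      by (rule integral_cong) (rule eq(2))
    ultimately show ?thesis by metis
  qed
  ultimately show thesis using that[of h] by blast
qed

section \<open>Pole orders and multiplicities on the rims\<close>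

definition rim_point :: "complex \<Rightarrow> real \<Rightarrow> cut_point" where
  "rim_point \<sigma> x = (if \<sigma> = 1 then Upper x else Lower x)"

lemma Phi_pole_rim_point:
  "Phi_pole \<kappa> m v h (rim_point \<sigma> x) n \<longleftrightarrow>
     (\<exists>F. continuation m (Phi \<kappa> m v h) F \<and> extension_pole F (rim_side \<sigma>) (of_real x) n)"
  by (auto simp: Phi_pole_def rim_point_def rim_side_def)

text \<open>Numerator and Jost function are holomorphic across the rim, so
  \<open>quotient_pole_order\<close> applies to each test function separately.\<close>

lemma Phi_pole_order_le:
  assumes \<sigma>: "\<sigma> \<in> {1, -1}" and x: "x \<in> {-m<..<m}" and h: "h \<in> test_functions"
    and p: "Phi_pole \<kappa> m v h (rim_point \<sigma> x) n"
  shows "rim_jost \<sigma> (of_real x) = 0 \<and> n \<le> nat (zorder (rim_jost \<sigma>) (of_real x))"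
proof -
  obtain X A C where X: "X \<ge> \<gamma>" and K: "\<forall>\<sigma>\<in>{1,-1}. A holomorphic_on ball 0 m \<and> C \<sigma> holomorphic_on ball 0 m \<and>
      (\<forall>x\<in>{-m<..<m}. \<forall>n. (\<exists>F. continuation m (Phi \<kappa> m v h) F \<and> extension_pole F (rim_side \<sigma>) (of_real x) n) \<longleftrightarrow>
          pole_of_order_at (\<lambda>z. A z - C \<sigma> z / rim_jost \<sigma> z) (of_real x) n) \<and>
      (\<forall>x\<in>{-m<..<m}. rim_jost \<sigma> (of_real x) = 0 \<longrightarrow> (\<exists>c. c \<noteq> 0 \<and> C \<sigma> (of_real x) =
          c * integral {0..X} (\<lambda>y. cnj (cutoff (\<lambda>x. fst (h x)) y) * phi1 y (of_real x) + cnj (cutoff (\<lambda>x. snd (h x)) y) * phi2 y (of_real x)) *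
            integral {0..X} (\<lambda>y. cutoff (\<lambda>x. fst (h x)) y * phi1 y (of_real x) + cutoff (\<lambda>x. snd (h x)) y * phi2 y (of_real x))))"
    using Phi_pole_iff[OF h] by (elim exE conjE) (rule that)
  note K\<sigma> = bspec[OF K \<sigma>]
  note AC = conjunct1[OF K\<sigma>] conjunct1[OF conjunct2[OF K\<sigma>]]
    and iff = bspec[OF conjunct1[OF conjunct2[OF conjunct2[OF K\<sigma>]]] x, rule_format]
    and C = bspec[OF conjunct2[OF conjunct2[OF conjunct2[OF K\<sigma>]]] x, rule_format]
  have an: "A analytic_on {of_real x}" "C \<sigma> analytic_on {of_real x}" "rim_jost \<sigma> analytic_on {of_real x}"
    using of_real_in_ball[OF x] AC rim_jost_holomorphic[of \<sigma>] open_ball[of 0 m] unfolding analytic_at by blast+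
  have ev: "\<forall>\<^sub>F w in at (of_real x). rim_jost \<sigma> w \<noteq> 0"
    using rim_jost_eventually_nz[OF \<sigma> x] by eventually_elim auto
  have "pole_of_order_at (\<lambda>z. A z - C \<sigma> z / rim_jost \<sigma> z) (of_real x) n"
    using p unfolding Phi_pole_rim_point iff .
  from quotient_pole_order[OF an ev this] show ?thesis by blast
qed

text \<open>The test function of \<open>bump_pairing\<close> makes both pairings in the numerator
  nonzero, so the full order of the zero appears as a pole order.\<close>

lemma Phi_pole_order_attained:
  assumes \<sigma>: "\<sigma> \<in> {1, -1}" and x: "x \<in> {-m<..<m}" and J: "rim_jost \<sigma> (of_real x) = 0"
  shows "\<exists>h\<in>test_functions. Phi_pole \<kappa> m v h (rim_point \<sigma> x) (nat (zorder (rim_jost \<sigma>) (of_real x)))"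
proof -
  obtain h where h: "h \<in> test_functions"
    and n1: "\<And>X. X \<ge> \<gamma> \<Longrightarrow> integral {0..X} (\<lambda>y. cnj (cutoff (\<lambda>x. fst (h x)) y) * phi1 y (of_real x) + cnj (cutoff (\<lambda>x. snd (h x)) y) * phi2 y (of_real x)) \<noteq> 0"
    and n2: "\<And>X. X \<ge> \<gamma> \<Longrightarrow> integral {0..X} (\<lambda>y. cutoff (\<lambda>x. fst (h x)) y * phi1 y (of_real x) + cutoff (\<lambda>x. snd (h x)) y * phi2 y (of_real x)) \<noteq> 0"
    using bump_pairing[of "of_real x"] by auto
  obtain X A C where X: "X \<ge> \<gamma>" and K: "\<forall>\<sigma>\<in>{1,-1}. A holomorphic_on ball 0 m \<and> C \<sigma> holomorphic_on ball 0 m \<and>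
      (\<forall>x\<in>{-m<..<m}. \<forall>n. (\<exists>F. continuation m (Phi \<kappa> m v h) F \<and> extension_pole F (rim_side \<sigma>) (of_real x) n) \<longleftrightarrow>
          pole_of_order_at (\<lambda>z. A z - C \<sigma> z / rim_jost \<sigma> z) (of_real x) n) \<and>
      (\<forall>x\<in>{-m<..<m}. rim_jost \<sigma> (of_real x) = 0 \<longrightarrow> (\<exists>c. c \<noteq> 0 \<and> C \<sigma> (of_real x) =
          c * integral {0..X} (\<lambda>y. cnj (cutoff (\<lambda>x. fst (h x)) y) * phi1 y (of_real x) + cnj (cutoff (\<lambda>x. snd (h x)) y) * phi2 y (of_real x)) *
            integral {0..X} (\<lambda>y. cutoff (\<lambda>x. fst (h x)) y * phi1 y (of_real x) + cutoff (\<lambda>x. snd (h x)) y * phi2 y (of_real x))))"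
    using Phi_pole_iff[OF h] by (elim exE conjE) (rule that)
  note K\<sigma> = bspec[OF K \<sigma>]
  note AC = conjunct1[OF K\<sigma>] conjunct1[OF conjunct2[OF K\<sigma>]]
    and iff = bspec[OF conjunct1[OF conjunct2[OF conjunct2[OF K\<sigma>]]] x, rule_format]
    and C = bspec[OF conjunct2[OF conjunct2[OF conjunct2[OF K\<sigma>]]] x, rule_format]
  have an: "A analytic_on {of_real x}" "C \<sigma> analytic_on {of_real x}" "rim_jost \<sigma> analytic_on {of_real x}"
    using of_real_in_ball[OF x] AC rim_jost_holomorphic[of \<sigma>] open_ball[of 0 m] unfolding analytic_at by blast+
  have ev: "\<forall>\<^sub>F w in at (of_real x). rim_jost \<sigma> w \<noteq> 0"
    using rim_jost_eventually_nz[OF \<sigma> x] by eventually_elim auto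
  have "C \<sigma> (of_real x) \<noteq> 0" using C[OF J] n1[OF X] n2[OF X] by auto
  from quotient_pole_order_attained(1)[OF an ev J this]
  have "Phi_pole \<kappa> m v h (rim_point \<sigma> x) (nat (zorder (rim_jost \<sigma>) (of_real x)))"
    unfolding Phi_pole_rim_point iff .
  with h show ?thesis by blast
qed

lemma has_Phi_pole_rim_iff:
  assumes "\<sigma> \<in> {1, -1}" "x \<in> {-m<..<m}"
  shows "has_Phi_pole \<kappa> m v (rim_point \<sigma> x) \<longleftrightarrow> rim_jost \<sigma> (of_real x) = 0"
  unfolding has_Phi_pole_def using Phi_pole_order_le[OF assms] Phi_pole_order_attained[OF assms] by blast

lemma state_multiplicity_rim:
  assumes "\<sigma> \<in> {1, -1}" "x \<in> {-m<..<m}" "rim_jost \<sigma> (of_real x) = 0"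
  shows "state_multiplicity \<kappa> m v (rim_point \<sigma> x) = enat (nat (zorder (rim_jost \<sigma>) (of_real x)))"
  unfolding state_multiplicity_def
proof (rule Sup_eqI)
  fix y assume "y \<in> {enat n |n. \<exists>h\<in>test_functions. Phi_pole \<kappa> m v h (rim_point \<sigma> x) n}"
  thus "y \<le> enat (nat (zorder (rim_jost \<sigma>) (of_real x)))"
    using Phi_pole_order_le[OF assms(1,2)] by auto
next
  fix y assume y: "\<And>z. z \<in> {enat n |n. \<exists>h\<in>test_functions. Phi_pole \<kappa> m v h (rim_point \<sigma> x) n} \<Longrightarrow> z \<le> y"
  show "enat (nat (zorder (rim_jost \<sigma>) (of_real x))) \<le> y"
    by (rule y) (use Phi_pole_order_attained[OF assms] in blast)
qed

lemma is_eigenvalue_iff: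
  "is_eigenvalue \<kappa> m v p \<longleftrightarrow> (\<exists>x\<in>{-m<..<m}. p = Upper x \<and> rim_jost 1 (of_real x) = 0)"
  using has_Phi_pole_rim_iff[of 1] by (auto simp: is_eigenvalue_def g_plus_def rim_point_def)

lemma is_antibound_iff:
  "is_antibound \<kappa> m v p \<longleftrightarrow> (\<exists>x\<in>{-m<..<m}. p = Lower x \<and> rim_jost (- 1) (of_real x) = 0)"
  using has_Phi_pole_rim_iff[of "- 1"]
  by (auto simp: is_antibound_def is_state_def is_eigenvalue_def is_resonance_def is_virtual_state_def
      g_plus_def g_minus_def Lambda_minus_def rim_point_def)

lemma antibound_states_odd:
  assumes x: "x1 \<in> {-m<..<m}" "x2 \<in> {-m<..<m}" "x1 < x2"
    and e: "is_eigenvalue \<kappa> m v (Upper x1)" "is_eigenvalue \<kappa> m v (Upper x2)" "\<forall>x\<in>{x1<..<x2}. \<not> is_eigenvalue \<kappa> m v (Upper x)"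
  shows "finite {p \<in> Lower ` {x1<..<x2}. is_antibound \<kappa> m v p} \<and>
     (\<exists>n. odd n \<and> n \<ge> 1 \<and> (\<Sum>p\<in>{p \<in> Lower ` {x1<..<x2}. is_antibound \<kappa> m v p}. state_multiplicity \<kappa> m v p) = enat n)"
proof -
  have sub: "x \<in> {-m<..<m}" if "x \<in> {x1..x2}" for x using x that by auto
  have J: "rim_jost 1 (of_real x1) = 0" "rim_jost 1 (of_real x2) = 0" using e(1,2) by (auto simp: is_eigenvalue_iff)
  have nz: "rim_jost 1 (of_real y) \<noteq> 0" if "y \<in> {x1<..<x2}" for y
    using e(3) that sub[of y] by (force simp: is_eigenvalue_iff)
  have neg: "Re (rim_jost (- 1) (of_real x1)) * Re (rim_jost (- 1) (of_real x2)) < 0"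
    by (rule rim_jost_consecutive_zeros[OF x J nz])
  let ?Z = "{x \<in> {x1<..<x2}. rim_jost (- 1) (of_real x) = 0}"
  have im: "complex_of_real ` {x1..x2} \<subseteq> ball 0 m" using sub of_real_in_ball by blast
  have re: "rim_jost (- 1) (of_real y) \<in> \<real>" if "y \<in> {x1..x2}" for y
    by (rule rim_jost_real[OF sub[OF that]]) simp
  \<comment> \<open>An eigenvalue at an end point excludes a zero on the lower rim there, so
    \<open>zeros_parity\<close> applies to the closed interval.\<close>
  have n0: "rim_jost (- 1) (of_real x1) \<noteq> 0" "rim_jost (- 1) (of_real x2) \<noteq> 0"
    by (rule rim_jost_not_both_zero[OF x(1) J(1)], rule rim_jost_not_both_zero[OF x(2) J(2)])
  note par = zeros_parity[OF rim_jost_holomorphic open_ball connected_ball im less_imp_le[OF x(3)] re n0]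
  have S: "{p \<in> Lower ` {x1<..<x2}. is_antibound \<kappa> m v p} = Lower ` ?Z"
    using sub by (auto simp: is_antibound_iff)
  have fin: "finite ?Z" by (rule par(1))
  have inj: "inj_on Lower A" for A by (auto simp: inj_on_def)
  \<comment> \<open>Each multiplicity on the rim is finite, so the sum in \<open>enat\<close> is
    that of natural numbers, to which parity applies.\<close>
  have enat_sum: "(\<Sum>y\<in>A. enat (f y)) = enat (\<Sum>y\<in>A. f y)" if "finite A" for A :: "real set" and f
    using that by (induction A) (auto simp: zero_enat_def)
  have "(\<Sum>p\<in>Lower ` ?Z. state_multiplicity \<kappa> m v p) = (\<Sum>y\<in>?Z. state_multiplicity \<kappa> m v (Lower y))"
    by (simp add: sum.reindex[OF inj])
  also have "\<dots> = (\<Sum>y\<in>?Z. enat (nat (zorder (rim_jost (- 1)) (of_real y))))"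
  proof (rule sum.cong)
    fix y assume y: "y \<in> ?Z"
    hence "y \<in> {-m<..<m}" by (intro sub) auto
    thus "state_multiplicity \<kappa> m v (Lower y) = enat (nat (zorder (rim_jost (- 1)) (of_real y)))"
      using state_multiplicity_rim[of "- 1" y] y by (auto simp: rim_point_def)
  qed simp
  also have "\<dots> = enat (\<Sum>y\<in>?Z. nat (zorder (rim_jost (- 1)) (of_real y)))" by (rule enat_sum[OF fin])
  finally have sum: "(\<Sum>p\<in>Lower ` ?Z. state_multiplicity \<kappa> m v p) = enat (\<Sum>y\<in>?Z. nat (zorder (rim_jost (- 1)) (of_real y)))" .
  have odd: "odd (\<Sum>y\<in>?Z. nat (zorder (rim_jost (- 1)) (of_real y)))"
    using par(2) neg by blast
  show ?thesis
    unfolding S sum using fin odd odd_pos by (intro conjI finite_imageI exI[of _ "\<Sum>y\<in>?Z. nat (zorder (rim_jost (- 1)) (of_real y))"]) (auto simp: Suc_le_eq)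
qed

end

section \<open>Consequences of the hypotheses on the potential\<close>

lemma L2_loc_int:
  assumes "v \<in> L2"
  shows "loc_int (\<lambda>x. of_real (v x))"
proof -
  have "v absolutely_integrable_on {0..X}" for X
  proof -
    have v2: "integrable lebesgue (\<lambda>x. indicator {0<..} x *\<^sub>R (v x)\<^sup>2)"
      using L2_integrable[OF assms] by (simp add: integrable_restrict_space)
    have m0: "(\<lambda>x. indicator {0<..} x *\<^sub>R v x) \<in> borel_measurable lebesgue"
      by (rule iffD1[OF borel_measurable_restrict_space_iff L2_measurable[OF assms]]) simp
    have m: "(\<lambda>x. indicator {0<..X} x *\<^sub>R (indicator {0<..} x *\<^sub>R v x)) \<in> borel_measurable lebesgue"
      by (rule borel_measurable_scaleR[OF borel_measurable_indicator m0]) simp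
    have eq: "(\<lambda>x. indicator {0<..X} x *\<^sub>R (indicator {0<..} x *\<^sub>R v x)) = (\<lambda>x. indicator {0<..X} x *\<^sub>R v x)"
      by (auto simp: indicator_def fun_eq_iff)
    have "emeasure lborel {0<..X} < \<infinity>"
      by (rule emeasure_bounded_finite, rule bounded_subset[OF bounded_closed_interval[of 0 X]]) auto
    hence "integrable lebesgue (indicat_real {0<..X})"
      by (intro integrable_real_indicator) auto
    hence "integrable lebesgue (\<lambda>x. indicat_real {0<..X} x + indicator {0<..} x *\<^sub>R (v x)\<^sup>2)"
      using v2 by (rule Bochner_Integration.integrable_add)
    hence "integrable lebesgue (\<lambda>x. indicator {0<..X} x *\<^sub>R v x)"
    proof (rule Bochner_Integration.integrable_bound)
      show "(\<lambda>x. indicator {0<..X} x *\<^sub>R v x) \<in> borel_measurable lebesgue" using m unfolding eq .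
      show "AE x in lebesgue. norm (indicator {0<..X} x *\<^sub>R v x) \<le> norm (indicat_real {0<..X} x + indicator {0<..} x *\<^sub>R (v x)\<^sup>2)"
      proof (rule AE_I2)
        fix x
        \<comment> \<open>This bound turns square integrability into integrability on bounded
          intervals.\<close>
        have "\<bar>v x\<bar> \<le> 1 + (v x)\<^sup>2"
          using sum_squares_bound[of "\<bar>v x\<bar>" 1] by simp
        thus "norm (indicator {0<..X} x *\<^sub>R v x) \<le> norm (indicat_real {0<..X} x + indicator {0<..} x *\<^sub>R (v x)\<^sup>2)"
          by (auto simp: indicator_def)
      qed
    qed
    hence "v absolutely_integrable_on {0<..X}" by (simp add: set_integrable_def)
    thus ?thesis
      by (rule absolutely_integrable_spike_set) (auto intro: negligible_subset[of "{0}"])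
  qed
  thus ?thesis
    unfolding loc_int_def using absolutely_integrable_linear[OF _ bounded_linear_of_real]
    by (auto simp: o_def)
qed

text \<open>The complement of the essential support is covered by countably many null neighbourhoods.\<close>

lemma AE_zero_outside_ess_supp:
  assumes "ess_supp v \<subseteq> {0..\<gamma>}" "\<gamma> > 0"
  shows "AE x in lebesgue. x \<ge> \<gamma> \<longrightarrow> v x = 0"
proof -
  have nb: "\<exists>e>0. AE y in lebesgue. y > 0 \<longrightarrow> y \<in> ball x e \<longrightarrow> v y = 0" if "x > \<gamma>" for x
  proof -
    have "x \<notin> ess_supp v" using assms that by auto
    thus ?thesis unfolding ess_supp_def AE_half_line_iff by auto
  qed
  then obtain e where e: "\<And>x. x > \<gamma> \<Longrightarrow> e x > 0" "\<And>x. x > \<gamma> \<Longrightarrow> AE y in lebesgue. y > 0 \<longrightarrow> y \<in> ball x (e x) \<longrightarrow> v y = 0"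
    by metis
  define F where "F = (\<lambda>x. ball x (e x)) ` {\<gamma><..}"
  obtain F' where F': "F' \<subseteq> F" "countable F'" "\<Union>F' = \<Union>F"
    using Lindelof[of F] by (auto simp: F_def)
  have "AE y in lebesgue. \<forall>B\<in>F'. y > 0 \<longrightarrow> y \<in> B \<longrightarrow> v y = 0"
    unfolding AE_ball_countable[OF F'(2)] using F'(1) e(2) by (auto simp: F_def)
  moreover have "AE y in lebesgue. y \<noteq> \<gamma>" by (rule AE_I'[of "{\<gamma>}"]) auto
  ultimately show ?thesis
  proof eventually_elim
    case (elim y)
    show ?case
    proof
      assume "y \<ge> \<gamma>"
      hence y: "y > \<gamma>" using elim(2) by simp
      have "y \<in> \<Union>F" using e(1)[OF y] y by (auto simp: F_def intro!: bexI[of _ y])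
      then obtain B where "B \<in> F'" "y \<in> B" using F'(3) by blast
      thus "v y = 0" using elim(1) y assms(2) by auto
    qed
  qed
qed

theorem theorem2p4:
  fixes \<kappa> :: nat and m \<gamma> :: real and v :: "real \<Rightarrow> real"
  assumes "\<kappa> \<ge> 1" and "m > 0"
    and "v \<in> L2"
    and "ess_supp v \<noteq> {}" and "ess_supp v \<subseteq> {0..\<gamma>}"
    and "\<gamma> = Sup (ess_supp v)" and "\<gamma> > 0"
  shows "finite {p. is_eigenvalue \<kappa> m v p}
    \<and> (\<forall>x\<in>{-m<..<m}. is_eigenvalue \<kappa> m v (Upper x) \<longrightarrow> \<not> is_antibound \<kappa> m v (Lower x))
    \<and> (\<forall>x1\<in>{-m<..<m}. \<forall>x2\<in>{-m<..<m}.
         x1 < x2 \<longrightarrow> is_eigenvalue \<kappa> m v (Upper x1) \<longrightarrow> is_eigenvalue \<kappa> m v (Upper x2) \<longrightarrow>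
         (\<forall>x\<in>{x1<..<x2}. \<not> is_eigenvalue \<kappa> m v (Upper x)) \<longrightarrow>
         finite {p \<in> Lower ` {x1<..<x2}. is_antibound \<kappa> m v p} \<and>
         (\<exists>n. odd n \<and> n \<ge> 1 \<and>
            (\<Sum>p\<in>{p \<in> Lower ` {x1<..<x2}. is_antibound \<kappa> m v p}. state_multiplicity \<kappa> m v p) = enat n))"
proof -
  interpret dirac \<kappa> m \<gamma> v
    by unfold_locales (use assms L2_loc_int AE_zero_outside_ess_supp in auto)
  \<comment> \<open>The source is zero and the leading coefficient \<open>\<delta>\<close> is 1:
    nonzero, to make the solution nontrivial for every \<open>z\<close>, and real, to make it real
    on the real axis.\<close>
  have "\<exists>f1 f2. entire_param f1 \<and> entire_param f2 \<and>
    (\<forall>z. sol {0<..} z (\<lambda>_. 0) (\<lambda>_. 0) (\<lambda>x. f1 x z) (\<lambda>x. f2 x z)) \<and>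
    (\<forall>z. \<exists>C. \<forall>x\<in>{0..1}. norm (f1 x z) \<le> C * x \<and> norm (f2 x z) \<le> C * x) \<and>
    (\<forall>z. \<exists>x\<in>{0<..<\<gamma>}. f2 x z \<noteq> 0) \<and>
    (\<forall>x z. x \<ge> 0 \<longrightarrow> z \<in> \<real> \<longrightarrow> f1 x z \<in> \<real> \<and> f2 x z \<in> \<real>)"
    using regular_solution_entire[OF continuous_on_const continuous_on_const zero_less_one, of 0 0 1] by simp
  then obtain phi1 phi2 where phi: "entire_param phi1" "entire_param phi2"
    "\<forall>z. sol {0<..} z (\<lambda>_. 0) (\<lambda>_. 0) (\<lambda>x. phi1 x z) (\<lambda>x. phi2 x z)"
    "\<forall>z. \<exists>C. \<forall>x\<in>{0..1}. norm (phi1 x z) \<le> C * x \<and> norm (phi2 x z) \<le> C * x"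
    "\<forall>z. \<exists>x\<in>{0<..<\<gamma>}. phi2 x z \<noteq> 0"
    "\<forall>x z. x \<ge> 0 \<longrightarrow> z \<in> \<real> \<longrightarrow> phi1 x z \<in> \<real> \<and> phi2 x z \<in> \<real>"
    by (elim exE conjE) (rule that)
  interpret dirac_regular \<kappa> m \<gamma> v phi1 phi2
    by unfold_locales (rule phi(1) phi(2) phi(3-6)[rule_format]; assumption)+
  have "{p. is_eigenvalue \<kappa> m v p} \<subseteq> Upper ` {x\<in>{-m<..<m}. rim_jost 1 (of_real x) = 0}"
    by (auto simp: is_eigenvalue_iff)
  hence "finite {p. is_eigenvalue \<kappa> m v p}"
    by (rule finite_subset) (intro finite_imageI rim_jost_zeros_finite)
  moreover have "\<not> is_antibound \<kappa> m v (Lower x)" if "x \<in> {-m<..<m}" "is_eigenvalue \<kappa> m v (Upper x)" for x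
    using that rim_jost_not_both_zero[OF that(1)] by (auto simp: is_eigenvalue_iff is_antibound_iff)
  ultimately show ?thesis
    using antibound_states_odd by blast
qed

end
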